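(* There is a sequence of real numbers $(\delta_n)_{n\ge 3}$ with $\delta_n\to0$ as $n\to\infty$ such that for every $n\ge3$ and every non-negative normal element $\Sigma=\sum_\sigma\alpha_\sigma\sigma\in\mathbb{R}[S_n]$, writing $|\Sigma|=\sum_{\sigma}\alpha_\sigma$, $$|\Sigma|-\lambda(S_n,\Sigma)\ \ge\ \left[\,|\Sigma|-\lambda(1,\Sigma)\,\right]\cdot(1-\delta_n).$$
   Context: An element $\Sigma=\sum_{\sigma\in S_n}\alpha_\sigma\sigma\in\mathbb{R}[S_n]$ is non-negative if $\alpha_\sigma\ge0$ for all $\sigma$, and normal if $\sigma\mapsto\alpha_\sigma$ is constant on each conjugacy class. For a representation $\rho$ of $S_n$, $\rho(\Sigma)=\sum_\sigma\alpha_\sigma\rho(\sigma)$. $\widehat{S_n}$ is the set of complex irreducible representations of $S_n$, with $\mathrm{triv}$ and $\mathrm{sgn}$ the trivial and sign representations. For normal $\Sigma$ all eigenvalues of $\rho(\Sigma)$ are real; $\lambda_1(\rho(\Sigma))$ denotes the largest one, and $$\lambda(S_n,\Sigma)=\max_{\rho\in\widehat{S_n}\setminus\{\mathrm{triv},\mathrm{sgn}\}}\lambda_1(\rho(\Sigma)).$$ $\lambda(1,\Sigma)$ is the largest eigenvalue of the $n\times n$ matrix $\sum_\sigma\alpha_\sigma P_\sigma$, where $P_\sigma$ is the permutation matrix of $\sigma$ acting on $\{1,\dots,n\}$, having an eigenvector orthogonal to the constant functions; it is the second eigenvalue of the (weighted) Schreier graph of $S_n$ acting on $\{1,\dots,n\}$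 with respect to $\Sigma$. *)

theory Defs
  imports
    "HOL-Algebra.Sym_Groups"
    "Jordan_Normal_Form.Char_Poly"
    "Jordan_Normal_Form.VS_Connect"
begin

text \<open>An element \<open>\<Sum>\<sigma>. \<alpha> \<sigma> \<cdot> \<sigma>\<close> of the real group algebra of the symmetric group is given by its
  coefficient function \<open>\<alpha>\<close>; only the values of \<open>\<alpha>\<close> on permutations of \<open>{1..n}\<close> matter.\<close>

definition nonneg_elem :: "nat \<Rightarrow> ((nat \<Rightarrow> nat) \<Rightarrow> real) \<Rightarrow> bool" where
  "nonneg_elem n \<alpha> \<longleftrightarrow> (\<forall>\<sigma>\<in>carrier (sym_group n). 0 \<le> \<alpha> \<sigma>)"

definition normal_elem :: "nat \<Rightarrow> ((nat \<Rightarrow> nat) \<Rightarrow> real) \<Rightarrow> bool" where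
  "normal_elem n \<alpha> \<longleftrightarrow>
     (\<forall>\<sigma>\<in>carrier (sym_group n). \<forall>\<tau>\<in>carrier (sym_group n).
        \<alpha> (\<tau> \<otimes>\<^bsub>sym_group n\<^esub> \<sigma> \<otimes>\<^bsub>sym_group n\<^esub> inv\<^bsub>sym_group n\<^esub> \<tau>) = \<alpha> \<sigma>)"

definition total_weight :: "nat \<Rightarrow> ((nat \<Rightarrow> nat) \<Rightarrow> real) \<Rightarrow> real" where
  "total_weight n \<alpha> = (\<Sum>\<sigma>\<in>carrier (sym_group n). \<alpha> \<sigma>)"

text \<open>Finite-dimensional complex representations in coordinates: homomorphisms to the group of
  invertible \<open>d \<times> d\<close> matrices.\<close>

definition is_rep :: "nat \<Rightarrow> nat \<Rightarrow> ((nat \<Rightarrow> nat) \<Rightarrow> complex mat) \<Rightarrow> bool" where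
  "is_rep n d \<rho> \<longleftrightarrow> \<rho> \<in> hom (sym_group n) (units_of (ring_mat TYPE(complex) d ()))"

definition irreducible_rep :: "nat \<Rightarrow> nat \<Rightarrow> ((nat \<Rightarrow> nat) \<Rightarrow> complex mat) \<Rightarrow> bool" where
  "irreducible_rep n d \<rho> \<longleftrightarrow>
     is_rep n d \<rho> \<and> 0 < d \<and>
     (\<forall>W. VectorSpace.subspace class_ring W (module_vec TYPE(complex) d) \<and>
          (\<forall>\<sigma>\<in>carrier (sym_group n). \<forall>w\<in>W. \<rho> \<sigma> *\<^sub>v w \<in> W) \<longrightarrow>
          W = {0\<^sub>v d} \<or> W = carrier_vec d)"

text \<open>The same change of basis \<open>P\<close> (with inverse \<open>Q\<close>) has to work for all group elements.\<close>

definition isomorphic_reps ::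
    "nat \<Rightarrow> ((nat \<Rightarrow> nat) \<Rightarrow> complex mat) \<Rightarrow> ((nat \<Rightarrow> nat) \<Rightarrow> complex mat) \<Rightarrow> bool" where
  "isomorphic_reps n \<rho> \<rho>' \<longleftrightarrow>
     (\<exists>P Q. \<forall>\<sigma>\<in>carrier (sym_group n). similar_mat_wit (\<rho> \<sigma>) (\<rho>' \<sigma>) P Q)"

definition triv_rep :: "(nat \<Rightarrow> nat) \<Rightarrow> complex mat" where
  "triv_rep \<sigma> = 1\<^sub>m 1"

definition sgn_rep :: "(nat \<Rightarrow> nat) \<Rightarrow> complex mat" where
  "sgn_rep \<sigma> = of_int (sign \<sigma>) \<cdot>\<^sub>m 1\<^sub>m 1"

definition perm_mat :: "nat \<Rightarrow> (nat \<Rightarrow> nat) \<Rightarrow> real mat" where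
  \<comment> \<open>matrix indices start at 0, whereas permutations act on \<open>{1..n}\<close>\<close>
  "perm_mat n \<sigma> = mat n n (\<lambda>(i, j). if \<sigma> (Suc j) = Suc i then 1 else 0)"

text \<open>The \<open>d \<times> d\<close> matrix \<open>\<Sum>\<sigma>. \<alpha> \<sigma> \<cdot> \<rho> \<sigma>\<close>, for \<open>\<rho>\<close> with real or complex entries.\<close>

definition rep_elem ::
    "nat \<Rightarrow> nat \<Rightarrow> ((nat \<Rightarrow> nat) \<Rightarrow> 'a::real_algebra_1 mat) \<Rightarrow> ((nat \<Rightarrow> nat) \<Rightarrow> real) \<Rightarrow> 'a mat" where
  "rep_elem n d \<rho> \<alpha> = mat d d (\<lambda>ij. \<Sum>\<sigma>\<in>carrier (sym_group n). \<alpha> \<sigma> *\<^sub>R (\<rho> \<sigma> $$ ij))"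

text \<open>Meant for matrices all of whose eigenvalues are real.\<close>

definition largest_eigenvalue :: "complex mat \<Rightarrow> real" where
  "largest_eigenvalue A = Max {x. eigenvalue A (complex_of_real x)}"

text \<open>The maximum is over all irreducible matrix representations rather than over isomorphism
  classes; isomorphic representations contribute the same value.\<close>

definition lambda_Sn :: "nat \<Rightarrow> ((nat \<Rightarrow> nat) \<Rightarrow> real) \<Rightarrow> real" where
  "lambda_Sn n \<alpha> =
     Max {largest_eigenvalue (rep_elem n d \<rho> \<alpha>) | d \<rho>.
            irreducible_rep n d \<rho> \<and>
            \<not> isomorphic_reps n \<rho> triv_rep \<and> \<not> isomorphic_reps n \<rho> sgn_rep}"

definition lambda_schreier :: "nat \<Rightarrow> ((nat \<Rightarrow> nat) \<Rightarrow> real) \<Rightarrow> real" where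
  "lambda_schreier n \<alpha> =
     Max {x. \<exists>v. eigenvector (rep_elem n n (perm_mat n) \<alpha>) v x \<and>
                 (\<forall>c. v \<bullet> vec n (\<lambda>_. c) = 0)}"

end

theory Submission
  imports
    Defs
    "HOL-Library.Poly_Mapping"
    "HOL-Computational_Algebra.Fundamental_Theorem_Algebra"
    "HOL-Combinatorics.Perm"
    "HOL-Combinatorics.Permutations"
    "HOL-Real_Asymp.Real_Asymp"
    "Jordan_Normal_Form.Spectral_Radius"
begin

text \<open>For normal \<open>\<Sigma>\<close> an irreducible representation \<open>\<rho>\<close> maps \<open>\<Sigma>\<close> to the scalar \<open>\<Sum>\<sigma>. \<alpha> \<sigma> * r \<sigma>\<close>, where
  \<open>r\<close> is the normalized character of \<open>\<rho>\<close>, and for the Schreier graph the scalar is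
  \<open>\<Sum>\<sigma>. \<alpha> \<sigma> * (1 - |supp \<sigma>| / (n - 1))\<close>. So it suffices to bound \<open>r \<sigma>\<close> by
  \<open>1 - (1 - o(1)) * |supp \<sigma>| / (n - 1)\<close>, uniformly in \<open>\<sigma>\<close> and in \<open>r\<close> other than the trivial and the
  sign character.

  Restricting to the permutations that fix a point outside the support of \<open>\<sigma>\<close> either identifies
  \<open>r\<close> as the character of the standard representation, for which the bound is an equality without
  the \<open>o(1)\<close>, or yields a proper character of the smaller group with at least the same value at
  \<open>\<sigma>\<close>. Iterating reduces the claim to an upper bound for \<open>r \<sigma>\<close> when \<open>\<sigma>\<close> has no fixed points.
  If \<open>\<sigma>\<close> moves few points, \<open>1 - r \<sigma>\<close> is bounded below by a constant, because \<open>1 - r\<close> behaves like a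
  squared length and commutators with transpositions produce a product of two transpositions.
  If \<open>\<sigma>\<close> moves many points, \<open>r \<sigma>\<close> is small: choose \<open>A\<close> disjoint from \<open>\<sigma> A\<close> with a third of the
  points. The part of the representation on which \<open>Sym A\<close> acts by a linear character contributes
  little since Young subgroups with two blocks give Gelfand pairs and the degree of the
  representation is large; on the rest one averages over the conjugates of \<open>\<sigma>\<close> by \<open>Sym A\<close>, whose
  correlations are mean squares of characters of \<open>Sym A\<close>, hence small.

  Representations enter only at the end. The character theory is done with functions on the group
  satisfying the functional equation \<open>sph\<close> of normalized irreducible characters, and with positive
  functionals on the real group algebra, which suffices because every permutation is conjugate to
  its inverse.\<close>


text \<open>The obstacle is uniformity in \<sigma>. With many fixed points \<open>r \<sigma>\<close>
  is close to 1, so smallness cannot be the goal, and a gap that depends on the number of points is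
  useless if that number grows while \<sigma> moves few points. Descending to the support separates
  the two regimes. The descent loses nothing: when a trivial or sign constituent stops it on m
  points, the value reached is at most \<open>1 - |supp| / (m - 1)\<close>, which increases with m.
  Afterwards crude bounds suffice. For bounded support a gap of size \<open>1 / (8 * m!)\<close>
  beats a Schreier loss of order \<open>1 / n\<close>; for large support any degree bound that tends
  to infinity works. Doing this without modules needs substitutes for complete reducibility and for
  the degree. If every element is conjugate to its inverse, central elements of the real group
  algebra are self-adjoint, so the centre splits over the reals, and a positive tracial functional
  is a nonnegative combination of normalized characters; this replaces restriction to subgroups. The
  degree is replaced by the mean square of the character, its inverse square.\<close>

abbreviation lookup :: "('a \<Rightarrow>\<^sub>0 'b::zero) \<Rightarrow> 'a \<Rightarrow> 'b" where
  "lookup \<equiv> Poly_Mapping.lookup"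

abbreviation keys :: "('a \<Rightarrow>\<^sub>0 'b::zero) \<Rightarrow> 'a set" where
  "keys \<equiv> Poly_Mapping.keys"

section \<open>Finitely supported functions as a real algebra\<close>

instantiation poly_mapping :: (type, real_vector) real_vector
begin

lift_definition scaleR_poly_mapping :: "real \<Rightarrow> ('a \<Rightarrow>\<^sub>0 'b) \<Rightarrow> 'a \<Rightarrow>\<^sub>0 'b"
  is "\<lambda>c f k. c *\<^sub>R f k"
  by (rule finite_subset) auto

instance
  by standard (transfer; simp add: fun_eq_iff scaleR_add_left scaleR_add_right)+

end

lemma lookup_scaleR [simp]: "lookup (c *\<^sub>R x) k = c *\<^sub>R lookup x k"
  by transfer simp

text \<open>Scalars act by multiplication with an element supported at the unit, so their
  compatibility with products reduces to associativity and to the centrality of that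
  element.\<close>

lemma lookup_scaleR_conv:
  fixes x :: "'a::monoid_add \<Rightarrow>\<^sub>0 'b::real_algebra_1"
  shows "c *\<^sub>R x = Poly_Mapping.single 0 (of_real c) * x"
  unfolding mult_map_scale_conv_mult [symmetric]
  by (rule poly_mapping_eqI) (simp add: Poly_Mapping.map.rep_eq when_def scaleR_conv_of_real)

lemma poly_mapping_expand:
  fixes x :: "'a \<Rightarrow>\<^sub>0 'b::comm_monoid_add"
  shows "x = (\<Sum>g\<in>keys x. Poly_Mapping.single g (lookup x g))"
proof (rule poly_mapping_eqI)
  fix k
  show "lookup x k = lookup (\<Sum>g\<in>keys x. Poly_Mapping.single g (lookup x g)) k"
  proof (cases "k \<in> keys x")
    case True
    then have "(\<Sum>g\<in>keys x. lookup (Poly_Mapping.single g (lookup x g)) k) = lookup x k"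
      by (subst sum.remove [of _ k]) (auto simp: lookup_single_not_eq intro!: sum.neutral)
    then show ?thesis by (simp add: lookup_sum)
  next
    case False
    then have "(\<Sum>g\<in>keys x. lookup (Poly_Mapping.single g (lookup x g)) k) = 0"
      by (intro sum.neutral) (auto simp: lookup_single when_def)
    then show ?thesis using False by (simp add: lookup_sum in_keys_iff)
  qed
qed

instance poly_mapping :: (monoid_add, real_algebra_1) real_algebra_1
proof
  fix c :: real and x y :: "'a \<Rightarrow>\<^sub>0 'b"
  show "c *\<^sub>R x * y = c *\<^sub>R (x * y)"
    by (simp add: lookup_scaleR_conv mult.assoc)
  have "Poly_Mapping.single 0 (of_real c) * x = x * Poly_Mapping.single 0 (of_real c)"
    by (subst (1 2) poly_mapping_expand [of x])
       (simp add: sum_distrib_left sum_distrib_right mult_single of_real_def)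
  then show "x * c *\<^sub>R y = c *\<^sub>R (x * y)"
    by (metis lookup_scaleR_conv mult.assoc)
qed

subsection \<open>The real group algebra\<close>

text \<open>Products of finitely supported functions are convolutions along \<open>+\<close>, so
  every group below is written additively, although none is assumed commutative.\<close>

type_synonym 'g grp_alg = "'g \<Rightarrow>\<^sub>0 real"

definition el :: "'g \<Rightarrow> 'g grp_alg" where
  "el g = Poly_Mapping.single g 1"

definition lext :: "('g \<Rightarrow> 'b::real_vector) \<Rightarrow> 'g grp_alg \<Rightarrow> 'b" where
  "lext F x = (\<Sum>g\<in>keys x. lookup x g *\<^sub>R F g)"

text \<open>The algebra of a subgroup is a subset of one ambient algebra, so elements of the algebra
  of a smaller symmetric group need no embedding map.\<close>

definition alg :: "'g set \<Rightarrow> 'g grp_alg set" where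
  "alg G = {x. keys x \<subseteq> G}"

lemma el_0: "el (0::'g::monoid_add) = 1"
  by (simp add: el_def)

lemma el_add: "el (g + h) = el g * el (h::'g::monoid_add)"
  by (simp add: el_def mult_single)

lemma grp_alg_expand: "x = (\<Sum>g\<in>keys x. lookup x g *\<^sub>R el g)"
proof -
  have "lookup x g *\<^sub>R el g = Poly_Mapping.single g (lookup x g)" for g
    by (rule poly_mapping_eqI) (simp add: el_def lookup_single when_def)
  then show ?thesis using poly_mapping_expand [of x] by simp
qed

lemma lext_superset:
  assumes "finite A" "keys x \<subseteq> A"
  shows "lext F x = (\<Sum>g\<in>A. lookup x g *\<^sub>R F g)"
  unfolding lext_def using assms
  by (intro sum.mono_neutral_left) (auto simp: in_keys_iff)

lemma lext_el [simp]: "lext F (el g) = F g"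
  by (simp add: lext_def el_def)

lemma linear_lext: "linear (lext F)"
proof (rule linearI)
  fix x y :: "'a grp_alg" and c :: real
  have "lext F z = (\<Sum>g\<in>keys x \<union> keys y. lookup z g *\<^sub>R F g)"
    if "keys z \<subseteq> keys x \<union> keys y" for z
    by (rule lext_superset) (use that in auto)
  moreover have "keys (x + y) \<subseteq> keys x \<union> keys y" by (rule keys_add)
  ultimately show "lext F (x + y) = lext F x + lext F y"
    by (simp add: lookup_add scaleR_add_left sum.distrib)
  have "lext F (c *\<^sub>R x) = (\<Sum>g\<in>keys x. lookup (c *\<^sub>R x) g *\<^sub>R F g)"
    by (rule lext_superset) (auto simp: in_keys_iff)
  then show "lext F (c *\<^sub>R x) = c *\<^sub>R lext F x"
    by (simp add: lext_def scaleR_sum_right)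
qed

lemmas lext_add = linear_add [OF linear_lext]
  and lext_scaleR = linear_cmul [OF linear_lext]
  and lext_0 = linear_0 [OF linear_lext]
  and lext_diff = linear_diff [OF linear_lext]
  and lext_uminus = linear_neg [OF linear_lext]
  and lext_sum = linear_sum [OF linear_lext]

lemmas lext_simps = lext_add lext_scaleR lext_0 lext_diff lext_uminus lext_sum

lemma el_in_alg [simp]: "el g \<in> alg G \<longleftrightarrow> g \<in> G"
  by (simp add: alg_def el_def)

lemma alg_mono: "G \<subseteq> H \<Longrightarrow> x \<in> alg G \<Longrightarrow> x \<in> alg H"
  by (auto simp: alg_def)

lemma subspace_alg: "Real_Vector_Spaces.subspace (alg G)"
proof (rule subspaceI)
  fix x y :: "'a grp_alg" and c :: real
  show "0 \<in> alg G" by (simp add: alg_def)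
  show "x + y \<in> alg G" if "x \<in> alg G" "y \<in> alg G"
    using that keys_add [of x y] by (auto simp: alg_def)
  show "c *\<^sub>R x \<in> alg G" if "x \<in> alg G"
    using that by (auto simp: alg_def in_keys_iff)
qed

lemmas alg_intros = subspace_0 [OF subspace_alg] subspace_add [OF subspace_alg]
  subspace_scale [OF subspace_alg] subspace_diff [OF subspace_alg] subspace_neg [OF subspace_alg]
  subspace_sum [OF subspace_alg]

text \<open>The standard way to check identities below: both sides are linear in each argument, so
  group elements suffice. Nested uses handle bilinear identities.\<close>

lemma alg_linear_eq:
  assumes "linear f" "linear f'" "\<And>h. h \<in> G \<Longrightarrow> f (el h) = f' (el h)" "x \<in> alg G"
  shows "f x = f' x"
proof -
  have "f x = (\<Sum>g\<in>keys x. lookup x g *\<^sub>R f (el g))"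
    by (subst grp_alg_expand [of x]) (simp add: linear_sum [OF assms(1)] linear_cmul [OF assms(1)])
  also have "\<dots> = (\<Sum>g\<in>keys x. lookup x g *\<^sub>R f' (el g))"
    using assms(3,4) by (intro sum.cong) (auto simp: alg_def)
  also have "\<dots> = f' x"
    by (subst (2) grp_alg_expand [of x]) (simp add: linear_sum [OF assms(2)] linear_cmul [OF assms(2)])
  finally show ?thesis .
qed

text \<open>In a unitary representation \<open>star x\<close> acts as the adjoint of
  \<open>x\<close>.\<close>

definition star :: "'g::group_add grp_alg \<Rightarrow> 'g grp_alg" where
  "star = lext (\<lambda>g. el (- g))"

lemma linear_star: "linear star"
  unfolding star_def by (rule linear_lext)

lemmas star_linear = linear_add [OF linear_star] linear_cmul [OF linear_star]
  linear_0 [OF linear_star] linear_diff [OF linear_star] linear_neg [OF linear_star]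
  linear_sum [OF linear_star]

lemma star_el [simp]: "star (el g) = el (- g)"
  by (simp add: star_def)

lemma linear_mult_right: "linear f \<Longrightarrow> linear (\<lambda>x. f x * (a::'a::real_algebra))"
  by (rule linearI) (simp_all add: linear_add linear_cmul algebra_simps)

lemma linear_mult_left: "linear f \<Longrightarrow> linear (\<lambda>x. (a::'a::real_algebra) * f x)"
  by (rule linearI) (simp_all add: linear_add linear_cmul algebra_simps)

lemma linear_comp: "linear f \<Longrightarrow> linear h \<Longrightarrow> linear (\<lambda>x. h (f x))"
  using linear_compose [of f h] by (simp add: o_def)

lemmas lin_intros = linear_mult_right linear_mult_left linear_comp [OF _ linear_star]
  linear_comp [OF _ linear_lext] linear_id [unfolded id_def]

lemma in_alg_UNIV: "x \<in> alg UNIV"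
  by (simp add: alg_def)

lemma star_mult: "star (x * y) = star y * star x"
proof (rule alg_linear_eq [where x = x and G = UNIV])
  fix g :: 'a
  show "star (el g * y) = star y * star (el g)"
  proof (rule alg_linear_eq [where x = y and G = UNIV])
    fix h :: 'a
    show "star (el g * el h) = star (el h) * star (el g)"
      by (simp flip: el_add add: minus_add)
  qed (auto intro!: lin_intros in_alg_UNIV)
qed (auto intro!: lin_intros in_alg_UNIV)

lemma star_star [simp]: "star (star x) = x"
  by (rule alg_linear_eq [where x = x and G = UNIV]) (auto intro!: lin_intros in_alg_UNIV)

lemma star_1 [simp]: "star 1 = 1"
  by (metis el_0 star_el minus_zero)

lemma lookup_star: "lookup (star x) g = lookup x (- g)"
proof (rule alg_linear_eq [where x = x and G = UNIV and f = "\<lambda>x. lookup (star x) g"])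
  show "linear (\<lambda>x. lookup (star x) g :: real)" "linear (\<lambda>x. lookup x (- g) :: real)"
    by (auto intro!: linearI simp: lookup_add star_linear)
  fix h :: 'a
  have "(- h = g) = (h = - g)" by (metis minus_minus)
  then show "lookup (star (el h)) g = lookup (el h) (- g)"
    by (simp only: star_el) (simp add: el_def lookup_single when_def)
qed (rule in_alg_UNIV)

section \<open>Finite subgroups and averages over them\<close>

definition subgrp :: "'g::group_add set \<Rightarrow> bool" where
  "subgrp G \<longleftrightarrow> finite G \<and> 0 \<in> G \<and> (\<forall>g\<in>G. \<forall>h\<in>G. g + h \<in> G) \<and> (\<forall>g\<in>G. - g \<in> G)"

lemma subgrpD:
  assumes "subgrp G"
  shows "finite G" "0 \<in> G" "g \<in> G \<Longrightarrow> h \<in> G \<Longrightarrow> g + h \<in> G" "g \<in> G \<Longrightarrow> - g \<in> G"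
    "g \<in> G \<Longrightarrow> h \<in> G \<Longrightarrow> g - h \<in> G"
  using assms by (auto simp: subgrp_def) (metis diff_conv_add_uminus)

lemma subgrp_card: "subgrp G \<Longrightarrow> card G > 0"
  by (auto simp: subgrp_def card_gt_0_iff)

lemma alg_mult:
  assumes "subgrp G" "x \<in> alg G" "y \<in> alg G"
  shows "x * y \<in> alg G"
proof -
  have "keys (x * y) \<subseteq> {a + b |a b. a \<in> keys x \<and> b \<in> keys y}" by (rule keys_mult)
  moreover have "a + b \<in> G" if "a \<in> keys x" "b \<in> keys y" for a b
    using that assms by (auto simp: alg_def intro: subgrpD(3))
  ultimately show ?thesis unfolding alg_def by blast
qed

lemma alg_1: "subgrp G \<Longrightarrow> 1 \<in> alg G"
  by (metis el_0 el_in_alg subgrpD(2))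

lemma alg_star:
  assumes "subgrp G" "x \<in> alg G"
  shows "star x \<in> alg G"
  unfolding alg_def
proof safe
  fix g assume "g \<in> keys (star x)"
  then have "- g \<in> keys x" by (simp add: in_keys_iff lookup_star)
  then have "- g \<in> G" using assms(2) by (auto simp: alg_def)
  then show "g \<in> G" using subgrpD(4) [OF assms(1), of "- g"] by simp
qed

definition avg :: "'g set \<Rightarrow> ('g \<Rightarrow> 'b::real_vector) \<Rightarrow> 'b" where
  "avg G f = (1 / real (card G)) *\<^sub>R (\<Sum>g\<in>G. f g)"

lemma avg_cong: "(\<And>g. g \<in> G \<Longrightarrow> f g = f' g) \<Longrightarrow> avg G f = avg G f'"
  by (simp add: avg_def)

lemma avg_const: "finite G \<Longrightarrow> G \<noteq> {} \<Longrightarrow> avg G (\<lambda>_. c) = c"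
  by (simp add: avg_def sum_constant_scaleR)

lemma avg_const_on: "subgrp G \<Longrightarrow> (\<And>g. g \<in> G \<Longrightarrow> f g = c) \<Longrightarrow> avg G f = c"
  using avg_cong [of G f "\<lambda>_. c"] avg_const [of G c] by (auto simp: subgrp_def)

lemma avg_mult_left: "avg G (\<lambda>g. c * f g) = c * avg G (f :: _ \<Rightarrow> 'a::real_algebra)"
  by (simp add: avg_def sum_distrib_left)

lemma avg_mult_right: "avg G (\<lambda>g. f g * c) = avg G (f :: _ \<Rightarrow> 'a::real_algebra) * c"
  by (simp add: avg_def sum_distrib_right)

lemma avg_add: "avg G (\<lambda>g. f g + h g) = avg G f + avg G h"
  by (simp add: avg_def sum.distrib scaleR_add_right)

lemma avg_sum: "avg G (\<lambda>g. \<Sum>i\<in>I. f i g) = (\<Sum>i\<in>I. avg G (f i))"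
  unfolding avg_def by (subst sum.swap) (simp add: scaleR_sum_right)

lemma avg_avg:
  "avg A (\<lambda>g. avg B (f g)) = (1 / (real (card A) * real (card B))) *\<^sub>R (\<Sum>g\<in>A. \<Sum>h\<in>B. f g h)"
  by (simp add: avg_def flip: scaleR_sum_right)

lemma avg_swap: "avg G (\<lambda>g. avg H (\<lambda>h. f g h)) = avg H (\<lambda>h. avg G (\<lambda>g. f g h))"
  by (simp add: avg_avg sum.swap [of _ H] mult.commute)

lemma avg_mono: "(\<And>g. g \<in> G \<Longrightarrow> f g \<le> (h g::real)) \<Longrightarrow> avg G f \<le> avg G h"
  unfolding avg_def real_scaleR_def by (intro mult_left_mono sum_mono) auto

lemma avg_lext: "lext F (avg G f) = avg G (\<lambda>g. lext F (f g))"
  by (simp add: avg_def lext_simps)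

lemma avg_star: "star (avg G f) = avg G (\<lambda>g. star (f g))"
  by (simp add: avg_def star_linear)

lemma avg_alg: "(\<And>g. g \<in> H \<Longrightarrow> f g \<in> alg G) \<Longrightarrow> avg H f \<in> alg G"
  unfolding avg_def by (intro alg_intros(3,6))

lemma avg_shift_right:
  assumes "subgrp G" "a \<in> G"
  shows "avg G (\<lambda>g. f (g + a)) = avg G f"
proof -
  have "(\<Sum>g\<in>G. f (g + a)) = (\<Sum>g\<in>G. f g)"
    by (rule sum.reindex_bij_witness [where i = "\<lambda>g. g - a" and j = "\<lambda>g. g + a"])
       (use assms in \<open>auto intro: subgrpD\<close>)
  then show ?thesis by (simp add: avg_def)
qed

lemma avg_shift_left:
  assumes "subgrp G" "a \<in> G"
  shows "avg G (\<lambda>g. f (a + g)) = avg G f"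
proof -
  have "(\<Sum>g\<in>G. f (a + g)) = (\<Sum>g\<in>G. f g)"
    by (rule sum.reindex_bij_witness [where i = "\<lambda>g. - a + g" and j = "\<lambda>g. a + g"])
       (use assms in \<open>auto intro: subgrpD simp: add.assoc [symmetric]\<close>)
  then show ?thesis by (simp add: avg_def)
qed

lemma avg_uminus:
  assumes "subgrp G"
  shows "avg G (\<lambda>g. f (- g)) = avg G f"
proof -
  have "(\<Sum>g\<in>G. f (- g)) = (\<Sum>g\<in>G. f g)"
    by (rule sum.reindex_bij_witness [where i = uminus and j = uminus])
       (use assms in \<open>auto intro: subgrpD\<close>)
  then show ?thesis by (simp add: avg_def)
qed

subsection \<open>Positive tracial functionals and spherical functions\<close>

text \<open>Models the trace of a unitary representation with real character. Positivity makes
  \<open>lext \<phi> (star x * y)\<close> a semidefinite form, so lengths and Cauchy-Schwarz are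
  available without a Hilbert space.\<close>

definition tpos :: "'g::group_add set \<Rightarrow> ('g \<Rightarrow> real) \<Rightarrow> bool" where
  "tpos G \<phi> \<longleftrightarrow> (\<forall>g\<in>G. \<forall>h\<in>G. \<phi> (g + h) = \<phi> (h + g)) \<and> (\<forall>g\<in>G. \<phi> (- g) = \<phi> g) \<and>
     (\<forall>x\<in>alg G. 0 \<le> lext \<phi> (star x * x))"

text \<open>For a finite group, the solutions of this functional equation are the normalized
  irreducible characters.\<close>

definition sph :: "'g::group_add set \<Rightarrow> ('g \<Rightarrow> 'a::real_algebra_1) \<Rightarrow> bool" where
  "sph G r \<longleftrightarrow> r 0 = 1 \<and> (\<forall>g\<in>G. \<forall>h\<in>G. avg G (\<lambda>t. r (g + (t + h - t))) = r g * r h)"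

lemma lext_mult_comm_gen:
  assumes "\<And>g h. g \<in> G \<Longrightarrow> h \<in> G \<Longrightarrow> \<phi> (g + h) = \<phi> (h + g)" "x \<in> alg G" "y \<in> alg G"
  shows "lext \<phi> (x * y) = lext \<phi> (y * x)"
proof (rule alg_linear_eq [where x = x and G = G])
  fix g assume g: "g \<in> G"
  show "lext \<phi> (el g * y) = lext \<phi> (y * el g)"
    by (rule alg_linear_eq [where x = y and G = G])
       (use assms g in \<open>auto intro!: lin_intros simp flip: el_add\<close>)
qed (use assms in \<open>auto intro!: lin_intros\<close>)

lemma tpos_comm:
  assumes "tpos G \<phi>" "x \<in> alg G" "y \<in> alg G"
  shows "lext \<phi> (x * y) = lext \<phi> (y * x)"
  using assms by (intro lext_mult_comm_gen) (auto simp: tpos_def)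

lemma tpos_star:
  assumes "tpos G \<phi>" "x \<in> alg G"
  shows "lext \<phi> (star x) = lext \<phi> x"
  by (rule alg_linear_eq [where x = x and G = G]) (use assms in \<open>auto intro!: lin_intros linear_lext simp: tpos_def\<close>)

lemma tpos_nonneg: "tpos G \<phi> \<Longrightarrow> x \<in> alg G \<Longrightarrow> 0 \<le> lext \<phi> (star x * x)"
  by (simp add: tpos_def)

lemma tpos_mono: "H \<subseteq> G \<Longrightarrow> tpos G \<phi> \<Longrightarrow> tpos H \<phi>"
  using alg_mono [of H G] unfolding tpos_def by blast

text \<open>Expand the square of \<open>l *\<^sub>R x - y\<close> and divide by \<open>l\<close>.
  The free weight is kept because \<open>rest_bound\<close> chooses it with a view to an
  average.\<close>

lemma tpos_bessel:
  assumes "subgrp G" "tpos G \<phi>" "x \<in> alg G" "y \<in> alg G" "l > 0"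
  shows "2 * lext \<phi> (star x * y) \<le> l * lext \<phi> (star x * x) + lext \<phi> (star y * y) / l"
proof -
  define z where "z = l *\<^sub>R x - y"
  have "z \<in> alg G" unfolding z_def using assms by (intro alg_intros)
  then have "0 \<le> lext \<phi> (star z * z)" using assms tpos_nonneg by blast
  also have "\<dots> = l\<^sup>2 * lext \<phi> (star x * x) - l * lext \<phi> (star x * y) - l * lext \<phi> (star y * x) + lext \<phi> (star y * y)"
    by (simp add: z_def star_linear algebra_simps lext_simps power2_eq_square)
  also have "lext \<phi> (star y * x) = lext \<phi> (star x * y)"
    using tpos_star [OF assms(2), of "star x * y"] assms
    by (simp add: star_mult alg_mult alg_star)
  finally have "l * (2 * lext \<phi> (star x * y)) \<le> l * (l * lext \<phi> (star x * x) + lext \<phi> (star y * y) / l)"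
    using assms(5) by (simp add: algebra_simps power2_eq_square)
  then show ?thesis using assms(5) by (simp only: mult_le_cancel_left_pos)
qed

lemma tpos_CS:
  assumes "subgrp G" "tpos G \<phi>" "x \<in> alg G" "y \<in> alg G"
  shows "(lext \<phi> (star x * y))\<^sup>2 \<le> lext \<phi> (star x * x) * lext \<phi> (star y * y)"
proof -
  define a b c where "a = lext \<phi> (star x * x)" and "b = lext \<phi> (star y * y)" and "c = lext \<phi> (star x * y)"
  have nn: "a \<ge> 0" "b \<ge> 0" using assms tpos_nonneg by (auto simp: a_def b_def)
  have 1: "2 * c \<le> l * a + b / l" if "l > 0" for l
    using tpos_bessel [OF assms that] by (simp add: a_def b_def c_def)
  have 2: "- (2 * c) \<le> l * a + b / l" if "l > 0" for l
    using tpos_bessel [OF assms(1,2,3) _ that, of "- y"] assms(4)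
    by (simp add: a_def b_def c_def star_linear lext_simps alg_intros)
  have key: "c\<^sup>2 \<le> a * b"
  proof (cases "c = 0")
    case False
    show ?thesis
    proof (cases "a = 0")
      case True
      \<comment> \<open>Without the \<open>a\<close> term the bound is \<open>b / l\<close>; this
        large \<open>l\<close> pushes it below \<open>\<bar>c\<bar>\<close>, contradicting
        \<open>c \<noteq> 0\<close>.\<close>
      define l where "l = (b + 1) / \<bar>c\<bar>"
      have "l > 0" using nn False by (simp add: l_def add_nonneg_pos)
      then have "2 * \<bar>c\<bar> \<le> b / l" using 1 2 True by (fastforce simp: abs_if)
      also have "b / l = b / (b + 1) * \<bar>c\<bar>" using False nn by (simp add: l_def)
      also have "\<dots> \<le> 1 * \<bar>c\<bar>" using nn by (intro mult_right_mono) auto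
      finally show ?thesis using False by simp
    next
      case a0: False
      \<comment> \<open>Makes the first term equal to \<open>\<bar>c\<bar>\<close>, which cancels
        half of the left side.\<close>
      define l where "l = \<bar>c\<bar> / a"
      have "l > 0" using nn False a0 by (simp add: l_def)
      then have "2 * \<bar>c\<bar> \<le> l * a + b / l" using 1 2 by (cases "c \<ge> 0") auto
      also have "\<dots> = \<bar>c\<bar> + a * b / \<bar>c\<bar>" using a0 by (simp add: l_def)
      finally have "\<bar>c\<bar> \<le> a * b / \<bar>c\<bar>" by simp
      then have "\<bar>c\<bar> * \<bar>c\<bar> \<le> a * b" using False by (simp add: pos_le_divide_eq)
      then show ?thesis by (simp add: power2_eq_square)
    qed
  qed (use nn in simp)
  then show ?thesis by (simp add: a_def b_def c_def)
qed

text \<open>Cauchy-Schwarz for \<open>e\<close> and \<open>el g * e\<close>: translation preserves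
  length, and the squared length of a projection is its trace.\<close>

lemma tpos_bound_el:
  assumes "subgrp G" "tpos G \<phi>" "g \<in> G" "e \<in> alg G" "e * e = e" "star e = e"
  shows "\<bar>lext \<phi> (el g * e)\<bar> \<le> lext \<phi> e"
proof -
  have ee: "lext \<phi> (star e * e) = lext \<phi> e" using assms by simp
  then have nn: "lext \<phi> e \<ge> 0" using assms tpos_nonneg by metis
  have ge: "el g * e \<in> alg G" using assms by (intro alg_mult) auto
  have "(lext \<phi> (star e * (el g * e)))\<^sup>2 \<le> lext \<phi> (star e * e) * lext \<phi> (star (el g * e) * (el g * e))"
    by (rule tpos_CS) (use assms ge in auto)
  also have "star (el g * e) * (el g * e) = e * (el (- g) * el g) * e"
    using assms by (simp add: star_mult mult.assoc)
  also have "\<dots> = e" using assms by (simp flip: el_add add: el_0)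
  also have "lext \<phi> (star e * (el g * e)) = lext \<phi> (el g * e)"
    using tpos_comm [OF assms(2), of e "el g * e"] assms ge by (simp add: mult.assoc)
  finally have "(lext \<phi> (el g * e))\<^sup>2 \<le> (lext \<phi> e)\<^sup>2" using ee by (simp add: power2_eq_square)
  then show ?thesis using nn by (simp add: abs_le_square_iff [symmetric])
qed

text \<open>The library function \<open>poly\<close> needs a commutative ring.\<close>

definition peval :: "real poly \<Rightarrow> 'a::real_algebra_1 \<Rightarrow> 'a" where
  "peval p y = (\<Sum>i\<le>degree p. coeff p i *\<^sub>R y ^ i)"

lemma peval_bound:
  assumes "degree p \<le> n"
  shows "peval p y = (\<Sum>i\<le>n. coeff p i *\<^sub>R y ^ i)"
  unfolding peval_def using assms
  by (intro sum.mono_neutral_left) (auto simp: coeff_eq_0 not_le)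

lemma peval_add: "peval (p + q) y = peval p y + peval q y"
proof -
  let ?n = "max (degree p) (degree q)"
  have "degree (p + q) \<le> ?n" by (rule degree_add_le_max)
  then show ?thesis
    by (simp add: peval_bound [of p ?n] peval_bound [of q ?n] peval_bound [of "p + q" ?n]
        scaleR_add_left sum.distrib)
qed

lemma peval_0 [simp]: "peval 0 y = 0"
  by (simp add: peval_def)

lemma peval_pCons: "peval (pCons a p) y = a *\<^sub>R 1 + y * peval p y"
proof -
  have "peval (pCons a p) y = (\<Sum>i\<le>Suc (degree p). coeff (pCons a p) i *\<^sub>R y ^ i)"
    by (rule peval_bound) (rule degree_pCons_le)
  also have "\<dots> = a *\<^sub>R 1 + y * peval p y"
    by (simp only: sum.atMost_Suc_shift) (simp add: peval_def sum_distrib_left)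
  finally show ?thesis .
qed

lemma peval_smult: "peval (Polynomial.smult c p) y = c *\<^sub>R peval p y"
  by (induction p) (simp_all add: peval_pCons algebra_simps)

lemma peval_mult: "peval (p * q) y = peval p y * peval q y"
  by (induction p) (simp_all add: peval_pCons peval_add peval_smult algebra_simps)

text \<open>Serves to split minimal polynomials over the reals; the second case, a pair of conjugate
  non-real roots, will be excluded by positivity.\<close>

lemma real_poly_factor:
  fixes p :: "real poly"
  assumes "degree p > 0"
  obtains a q where "p = [:- a, 1:] * q"
  | a b q where "b \<noteq> 0" "p = [:a\<^sup>2 + b\<^sup>2, - 2 * a, 1:] * q"
proof -
  have "\<not> constant (poly (map_poly complex_of_real p))"
    using assms by (simp add: constant_degree degree_map_poly)
  then obtain z where z: "poly (map_poly complex_of_real p) z = 0"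
    using fundamental_theorem_of_algebra by blast
  define a b where "a = Re z" and "b = Im z"
  show thesis
  proof (cases "b = 0")
    case True
    then have "z = complex_of_real a" by (simp add: a_def b_def complex_eq_iff)
    moreover have "poly (map_poly complex_of_real p) (of_real a) = of_real (poly p a)"
      by (induction p) (simp_all add: Polynomial.map_poly_pCons)
    ultimately have "poly p a = 0" using z by simp
    then show thesis using that(1) by (meson dvdE poly_eq_0_iff_dvd)
  next
    case False
    define d :: "real poly" where "d = [:a\<^sup>2 + b\<^sup>2, - 2 * a, 1:]"
    have dn: "d \<noteq> 0" "degree d = 2" by (simp_all add: d_def)
    \<comment> \<open>The remainder has degree at most 1 and vanishes at the non-real number
      \<open>z\<close>; comparing real and imaginary parts makes it zero.\<close>
    define m where "m = p mod d"
    have "degree m < 2 \<or> m = 0" using degree_mod_less [OF dn(1), of p] dn by (auto simp: m_def)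
    then have "degree m \<le> 1" by auto
    then have m: "m = [:c, e:]" if "c = coeff m 0" "e = coeff m 1" for c e
      using that by (intro poly_eqI) (auto simp: coeff_pCons coeff_eq_0 split: nat.splits)
    define c e where "c = coeff m 0" and "e = coeff m 1"
    have m: "m = [:c, e:]" using m c_def e_def by blast
    have pd: "p = p div d * d + m" by (simp add: m_def)
    have dz: "poly (map_poly complex_of_real d) z = 0"
      by (simp add: d_def Polynomial.map_poly_pCons a_def b_def complex_eq_iff power2_eq_square algebra_simps)
    have hom: "map_poly complex_of_real (u * v + w) =
        map_poly complex_of_real u * map_poly complex_of_real v + map_poly complex_of_real w" for u v w
      by (rule poly_eqI) (simp add: coeff_map_poly coeff_mult)
    have "poly (map_poly complex_of_real m) z = 0"
      using z by (subst (asm) pd, subst (asm) hom) (simp add: dz)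
    then have "complex_of_real c + z * complex_of_real e = 0" by (simp add: m Polynomial.map_poly_pCons)
    then have "c + a * e = 0" "b * e = 0"
      by (simp_all add: complex_eq_iff a_def b_def mult.commute)
    then have "m = 0" using False m by auto
    then have "p = d * (p div d)" using pd by (simp add: mult.commute)
    then show thesis using that(2) False unfolding d_def by blast
  qed
qed

subsection \<open>Spectral decomposition of the centre\<close>

text \<open>The class sum of \<open>h\<close>, scaled to total weight 1. These elements span the
  centre.\<close>

definition csum :: "'g::group_add set \<Rightarrow> 'g \<Rightarrow> 'g grp_alg" where
  "csum G h = avg G (\<lambda>t. el (t + h - t))"

definition cen :: "'g::group_add set \<Rightarrow> 'g grp_alg set" where
  "cen G = {x \<in> alg G. \<forall>g\<in>G. el g * x = x * el g}"

lemma conj_conj: "(g + t) + h - (g + t) = g + (t + h - t) - (g::'g::group_add)"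
  by (simp only: diff_conv_add_uminus minus_add minus_minus add.assoc)

lemma conj_uminus: "- (t + h - t) = t + - h - (t::'g::group_add)"
  by (simp only: diff_conv_add_uminus minus_add minus_minus add.assoc)

lemma el_conj: "el g * el h * el (- g) = el (g + h - (g::'g::group_add))"
  by (simp only: el_add [symmetric] diff_conv_add_uminus)

lemma el_cancel [simp]: "el g * el (- g) = 1" "el (- g) * el g = (1 :: 'g::group_add grp_alg)"
  "el g * (el (- g) * x) = x" "el (- g) * (el g * x) = x"
  by (simp_all flip: el_add mult.assoc add: el_0)

lemma cen_comm:
  assumes "x \<in> cen G" "y \<in> alg G"
  shows "y * x = x * y"
  by (rule alg_linear_eq [where x = y and G = G]) (use assms in \<open>auto intro!: lin_intros simp: cen_def\<close>)

lemma subspace_cen: "Real_Vector_Spaces.subspace (cen G)"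
  by (rule subspaceI) (auto simp: cen_def alg_intros algebra_simps)

lemmas cen_closed = subspace_0 [OF subspace_cen] subspace_add [OF subspace_cen]
  subspace_scale [OF subspace_cen] subspace_diff [OF subspace_cen] subspace_neg [OF subspace_cen]
  subspace_sum [OF subspace_cen]

lemma cen_alg: "x \<in> cen G \<Longrightarrow> x \<in> alg G"
  by (simp add: cen_def)

lemma cen_mult:
  assumes "subgrp G" "x \<in> cen G" "y \<in> cen G"
  shows "x * y \<in> cen G"
  unfolding cen_def
proof safe
  show "x * y \<in> alg G" using assms by (simp add: alg_mult cen_alg)
  fix g assume "g \<in> G"
  then have "el g * x = x * el g" "el g * y = y * el g" using assms by (auto simp: cen_def)
  then show "el g * (x * y) = x * y * el g" by (metis mult.assoc)
qed

lemma cen_1: "subgrp G \<Longrightarrow> 1 \<in> cen G"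
  by (auto simp: cen_def alg_1)

lemma csum_cen:
  assumes "subgrp G" "h \<in> G"
  shows "csum G h \<in> cen G"
  unfolding cen_def
proof safe
  show "csum G h \<in> alg G"
    unfolding csum_def using assms by (intro avg_alg) (simp add: subgrpD)
  fix g assume g: "g \<in> G"
  have "el g * csum G h = avg G (\<lambda>t. el ((g + t) + h - (g + t))) * el g"
    unfolding csum_def avg_mult_left [symmetric] avg_mult_right [symmetric]
    by (rule avg_cong) (simp only: conj_conj el_add [symmetric] diff_add_cancel)
  also have "avg G (\<lambda>t. el ((g + t) + h - (g + t))) = csum G h"
    unfolding csum_def by (rule avg_shift_left [OF assms(1) g])
  finally show "el g * csum G h = csum G h * el g" .
qed

section \<open>The coefficient at the unit as a trace\<close>

text \<open>The normalized character of the regular representation.\<close>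

definition delta0 :: "'g::zero \<Rightarrow> real" where
  "delta0 g = (if g = 0 then 1 else 0)"

lemma lookup_el: "lookup (el g) h = (if g = h then 1 else 0)"
  by (simp add: el_def lookup_single when_def)

lemma linear_lookup: "linear (\<lambda>x. lookup x g :: real)"
  by (rule linearI) (simp_all add: lookup_add)

lemma lext_delta0: "lext delta0 x = lookup x 0"
  by (rule alg_linear_eq [where x = x and G = UNIV and f' = "\<lambda>x. lookup x 0"])
     (simp_all add: linear_lext linear_lookup in_alg_UNIV lookup_el delta0_def)

lemma lookup_star_mult: "lookup (star x * y) 0 = lext (lookup y) x"
proof (rule alg_linear_eq [where x = x and G = UNIV])
  show "linear (\<lambda>x. lookup (star x * y) 0 :: real)"
    by (rule linearI) (simp_all add: star_linear lookup_add algebra_simps)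
  fix g
  have "lookup (el (- g) * y) 0 = lookup y g"
  proof (rule alg_linear_eq [where x = y and G = UNIV])
    show "linear (\<lambda>y. lookup (el (- g) * y) 0 :: real)"
      by (rule linearI) (simp_all add: lookup_add algebra_simps)
    fix h
    have "(- g + h = 0) = (h = g)" by (simp add: add_eq_0_iff)
    then show "lookup (el (- g) * el h) 0 = lookup (el h) g"
      by (simp add: lookup_el flip: el_add)
  qed (rule linear_lookup in_alg_UNIV)+
  then show "lookup (star (el g) * y) 0 = lext (lookup y) (el g)" by simp
qed (rule linear_lext in_alg_UNIV)+

lemma lookup_star_mult_self: "lookup (star x * x) 0 = (\<Sum>g\<in>keys x. (lookup x g)\<^sup>2)"
  unfolding lookup_star_mult by (simp add: lext_def power2_eq_square)

lemma lookup_squares_zero: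
  assumes "(\<Sum>g\<in>keys x. (lookup x g)\<^sup>2) = (0::real)"
  shows "x = 0"
proof (rule poly_mapping_eqI)
  fix k
  have "\<forall>g\<in>keys x. (lookup x g)\<^sup>2 = 0"
    using assms by (subst (asm) sum_nonneg_eq_0_iff) auto
  then show "lookup x k = lookup 0 k" by (cases "k \<in> keys x") (auto simp: in_keys_iff)
qed

lemma star_mult_self_zero: "star x * x = 0 \<Longrightarrow> x = 0"
  using lookup_star_mult_self [of x] by (intro lookup_squares_zero) simp

text \<open>The algebra is formally real with respect to \<open>star\<close>. This is what excludes
  non-real eigenvalues of central elements.\<close>

lemma star_mult_self_sum_zero:
  assumes "star x * x + star y * y = 0"
  shows "y = 0"
proof (rule lookup_squares_zero)
  have "(\<Sum>g\<in>keys x. (lookup x g)\<^sup>2) + (\<Sum>g\<in>keys y. (lookup y g)\<^sup>2) = 0"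
    using assms by (simp flip: lookup_star_mult_self lookup_add)
  moreover have "(\<Sum>g\<in>keys z. (lookup z g)\<^sup>2) \<ge> (0::real)" for z :: "'a grp_alg"
    by (rule sum_nonneg) simp
  ultimately show "(\<Sum>g\<in>keys y. (lookup y g)\<^sup>2) = 0"
    by (metis add_nonneg_eq_0_iff)
qed

lemma tpos_delta0: "tpos G (delta0 :: 'g::group_add \<Rightarrow> real)"
  unfolding tpos_def
proof (intro conjI ballI)
  fix g h :: 'g
  have "(g + h = 0) = (h + g = 0)" by (metis add_eq_0_iff minus_minus)
  then show "delta0 (g + h) = delta0 (h + g)" by (simp add: delta0_def)
  show "delta0 (- g) = delta0 g" by (simp add: delta0_def)
  show "0 \<le> lext delta0 (star x * x)" for x
    by (simp add: lext_delta0 lookup_star_mult_self sum_nonneg)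
qed

lemma alg_span: "alg G \<subseteq> span (el ` G)"
proof
  fix x assume x: "x \<in> alg G"
  have "(\<Sum>g\<in>keys x. lookup x g *\<^sub>R el g) \<in> span (el ` G)"
  proof (intro span_sum span_scale span_base imageI)
    show "g \<in> G" if "g \<in> keys x" for g using that x by (auto simp: alg_def)
  qed
  then show "x \<in> span (el ` G)" by (rule ssubst [OF grp_alg_expand])
qed

text \<open>The space \<open>alg G\<close> is spanned by \<open>card G\<close> elements, so the
  first \<open>card G + 1\<close> powers of \<open>y\<close> are dependent.\<close>

lemma algebraic:
  assumes "subgrp G" "y \<in> alg G"
  obtains p where "p \<noteq> 0" "peval p y = 0"
proof -
  have pw: "y ^ i \<in> alg G" for i
    by (induction i) (use assms in \<open>auto intro: alg_1 alg_mult\<close>)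
  define N where "N = card G"
  show thesis
  proof (cases "inj_on (\<lambda>i. y ^ i) {..N}")
    case False
    \<comment> \<open>Dependence is a property of the set of powers, so coinciding powers need a
      polynomial of their own.\<close>
    then obtain i j where ij: "i \<noteq> j" "y ^ i = y ^ j" by (auto simp: inj_on_def)
    define p :: "real poly" where "p = monom 1 i - monom 1 j"
    have "coeff p i = 1" using ij by (simp add: p_def coeff_monom)
    then have "p \<noteq> 0" by auto
    have dp: "degree p \<le> max i j"
      unfolding p_def by (rule order.trans [OF degree_diff_le_max]) (simp add: degree_monom_eq)
    have "peval p y = (\<Sum>k\<le>max i j. (if k = i then y ^ k else 0) - (if k = j then y ^ k else 0))"
      unfolding peval_bound [OF dp] by (rule sum.cong) (auto simp: p_def coeff_monom)
    also have "\<dots> = 0" using ij by (simp add: sum_subtractf)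
    finally show thesis using that \<open>p \<noteq> 0\<close> by blast
  next
    case True
    let ?S = "(\<lambda>i. y ^ i) ` {..N}"
    have "card ?S = N + 1" using True by (simp add: card_image)
    moreover have "card (el ` G) \<le> N" using subgrpD(1) [OF assms(1)] by (simp add: N_def card_image_le)
    moreover have "?S \<subseteq> span (el ` G)"
      using alg_span [of G] pw by blast
    ultimately have "\<not> independent ?S"
      using independent_span_bound [of "el ` G" ?S] finite_imageI [OF subgrpD(1) [OF assms(1)], of el]
      by auto
    then obtain u v where uv: "v \<in> ?S" "u v \<noteq> 0" "(\<Sum>v\<in>?S. u v *\<^sub>R v) = 0"
      by (auto simp: dependent_finite)
    obtain k where k: "k \<le> N" "v = y ^ k" using uv by auto
    define p where "p = (\<Sum>i\<le>N. monom (u (y ^ i)) i)"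
    have cp: "coeff p i = (if i \<le> N then u (y ^ i) else 0)" for i
      by (auto simp: p_def coeff_sum coeff_monom)
    have "coeff p k \<noteq> 0" using k uv by (simp add: cp)
    then have "p \<noteq> 0" by auto
    have "degree p \<le> N" by (rule degree_le) (simp add: cp)
    then have "peval p y = (\<Sum>i\<le>N. u (y ^ i) *\<^sub>R y ^ i)" by (simp add: peval_bound cp)
    also have "\<dots> = 0" using uv(3) True by (simp add: sum.reindex)
    finally show thesis using that \<open>p \<noteq> 0\<close> by blast
  qed
qed

section \<open>Minimal central idempotents and their spherical functions\<close>

definition central_idem :: "'g::group_add set \<Rightarrow> 'g grp_alg \<Rightarrow> bool" where
  "central_idem G e \<longleftrightarrow> e \<in> cen G \<and> e * e = e"

definition min_idem :: "'g::group_add set \<Rightarrow> 'g grp_alg \<Rightarrow> bool" where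
  "min_idem G e \<longleftrightarrow> central_idem G e \<and> e \<noteq> 0 \<and>
     (\<forall>f. central_idem G f \<longrightarrow> f * e = f \<longrightarrow> f = 0 \<or> f = e)"

lemma lext_csum:
  assumes G: "subgrp G" and x: "x \<in> alg G"
  shows "lext (csum G) x = avg G (\<lambda>t. el t * x * el (- t))"
proof (rule alg_linear_eq [where x = x and G = G])
  show "linear (\<lambda>x. avg G (\<lambda>t. el t * x * el (- t)))"
    unfolding avg_def
    by (rule linearI) (simp_all add: algebra_simps sum.distrib scaleR_sum_right)
qed (use x in \<open>auto simp: linear_lext csum_def el_conj intro!: avg_cong\<close>)

lemma cen_lext_csum:
  assumes "subgrp G" "x \<in> cen G"
  shows "lext (csum G) x = x"
proof -
  have "el t * x * el (- t) = x" if "t \<in> G" for t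
    using that assms by (simp add: cen_def mult.assoc)
  then show ?thesis
    using lext_csum [of G x] avg_const_on [of G "\<lambda>t. el t * x * el (- t)" x] assms by (simp add: cen_alg)
qed

text \<open>The bilinear form of the functional equation: averaging one factor over its conjugates
  makes \<open>r\<close> multiplicative.\<close>

lemma sph_lext_csum:
  assumes r: "sph G r" and x: "x \<in> alg G" and y: "y \<in> alg G"
  shows "lext r (x * lext (csum G) y) = lext r x * lext r y"
proof (rule alg_linear_eq [where x = x and G = G])
  fix g assume g: "g \<in> G"
  show "lext r (el g * lext (csum G) y) = lext r (el g) * lext r y"
  proof (rule alg_linear_eq [where x = y and G = G])
    fix h assume h: "h \<in> G"
    have "lext r (el g * csum G h) = avg G (\<lambda>t. r (g + (t + h - t)))"
      by (simp add: csum_def avg_lext flip: avg_mult_left el_add)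
    then show "lext r (el g * lext (csum G) (el h)) = lext r (el g) * lext r (el h)"
      using r g h by (simp add: sph_def)
  qed (use y in \<open>auto intro!: lin_intros linear_lext linear_mult_left\<close>)
qed (use x in \<open>auto intro!: lin_intros linear_lext linear_mult_right\<close>)

text \<open>The counterpart of the fact that central elements act as scalars in an irreducible
  representation.\<close>

lemma sph_lext_mult:
  assumes G: "subgrp G" and r: "sph G r" and x: "x \<in> alg G" and z: "z \<in> cen G"
  shows "lext r (x * z) = lext r x * lext r z"
  using sph_lext_csum [OF r x cen_alg [OF z]] by (simp add: cen_lext_csum [OF G z])

locale ambivalent_group =
  fixes G :: "'g::group_add set"
  assumes sub: "subgrp G"
    and ambivalent: "g \<in> G \<Longrightarrow> \<exists>t\<in>G. t + g - t = - g"
begin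

lemma csum_uminus:
  assumes "h \<in> G"
  shows "csum G (- h) = csum G h"
proof -
  obtain s where s: "s \<in> G" "s + h - s = - h" using ambivalent assms by blast
  have "csum G (- h) = avg G (\<lambda>t. el ((t + s) + h - (t + s)))"
    unfolding csum_def s(2) [symmetric] conj_conj ..
  then show ?thesis
    unfolding csum_def using avg_shift_right [OF sub s(1), of "\<lambda>t. el (t + h - t)"] by simp
qed

lemma star_csum:
  assumes "h \<in> G"
  shows "star (csum G h) = csum G h"
proof -
  have "star (csum G h) = csum G (- h)"
    unfolding csum_def avg_star star_el conj_uminus ..
  then show ?thesis using csum_uminus [OF assms] by simp
qed

lemma star_cen:
  assumes "x \<in> cen G"
  shows "star x = x"
proof -
  have "star (lext (csum G) x) = lext (csum G) x"
    by (rule alg_linear_eq [where x = x and G = G])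
       (use assms in \<open>auto intro!: lin_intros linear_lext simp: star_csum cen_alg\<close>)
  then show ?thesis using cen_lext_csum [OF sub assms] by simp
qed

text \<open>Times \<open>card G\<close>, the coefficient at the unit is the rank in the regular
  representation. Concretely, for \<open>t = lookup e 0\<close> the squared coefficients sum to
  \<open>t\<close>, and none exceeds \<open>t\<close> in absolute value, so
  \<open>t \<le> card G * t\<^sup>2\<close>.\<close>

lemma idem_coeff:
  assumes "central_idem G e" "e \<noteq> 0"
  shows "lookup e 0 * real (card G) \<ge> 1"
proof -
  have e: "e \<in> alg G" "e * e = e" "star e = e"
    using assms star_cen by (auto simp: central_idem_def cen_alg)
  define t where "t = lookup e 0"
  have t: "t = (\<Sum>g\<in>keys e. (lookup e g)\<^sup>2)"
    using lookup_star_mult_self [of e] e by (simp add: t_def)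
  have "(lookup e g)\<^sup>2 \<le> t\<^sup>2" if "g \<in> keys e" for g
  proof -
    have gG: "g \<in> G" using that e by (auto simp: alg_def)
    have "lookup e g = lext delta0 (el (- g) * e)"
      using lookup_star_mult [of "el g" e] by (simp add: lext_delta0)
    then have "\<bar>lookup e g\<bar> \<le> t"
      using tpos_bound_el [OF sub tpos_delta0, of "- g" e] gG e subgrpD(4) [OF sub]
      by (simp add: lext_delta0 t_def)
    then show ?thesis by (simp add: abs_le_square_iff [symmetric])
  qed
  then have "(\<Sum>g\<in>keys e. (lookup e g)\<^sup>2) \<le> (\<Sum>g\<in>keys e. t\<^sup>2)" by (rule sum_mono)
  then have "t \<le> (\<Sum>g\<in>keys e. t\<^sup>2)" using t by linarith
  also have "\<dots> = real (card (keys e)) * t\<^sup>2" by simp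
  also have "\<dots> \<le> real (card G) * t\<^sup>2"
    using e subgrpD(1) [OF sub] by (intro mult_right_mono) (auto simp: alg_def card_mono)
  finally have le: "t \<le> (real (card G) * t) * t" by (simp add: power2_eq_square)
  have "t \<noteq> 0"
  proof
    assume "t = 0"
    then show False using assms(2) t lookup_squares_zero [of e] by simp
  qed
  moreover have "t \<ge> 0" using t sum_nonneg [of "keys e" "\<lambda>g. (lookup e g)\<^sup>2"] by auto
  ultimately have "1 \<le> real (card G) * t" using le by (simp add: mult_le_cancel_right1)
  then show ?thesis by (simp add: t_def mult.commute)
qed

text \<open>Take a polynomial of least degree in \<open>x * e\<close> that annihilates
  \<open>e\<close>. Positivity excludes a quadratic factor without real roots, and a linear factor
  produces an idempotent below \<open>e\<close>, which must be \<open>e\<close> itself.\<close>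

lemma min_idem_scalar:
  assumes e: "min_idem G e" and x: "x \<in> cen G"
  shows "\<exists>c. x * e = c *\<^sub>R e"
proof -
  have ec: "e \<in> cen G" and ee: "e * e = e" and e0: "e \<noteq> 0"
    and emin: "\<And>f. central_idem G f \<Longrightarrow> f * e = f \<Longrightarrow> f = 0 \<or> f = e"
    using e by (auto simp: min_idem_def central_idem_def)
  define y where "y = x * e"
  have yc: "y \<in> cen G" using cen_mult [OF sub x ec] by (simp add: y_def)
  have comm: "a * b = b * a" if "a \<in> cen G" "b \<in> cen G" for a b
    using cen_comm [of b G a] that by (simp add: cen_alg)
  have pc: "peval p y \<in> cen G" for p
    by (induction p) (auto simp: peval_pCons intro!: cen_closed cen_mult sub yc cen_1)
  obtain p0 where "p0 \<noteq> 0" "peval p0 y * e = 0"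
    using algebraic [OF sub cen_alg [OF yc]] by (metis mult_zero_left)
  then obtain p where p: "p \<noteq> 0" "peval p y * e = 0"
    and pl: "\<And>q. q \<noteq> 0 \<and> peval q y * e = 0 \<Longrightarrow> degree p \<le> degree q"
    using ex_has_least_nat [of "\<lambda>p. p \<noteq> 0 \<and> peval p y * e = 0" p0 degree] by blast
  have pmin: "peval q y * e \<noteq> 0" if "q \<noteq> 0" "degree q < degree p" for q
    using pl [of q] that by linarith
  have "degree p > 0"
  proof (rule ccontr)
    assume "\<not> degree p > 0"
    then obtain c where c: "p = [:c:]" by (auto elim: degree_eq_zeroE)
    then show False using p e0 by (simp add: peval_pCons)
  qed
  then show ?thesis
  proof (cases rule: real_poly_factor)
    case (1 a q)
    have "q \<noteq> 0" using p(1) 1 by auto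
    then have dq: "degree q < degree p" using 1 by (simp add: degree_mult_eq del: mult_pCons_left)
    \<comment> \<open>\<open>v\<close> is an eigenvector of \<open>y\<close> for \<open>a\<close>,
      and being a polynomial in \<open>y\<close> times \<open>e\<close> it squares to a multiple of
      itself. The multiple is nonzero by positivity, so \<open>v\<close> can be scaled to an
      idempotent.\<close>
    define v where "v = peval q y * e"
    have v0: "v \<noteq> 0" using pmin [OF \<open>q \<noteq> 0\<close> dq] by (simp add: v_def)
    have vc: "v \<in> cen G" using cen_mult [OF sub pc ec] by (simp add: v_def)
    have ve: "v * e = v" by (simp add: v_def mult.assoc ee)
    have "peval p y = (y - a *\<^sub>R 1) * peval q y"
      unfolding 1 peval_mult by (simp add: peval_pCons)
    then have "(y - a *\<^sub>R 1) * v = 0"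
      using p(2) by (simp add: v_def mult.assoc)
    then have yv: "y * v = a *\<^sub>R v" by (simp add: left_diff_distrib)
    have pv: "peval s y * v = poly s a *\<^sub>R v" for s
    proof (induction s)
      case (pCons b s)
      have "y * peval s y * v = peval s y * (y * v)"
        using comm [OF yc pc] by (simp add: mult.assoc)
      then show ?case using pCons by (simp add: peval_pCons yv algebra_simps)
    qed simp
    have vv: "v * v = poly q a *\<^sub>R v"
    proof -
      have "v * v = peval q y * (e * v)" by (simp add: v_def mult.assoc)
      also have "e * v = v" using comm [OF ec vc] ve by simp
      finally show ?thesis by (simp add: pv)
    qed
    have "v * v \<noteq> 0" using star_mult_self_zero [of v] star_cen [OF vc] v0 by auto
    then have c0: "poly q a \<noteq> 0" using vv by auto
    define f where "f = (1 / poly q a) *\<^sub>R v"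
    have "central_idem G f"
      using c0 vc by (auto simp: central_idem_def f_def vv intro: cen_closed)
    moreover have "f * e = f" by (simp add: f_def ve)
    moreover have "f \<noteq> 0" using v0 c0 by (simp add: f_def)
    ultimately have "f = e" using emin by blast
    then have "y * e = a *\<^sub>R e" using yv by (metis f_def mult_scaleR_right scaleR_left_commute)
    then have "x * e = a *\<^sub>R e" by (simp add: y_def mult.assoc ee)
    then show ?thesis by blast
  next
    case (2 a b q)
    have "q \<noteq> 0" using p(1) 2 by auto
    then have dq: "degree q < degree p" using 2 by (simp add: degree_mult_eq del: mult_pCons_left)
    define v where "v = peval q y * e"
    have v0: "v \<noteq> 0" using pmin [OF \<open>q \<noteq> 0\<close> dq] by (simp add: v_def)
    have vc: "v \<in> cen G" using cen_mult [OF sub pc ec] by (simp add: v_def)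
    \<comment> \<open>The quadratic factor is \<open>u * u + b\<^sup>2 *\<^sub>R 1\<close>;
      multiplied by \<open>v * v\<close> it becomes a vanishing sum of the squares of
      \<open>u * v\<close> and \<open>b *\<^sub>R v\<close>.\<close>
    define u where "u = y - a *\<^sub>R 1"
    define w where "w = u * v"
    have uc: "u \<in> cen G" unfolding u_def by (intro cen_closed yc cen_1 sub)
    have wc: "w \<in> cen G" using cen_mult [OF sub uc vc] by (simp add: w_def)
    have "(2 * a) *\<^sub>R y = a *\<^sub>R y + a *\<^sub>R y" "(a * 2) *\<^sub>R y = a *\<^sub>R y + a *\<^sub>R y"
      by (simp_all flip: scaleR_add_left)
    then have "peval [:a\<^sup>2 + b\<^sup>2, - 2 * a, 1:] y = u * u + b\<^sup>2 *\<^sub>R 1"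
      by (simp add: peval_pCons u_def algebra_simps power2_eq_square)
    then have "(u * u + b\<^sup>2 *\<^sub>R 1) * v = 0"
      using p(2) unfolding 2 peval_mult by (simp add: v_def mult.assoc)
    then have uu: "u * u * v + b\<^sup>2 *\<^sub>R v = 0" by (simp add: algebra_simps)
    have "w * w = u * (v * u) * v" by (simp add: w_def mult.assoc)
    then have "w * w = u * u * v * v" using comm [OF uc vc] by (simp add: mult.assoc)
    then have "w * w + (b *\<^sub>R v) * (b *\<^sub>R v) = (u * u * v + b\<^sup>2 *\<^sub>R v) * v"
      by (simp add: algebra_simps power2_eq_square)
    also have "\<dots> = 0" using uu by simp
    finally have "b *\<^sub>R v = 0"
      using star_mult_self_sum_zero [of w "b *\<^sub>R v"] star_cen [OF wc] star_cen [OF vc]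
      by (simp add: star_linear)
    then show ?thesis using 2 v0 by simp
  qed
qed

text \<open>Both parts of a proper splitting have at least 1 as coefficient at the unit times
  \<open>card G\<close>, so this quantity drops by at least 1 for each of them.\<close>

lemma idem_split:
  assumes "central_idem G e" "lookup e 0 * real (card G) \<le> real k"
  shows "\<exists>es. (\<forall>f\<in>set es. min_idem G f) \<and> sum_list es = e"
  using assms
proof (induction k arbitrary: e)
  case 0
  then have "e = 0" using idem_coeff [of e] by fastforce
  then show ?case by (intro exI [of _ "[]"]) simp
next
  case (Suc k)
  show ?case
  proof (cases "e = 0 \<or> min_idem G e")
    case True
    then show ?thesis
    proof
      assume "e = 0" then show ?thesis by (intro exI [of _ "[]"]) simp
    next
      assume "min_idem G e" then show ?thesis by (intro exI [of _ "[e]"]) simp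
    qed
  next
    case False
    then obtain f where f: "central_idem G f" "f * e = f" "f \<noteq> 0" "f \<noteq> e"
      using Suc.prems(1) by (auto simp: min_idem_def)
    have ef: "e * f = f"
      using cen_comm [of f G e] f Suc.prems(1) by (auto simp: central_idem_def cen_alg)
    have d: "central_idem G (e - f)"
      using f Suc.prems(1) ef by (auto simp: central_idem_def algebra_simps intro: cen_closed)
    have "lookup (e - f) 0 * real (card G) \<le> real k" "lookup f 0 * real (card G) \<le> real k"
      using idem_coeff [OF f(1,3)] idem_coeff [OF d] f Suc.prems(2) by (auto simp: lookup_minus algebra_simps)
    then obtain es fs where
      "\<forall>f\<in>set es. min_idem G f" "sum_list es = e - f" "\<forall>f\<in>set fs. min_idem G f" "sum_list fs = f"
      using Suc.IH [OF d] Suc.IH [OF f(1)] by blast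
    then show ?thesis by (intro exI [of _ "es @ fs"]) auto
  qed
qed

text \<open>The spherical function records the scalars by which class sums act on the block of
  \<open>e\<close>.\<close>

lemma min_idem_spherical:
  assumes e: "min_idem G e"
  obtains r where "sph G r" "tpos G r" "\<And>h. h \<in> G \<Longrightarrow> csum G h * e = (r h :: real) *\<^sub>R e"
proof -
  have ec: "e \<in> cen G" and ee: "e * e = e" and e0: "e \<noteq> 0"
    using e by (auto simp: min_idem_def central_idem_def)
  note ea = cen_alg [OF ec] and es = star_cen [OF ec]
  have "\<forall>h\<in>G. \<exists>c. csum G h * e = c *\<^sub>R e"
    using min_idem_scalar [OF e] csum_cen [OF sub] by blast
  then obtain r where r: "csum G h * e = r h *\<^sub>R e" if "h \<in> G" for h by metis
  have inj: "a = b" if "a *\<^sub>R e = b *\<^sub>R e" for a b using that e0 by simp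
  have "sph G r"
    unfolding sph_def
  proof (intro conjI ballI)
    have "csum G 0 = 1"
      unfolding csum_def by (rule avg_const_on [OF sub]) (simp add: el_0)
    then show "r 0 = 1" using r [of 0] inj [of "r 0" 1] subgrpD(2) [OF sub] by simp
    fix g h assume gh: "g \<in> G" "h \<in> G"
    \<comment> \<open>A product of class sums is the average of the class sums of
      \<open>g + (t + h - t)\<close>; on \<open>e\<close> this becomes the functional
      equation.\<close>
    have "csum G g * csum G h = lext (csum G) (el g * csum G h)"
    proof -
      have "el g * csum G h \<in> alg G"
        using gh csum_cen [OF sub] by (intro alg_mult sub) (auto simp: cen_alg)
      then have "lext (csum G) (el g * csum G h) = avg G (\<lambda>s. el s * (el g * csum G h) * el (- s))"
        using lext_csum sub by blast
      also have "\<dots> = avg G (\<lambda>s. el (s + g - s) * csum G h)"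
      proof (rule avg_cong)
        fix s assume "s \<in> G"
        then have "csum G h * el (- s) = el (- s) * csum G h"
          using csum_cen [OF sub gh(2)] subgrpD(4) [OF sub] by (auto simp: cen_def)
        then show "el s * (el g * csum G h) * el (- s) = el (s + g - s) * csum G h"
          by (simp add: mult.assoc flip: el_conj)
      qed
      finally show ?thesis by (simp add: avg_mult_right csum_def [of G g])
    qed
    also have "el g * csum G h = avg G (\<lambda>t. el (g + (t + h - t)))"
      by (simp add: csum_def flip: avg_mult_left el_add)
    also have "lext (csum G) \<dots> = avg G (\<lambda>t. csum G (g + (t + h - t)))"
      by (simp add: avg_lext)
    finally have "csum G g * csum G h * e = avg G (\<lambda>t. csum G (g + (t + h - t)) * e)"
      by (simp add: avg_mult_right)
    also have "\<dots> = avg G (\<lambda>t. r (g + (t + h - t)) *\<^sub>R e)"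
      using gh by (intro avg_cong r) (auto intro: subgrpD [OF sub])
    also have "\<dots> = avg G (\<lambda>t. r (g + (t + h - t))) *\<^sub>R e"
      by (simp add: avg_def flip: scaleR_sum_left)
    also have "csum G g * csum G h * e = (r g * r h) *\<^sub>R e"
      using gh by (simp add: mult.assoc r)
    finally show "avg G (\<lambda>t. r (g + (t + h - t))) = r g * r h" using inj by metis
  qed
  have pos: "lookup e 0 > 0"
    using idem_coeff [of e] e e0 mult_nonpos_nonneg [of "lookup e 0" "real (card G)"]
    by (force simp: min_idem_def)
  \<comment> \<open>The same function as a trace: the regular character cut down by
    \<open>e\<close>. The trace property and positivity are inherited from
    \<open>delta0\<close>.\<close>
  have rd: "lext r x = lext delta0 (x * e) / lookup e 0" if "x \<in> alg G" for x
  proof (rule alg_linear_eq [where x = x and G = G])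
    show "linear (\<lambda>x. lext delta0 (x * e) / lookup e 0)"
      by (rule linearI) (simp_all add: algebra_simps lext_simps add_divide_distrib)
    fix h assume h: "h \<in> G"
    have "lext delta0 (csum G h * e) = avg G (\<lambda>t. lext delta0 (el (t + h - t) * e))"
      by (simp add: csum_def avg_lext flip: avg_mult_right)
    also have "\<dots> = lext delta0 (el h * e)"
    proof (rule avg_const_on [OF sub])
      fix t assume t: "t \<in> G"
      then have "el (t + h - t) * e = el t * (el h * e * el (- t))"
        using ec subgrpD(4) [OF sub] by (simp add: mult.assoc cen_def flip: el_conj)
      moreover have "lext delta0 (el t * (el h * e * el (- t))) = lext delta0 (el h * e * el (- t) * el t)"
        using t h ea by (intro tpos_comm [OF tpos_delta0, of _ G] alg_mult sub) (auto intro: subgrpD [OF sub])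
      ultimately show "lext delta0 (el (t + h - t) * e) = lext delta0 (el h * e)"
        by (simp add: mult.assoc)
    qed
    finally have "r h * lookup e 0 = lext delta0 (el h * e)"
      using r [OF h] by (simp add: lext_simps lext_delta0)
    then show "lext r (el h) = lext delta0 (el h * e) / lookup e 0"
      using pos by (simp add: field_simps)
  qed (use that linear_lext in auto)
  have cl: "r (g + h) = r (h + g)" if "g \<in> G" "h \<in> G" for g h
  proof -
    have "lext delta0 (el g * (el h * e)) = lext delta0 ((el h * e) * el g)"
      using that ea by (intro tpos_comm [OF tpos_delta0, of _ G] alg_mult sub) auto
    also have "e * el g = el g * e" using that ec by (simp add: cen_def)
    then have "el h * e * el g = el h * el g * e" by (simp add: mult.assoc)
    finally have "lext delta0 (el (g + h) * e) = lext delta0 (el (h + g) * e)"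
      by (simp add: el_add mult.assoc)
    moreover have "r k = lext delta0 (el k * e) / lookup e 0" if "k \<in> G" for k
      using rd [of "el k"] that by simp
    ultimately show ?thesis using that subgrpD(3) [OF sub] by metis
  qed
  have "tpos G r"
    unfolding tpos_def
  proof (intro conjI ballI)
    show "r (g + h) = r (h + g)" if "g \<in> G" "h \<in> G" for g h using cl that .
    fix g assume g: "g \<in> G"
    have "r (- g) *\<^sub>R e = r g *\<^sub>R e"
      using r [OF g] r [OF subgrpD(4) [OF sub g]] csum_uminus [OF g] by metis
    then show "r (- g) = r g" by (rule inj)
  next
    fix x assume x: "x \<in> alg G"
    have xx: "star x * x \<in> alg G" using x by (intro alg_mult alg_star sub)
    have "star (x * e) * (x * e) = e * (star x * x * e)" by (simp add: star_mult es mult.assoc)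
    also have "\<dots> = star x * x * e"
      using cen_comm [OF ec xx] by (metis ee mult.assoc)
    finally have "lext delta0 (star x * x * e) \<ge> 0"
      using tpos_nonneg [OF tpos_delta0, of "x * e" UNIV] by (simp add: in_alg_UNIV)
    then show "0 \<le> lext r (star x * x)" using rd [OF xx] pos by simp
  qed
  with that \<open>sph G r\<close> r show thesis by blast
qed

lemma spherical_decomposition:
  "\<exists>(n::nat) e r. (\<forall>i<n. e i \<in> cen G \<and> e i * e i = e i \<and> sph G (r i) \<and> tpos G (r i) \<and>
     (\<forall>h\<in>G. csum G h * e i = (r i h :: real) *\<^sub>R e i)) \<and> (\<Sum>i<n. e i) = 1"
proof -
  have "central_idem G 1" using cen_1 [OF sub] by (simp add: central_idem_def)
  moreover have "lookup (1::'g grp_alg) 0 * real (card G) \<le> real (card G)" by simp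
  ultimately obtain es where es: "\<forall>f\<in>set es. min_idem G f" "sum_list es = (1::'g grp_alg)"
    using idem_split by blast
  have "\<forall>f\<in>set es. \<exists>r. sph G r \<and> tpos G r \<and> (\<forall>h\<in>G. csum G h * f = (r h :: real) *\<^sub>R f)"
  proof
    fix f assume "f \<in> set es"
    then have "min_idem G f" using es(1) by blast
    then show "\<exists>r. sph G r \<and> tpos G r \<and> (\<forall>h\<in>G. csum G h * f = (r h :: real) *\<^sub>R f)"
      by (rule min_idem_spherical) (intro exI conjI ballI)
  qed
  from bchoice [OF this] obtain r where r: "\<forall>f\<in>set es. sph G (r f) \<and> tpos G (r f) \<and>
      (\<forall>h\<in>G. csum G h * f = (r f h :: real) *\<^sub>R f)" ..
  have c: "f \<in> cen G \<and> f * f = f" if "f \<in> set es" for f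
    using es(1) that by (simp add: min_idem_def central_idem_def)
  have "\<forall>i<length es. es ! i \<in> cen G \<and> es ! i * es ! i = es ! i \<and> sph G (r (es ! i)) \<and> tpos G (r (es ! i)) \<and>
     (\<forall>h\<in>G. csum G h * es ! i = r (es ! i) h *\<^sub>R es ! i)"
    using r c nth_mem by blast
  moreover have "(\<Sum>i<length es. es ! i) = 1"
    using es(2) by (simp add: sum_list_sum_nth atLeast0LessThan)
  ultimately have "(\<forall>i<length es. es ! i \<in> cen G \<and> es ! i * es ! i = es ! i \<and> sph G (r (es ! i)) \<and> tpos G (r (es ! i)) \<and>
     (\<forall>h\<in>G. csum G h * es ! i = r (es ! i) h *\<^sub>R es ! i)) \<and> (\<Sum>i<length es. es ! i) = 1" ..
  then show ?thesis
    by (rule exI [of _ "length es", OF exI [of _ "(!) es", OF exI [of _ "\<lambda>i. r (es ! i)"]]])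
qed

lemma tpos_csum:
  assumes "tpos G \<phi>" "h \<in> G"
  shows "lext \<phi> (csum G h) = \<phi> h"
proof -
  have "\<phi> (t + h - t) = \<phi> h" if t: "t \<in> G" for t
  proof -
    have "\<phi> (t + (h - t)) = \<phi> ((h - t) + t)"
      using assms(1) t subgrpD(5) [OF sub assms(2) t] unfolding tpos_def by blast
    then show ?thesis by (simp add: add_diff_eq)
  qed
  then have "avg G (\<lambda>t. \<phi> (t + h - t)) = \<phi> h" by (rule avg_const_on [OF sub])
  then show ?thesis by (simp add: csum_def avg_lext)
qed

text \<open>The decomposition of a character into irreducible ones: write 1 as the sum of the
  minimal central idempotents. The weights \<open>lext \<phi> (e i)\<close> are traces of
  projections, hence nonnegative.\<close>

lemma tpos_decomposition:
  assumes phi: "tpos G \<phi>"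
  obtains n :: nat and w r where "\<And>i. i < n \<Longrightarrow> 0 \<le> w i" "\<And>i. i < n \<Longrightarrow> sph G (r i)"
    "\<And>x. x \<in> alg G \<Longrightarrow> lext \<phi> x = (\<Sum>i<n. w i * lext (r i) x :: real)"
proof -
  obtain n :: nat and e r where er: "\<forall>i<n. e i \<in> cen G \<and> e i * e i = e i \<and> sph G (r i) \<and> tpos G (r i) \<and>
      (\<forall>h\<in>G. csum G h * e i = (r i h :: real) *\<^sub>R e i)" "(\<Sum>i<n. e i) = 1"
    using spherical_decomposition by blast
  have e: "\<And>i. i < n \<Longrightarrow> e i \<in> cen G" "\<And>i. i < n \<Longrightarrow> e i * e i = e i" "(\<Sum>i<n. e i) = 1"
    and r: "\<And>i. i < n \<Longrightarrow> sph G (r i)" "\<And>i. i < n \<Longrightarrow> tpos G (r i)"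
    "\<And>i h. i < n \<Longrightarrow> h \<in> G \<Longrightarrow> csum G h * e i = r i h *\<^sub>R e i"
    using er by simp_all
  have w: "0 \<le> lext \<phi> (e i)" if "i < n" for i
    using tpos_nonneg [OF phi, of "e i"] e that star_cen by (simp add: cen_alg)
  have "lext \<phi> x = (\<Sum>i<n. lext \<phi> (e i) * lext (r i) x)" if x: "x \<in> alg G" for x
  proof (rule alg_linear_eq [where x = x and G = G])
    show "linear (\<lambda>x. \<Sum>i<n. lext \<phi> (e i) * lext (r i) x)"
      by (intro linear_compose_sum) (auto intro!: lin_intros linear_mult_left linear_lext)
    fix h assume h: "h \<in> G"
    have "\<phi> h = lext \<phi> (\<Sum>i<n. csum G h * e i)"
      using tpos_csum [OF phi h] e(3) by (simp flip: sum_distrib_left)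
    also have "\<dots> = (\<Sum>i<n. r i h * lext \<phi> (e i))"
      using r(3) h by (simp add: lext_simps)
    finally show "lext \<phi> (el h) = (\<Sum>i<n. lext \<phi> (e i) * lext (r i) (el h))"
      by (simp add: mult.commute)
  qed (use x linear_lext in auto)
  then show thesis by (intro that [of n "\<lambda>i. lext \<phi> (e i)" r] w r(1))
qed

text \<open>A spherical function is multiplicative on the centre, so it is 1 on some
  \<open>e i\<close>, and there it agrees with \<open>r i\<close>. The field of values is arbitrary
  so that complex normalized characters turn out real; finiteness later ensures that the maximum in
  \<open>lambda_Sn\<close> exists.\<close>

lemma spherical_finite:
  "\<exists>(n::nat) r. (\<forall>i<n. sph G (r i) \<and> tpos G (r i)) \<and>
     (\<forall>s :: 'g \<Rightarrow> 'a::real_field. sph G s \<longrightarrow> (\<exists>i<n. \<forall>h\<in>G. s h = of_real (r i h)))"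
proof -
  obtain n :: nat and e r where er: "\<forall>i<n. e i \<in> cen G \<and> e i * e i = e i \<and> sph G (r i) \<and> tpos G (r i) \<and>
      (\<forall>h\<in>G. csum G h * e i = (r i h :: real) *\<^sub>R e i)" "(\<Sum>i<n. e i) = 1"
    using spherical_decomposition by blast
  have e: "\<And>i. i < n \<Longrightarrow> e i \<in> cen G" "\<And>i. i < n \<Longrightarrow> e i * e i = e i" "(\<Sum>i<n. e i) = 1"
    and r: "\<And>i. i < n \<Longrightarrow> sph G (r i)" "\<And>i. i < n \<Longrightarrow> tpos G (r i)"
    "\<And>i h. i < n \<Longrightarrow> h \<in> G \<Longrightarrow> csum G h * e i = r i h *\<^sub>R e i"
    using er by simp_all
  have "\<exists>i<n. \<forall>h\<in>G. s h = of_real (r i h)" if s: "sph G s" for s :: "'g \<Rightarrow> 'a"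
  proof -
    have s0: "s 0 = 1" using s by (simp add: sph_def)
    have "(\<Sum>i<n. lext s (e i)) = 1"
      using e(3) lext_sum [of s e "{..<n}"] s0 lext_el [of s 0] by (simp add: el_0)
    then obtain i where i: "i < n" "lext s (e i) \<noteq> 0"
      using sum.neutral [of "{..<n}" "\<lambda>i. lext s (e i)"] by fastforce
    have "lext s (e i) * lext s (e i) = lext s (e i)"
      using sph_lext_mult [OF sub s, of "e i" "e i"] e i by (simp add: cen_alg)
    then have 1: "lext s (e i) = 1" using i by simp
    have "s h = of_real (r i h)" if h: "h \<in> G" for h
    proof -
      have "lext s (csum G h) = s h"
      proof -
        have "avg G (\<lambda>t. s (0 + (t + h - t))) = s 0 * s h"
          using s h subgrpD(2) [OF sub] unfolding sph_def by blast
        then show ?thesis by (simp add: csum_def avg_lext s0)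
      qed
      moreover have "lext s (csum G h * e i) = lext s (csum G h) * lext s (e i)"
        using sph_lext_mult [OF sub s] csum_cen [OF sub h] e i by (simp add: cen_alg)
      ultimately show ?thesis using r(3) [OF i(1) h] 1 by (simp add: lext_simps of_real_def)
    qed
    with i show ?thesis by blast
  qed
  with r(1,2) show ?thesis by (intro exI [of _ n] exI [of _ r]) simp
qed

text \<open>The functional equation contains no positivity; it is inherited from the blocks, because
  there are no other solutions.\<close>

lemma sph_tpos:
  assumes "sph G s"
  shows "tpos G (s :: 'g \<Rightarrow> real)"
proof -
  obtain n :: nat and r' where r': "\<forall>i<n. sph G (r' i) \<and> tpos G (r' i)"
    "\<forall>s :: 'g \<Rightarrow> real. sph G s \<longrightarrow> (\<exists>i<n. \<forall>h\<in>G. s h = of_real (r' i h))"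
    using spherical_finite by blast
  then obtain i where i: "i < n" "\<forall>h\<in>G. s h = of_real (r' i h)" using assms by blast
  define r where "r = r' i"
  have r: "tpos G r" "\<And>h. h \<in> G \<Longrightarrow> s h = r h" using r' i by (simp_all add: r_def)
  have "lext s x = lext r x" if "x \<in> alg G" for x
    using that r(2) by (auto simp: lext_def alg_def intro!: sum.cong)
  then have "lext s (star x * x) = lext r (star x * x)" if "x \<in> alg G" for x
    using that alg_mult [OF sub] alg_star [OF sub] by blast
  moreover have "s (g + h) = s (h + g)" "s (- g) = s g" if "g \<in> G" "h \<in> G" for g h
  proof -
    have "r (g + h) = r (h + g)" "r (- g) = r g" using r(1) that unfolding tpos_def by blast+
    then show "s (g + h) = s (h + g)" "s (- g) = s g"
      using r(2) that subgrpD(3,4) [OF sub] by metis+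
  qed
  ultimately show ?thesis
    using r(1) unfolding tpos_def by metis
qed

end

subsection \<open>Projections and spherical functions\<close>

text \<open>Values 1 and -1 suffice: the characters to come are the trivial one, the sign, and one
  of an elementary abelian 2-group.\<close>

definition lchar :: "'g::group_add set \<Rightarrow> ('g \<Rightarrow> real) \<Rightarrow> bool" where
  "lchar H \<chi> \<longleftrightarrow> (\<forall>g\<in>H. \<forall>h\<in>H. \<chi> (g + h) = \<chi> g * \<chi> h) \<and> (\<forall>g\<in>H. \<chi> g = 1 \<or> \<chi> g = -1)"

text \<open>For a linear character \<chi> of a subgroup \<open>H\<close>, the orthogonal projection
  onto the vectors on which \<open>H\<close> acts by \<chi>.\<close>

definition proj :: "'g set \<Rightarrow> ('g \<Rightarrow> real) \<Rightarrow> 'g grp_alg" where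
  "proj H \<chi> = avg H (\<lambda>h. \<chi> h *\<^sub>R el h)"

lemma lchar_one: "lchar H (\<lambda>_. 1)"
  by (simp add: lchar_def)

lemma lcharD:
  assumes "lchar H \<chi>" "subgrp H"
  shows "g \<in> H \<Longrightarrow> h \<in> H \<Longrightarrow> \<chi> (g + h) = \<chi> g * \<chi> h" "g \<in> H \<Longrightarrow> \<chi> g * \<chi> g = 1"
    "g \<in> H \<Longrightarrow> \<chi> (- g) = \<chi> g" "\<chi> 0 = 1"
proof -
  show 1: "g \<in> H \<Longrightarrow> h \<in> H \<Longrightarrow> \<chi> (g + h) = \<chi> g * \<chi> h" for g h
    using assms by (simp add: lchar_def)
  show 2: "g \<in> H \<Longrightarrow> \<chi> g * \<chi> g = 1" for g using assms by (auto simp: lchar_def)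
  show 0: "\<chi> 0 = 1" using 1 [of 0 0] 2 [of 0] subgrpD(2) [OF assms(2)] by simp
  show "g \<in> H \<Longrightarrow> \<chi> (- g) = \<chi> g"
  proof -
    assume g: "g \<in> H"
    then have "\<chi> (- g) * \<chi> g = 1" using 1 [of "- g" g] 0 subgrpD(4) [OF assms(2)] by simp
    then have "\<chi> (- g) * (\<chi> g * \<chi> g) = \<chi> g" by (metis mult.assoc mult_1)
    then show ?thesis using 2 [OF g] by simp
  qed
qed

lemma proj_alg: "H \<subseteq> G \<Longrightarrow> proj H \<chi> \<in> alg G"
  unfolding proj_def by (intro avg_alg alg_intros(3)) auto

lemma lext_proj: "lext \<phi> (proj H \<chi>) = avg H (\<lambda>h. \<chi> h * \<phi> h)"
  by (simp add: proj_def avg_lext lext_simps)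

lemma el_proj:
  assumes "lchar H \<chi>" "subgrp H" "h \<in> H"
  shows "el h * proj H \<chi> = \<chi> h *\<^sub>R proj H \<chi>"
proof -
  note c = lcharD [OF assms(1,2)]
  have "\<chi> h *\<^sub>R proj H \<chi> = avg H (\<lambda>g. \<chi> h *\<^sub>R \<chi> (h + g) *\<^sub>R el (h + g))"
    unfolding proj_def avg_shift_left [OF assms(2,3), of "\<lambda>g. \<chi> g *\<^sub>R el g", symmetric]
    by (simp add: avg_def scaleR_sum_right mult.commute)
  also have "\<dots> = avg H (\<lambda>g. el h * (\<chi> g *\<^sub>R el g))"
    by (rule avg_cong) (use assms c in \<open>simp add: el_add mult.assoc [symmetric]\<close>)
  finally show ?thesis by (simp only: proj_def avg_mult_left)
qed

lemma star_proj:
  assumes "lchar H \<chi>" "subgrp H"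
  shows "star (proj H \<chi>) = proj H \<chi>"
proof -
  have "star (proj H \<chi>) = avg H (\<lambda>h. \<chi> (- h) *\<^sub>R el (- h))"
    unfolding proj_def avg_star
    by (rule avg_cong) (use lcharD [OF assms] in \<open>simp add: star_linear\<close>)
  then show ?thesis unfolding proj_def by (simp only: avg_uminus [OF assms(2), of "\<lambda>h. \<chi> h *\<^sub>R el h"])
qed

lemma proj_el:
  assumes "lchar H \<chi>" "subgrp H" "h \<in> H"
  shows "proj H \<chi> * el h = \<chi> h *\<^sub>R proj H \<chi>"
proof -
  have "star (el (- h) * proj H \<chi>) = proj H \<chi> * el h"
    by (simp add: star_mult star_proj [OF assms(1,2)])
  then show ?thesis
    using el_proj [OF assms(1,2), of "- h"] subgrpD(4) [OF assms(2,3)] lcharD(3) [OF assms]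
    by (simp add: star_linear star_proj [OF assms(1,2)])
qed

lemma proj_mult_absorb:
  assumes "lchar K \<chi>" "subgrp K" "subgrp H" "H \<subseteq> K"
  shows "proj H \<chi> * proj K \<chi> = proj K \<chi>"
proof -
  have "\<chi> h *\<^sub>R el h * proj K \<chi> = proj K \<chi>" if "h \<in> H" for h
  proof -
    have "h \<in> K" using that assms by auto
    then show ?thesis using el_proj [OF assms(1,2), of h] lcharD(2) [OF assms(1,2), of h] by simp
  qed
  then show ?thesis unfolding proj_def [of H] avg_mult_right [symmetric]
    by (rule avg_const_on [OF assms(3)])
qed

lemma proj_idem:
  assumes "lchar H \<chi>" "subgrp H"
  shows "proj H \<chi> * proj H \<chi> = proj H \<chi>"
  using proj_mult_absorb [OF assms assms(2)] by simp

lemma proj_cen: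
  assumes "lchar H \<chi>" "subgrp H"
  shows "proj H \<chi> \<in> cen H"
  using el_proj [OF assms] proj_el [OF assms] by (auto simp: cen_def proj_alg)

lemma proj_orth:
  assumes "lchar H \<chi>" "lchar H \<psi>" "subgrp H" "h \<in> H" "\<chi> h \<noteq> \<psi> h"
  shows "proj H \<chi> * proj H \<psi> = 0"
proof -
  have "\<psi> h *\<^sub>R (proj H \<chi> * proj H \<psi>) = proj H \<chi> * (el h * proj H \<psi>)"
    using el_proj [OF assms(2,3,4)] by simp
  also have "\<dots> = \<chi> h *\<^sub>R (proj H \<chi> * proj H \<psi>)"
    using proj_el [OF assms(1,3,4)] by (simp flip: mult.assoc)
  finally show ?thesis using assms(5) by simp
qed

lemma avg_conj:
  assumes "subgrp G" "t \<in> G"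
  shows "avg G (\<lambda>h. f (t + h - t)) = avg G f"
  using avg_shift_left [OF assms, of "\<lambda>h. f (h - t)"] avg_shift_right [OF assms(1), of "- t" f]
    subgrpD(4) [OF assms] by simp

lemma tpos_conj:
  assumes "subgrp G" "tpos G \<phi>" "g \<in> G" "x \<in> alg G"
  shows "lext \<phi> (el g * x * el (- g)) = lext \<phi> x"
proof -
  have "lext \<phi> (el g * (x * el (- g))) = lext \<phi> (x * el (- g) * el g)"
    using assms subgrpD(4) by (intro tpos_comm [OF assms(2)] alg_mult) auto
  then show ?thesis by (simp add: mult.assoc)
qed

lemma tpos_bound_el': 
  assumes "subgrp G" "tpos G \<phi>" "g \<in> G"
  shows "\<bar>\<phi> g\<bar> \<le> \<phi> 0"
  using tpos_bound_el [OF assms alg_1 [OF assms(1)]] lext_el [of \<phi> 0] by (simp add: el_0)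

text \<open>\<open>\<phi> 0 - \<phi> g\<close> is half the squared length of
  \<open>el 0 - el g\<close>. This is the parallelogram law with its remaining term dropped; that
  term comes from \<open>z\<close>, the difference of \<open>el 0 - el g\<close> and
  \<open>el g - el (g + h)\<close>.\<close>

lemma tpos_length_triangle:
  assumes "subgrp G" "tpos G \<phi>" "g \<in> G" "h \<in> G"
  shows "\<phi> 0 - \<phi> (g + h) \<le> 2 * (\<phi> 0 - \<phi> g) + 2 * (\<phi> 0 - \<phi> h)"
proof -
  define z where "z = el 0 - 2 *\<^sub>R el g + el (g + h)"
  have "z \<in> alg G" unfolding z_def using assms subgrpD(2,3) by (intro alg_intros) auto
  then have "0 \<le> lext \<phi> (star z * z)" using tpos_nonneg assms by blast
  also have "lext \<phi> (star z * z) = 6 * \<phi> 0 - 2 * \<phi> g - 2 * \<phi> (- g) + \<phi> (g + h) + \<phi> (- (g + h))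
      - 2 * \<phi> h - 2 * \<phi> (- h)"
  proof -
    have l: "lext \<phi> 1 = \<phi> 0" "lext \<phi> (el g * el h) = \<phi> (g + h)"
      "lext \<phi> (el (- h) * el (- g)) = \<phi> (- (g + h))"
      using lext_el [of \<phi> 0] by (simp_all add: el_0 minus_add flip: el_add)
    have z: "z = 1 - 2 *\<^sub>R el g + el g * el h" "star z = 1 - 2 *\<^sub>R el (- g) + el (- h) * el (- g)"
      by (simp_all add: z_def star_linear el_0 el_add star_mult)
    show ?thesis unfolding z(2) by (subst z(1)) (simp add: algebra_simps lext_simps l)
  qed
  finally show ?thesis
    using assms(2) subgrpD(3) [OF assms(1,3,4)] assms(3,4) by (simp add: tpos_def del: minus_add)
qed

lemma linear_avg:
  assumes "\<And>g. linear (\<lambda>x. f x g)"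
  shows "linear (\<lambda>x. avg G (f x))"
  unfolding avg_def using assms by (intro linear_compose_scale_right linear_compose_sum) auto

section \<open>Orthogonality relations, kernels and Gelfand pairs\<close>

context ambivalent_group
begin

lemma sph_avg:
  assumes r: "sph G (r :: 'g \<Rightarrow> real)" and x: "x \<in> alg G" and y: "y \<in> alg G"
  shows "avg G (\<lambda>g. lext r (x * el g * y * el (- g))) = lext r x * lext r y"
  using sph_lext_csum [OF r x y]
  by (simp add: lext_csum [OF sub y] avg_lext mult.assoc flip: avg_mult_left)

text \<open>For the normalized character of an irreducible representation of degree \<open>d\<close> this is
  \<open>1 / d\<^sup>2\<close>.\<close>

definition msq :: "('g \<Rightarrow> real) \<Rightarrow> real" where
  "msq r = avg G (\<lambda>g. (r g)\<^sup>2)"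

text \<open>Schur orthogonality. On group elements it reduces to the average of
  \<open>r (p + h) * r h\<close>: averaging \<open>h\<close> over its class leaves the second factor
  alone and splits the first.\<close>

lemma sph_convolution:
  assumes r: "sph G (r :: 'g \<Rightarrow> real)" and x: "x \<in> alg G" and y: "y \<in> alg G"
  shows "avg G (\<lambda>h. lext r (x * el h) * lext r (el (- h) * y)) = msq r * lext r (x * y)"
proof (rule alg_linear_eq [where x = x and G = G])
  note rt = sph_tpos [OF r]
  have rc: "r (g + h) = r (h + g)" and rm: "r (- g) = r g" if "g \<in> G" "h \<in> G" for g h
    using rt that by (simp_all add: tpos_def)
  fix k assume k: "k \<in> G"
  show "avg G (\<lambda>h. lext r (el k * el h) * lext r (el (- h) * y)) = msq r * lext r (el k * y)"
  proof (rule alg_linear_eq [where x = y and G = G])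
    fix m assume m: "m \<in> G"
    have F: "avg G (\<lambda>h. r (p + h) * r h) = msq r * r p" if p: "p \<in> G" for p
    proof -
      have "r (t + h - t) = r h" if "t \<in> G" "h \<in> G" for t h
        using rc [of t "h - t"] that subgrpD(5) [OF sub] by (simp add: add_diff_eq)
      then have 1: "avg G (\<lambda>h. r (p + h) * r h) = avg G (\<lambda>h. r (p + (t + h - t)) * r h)" if "t \<in> G" for t
        using that avg_conj [OF sub that, of "\<lambda>h. r (p + h) * r h"] by (simp cong: avg_cong)
      have "avg G (\<lambda>h. r (p + h) * r h) = avg G (\<lambda>t. avg G (\<lambda>h. r (p + (t + h - t)) * r h))"
        by (rule avg_const_on [OF sub, symmetric]) (rule 1 [symmetric])
      also have "\<dots> = avg G (\<lambda>h. avg G (\<lambda>t. r (p + (t + h - t))) * r h)"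
        by (subst avg_swap) (simp only: avg_mult_right)
      also have "\<dots> = avg G (\<lambda>h. r p * (r h)\<^sup>2)"
        by (rule avg_cong) (use r p in \<open>simp add: sph_def power2_eq_square\<close>)
      finally show ?thesis by (simp add: avg_mult_left msq_def mult.commute)
    qed
    have "avg G (\<lambda>h. r (k + h) * r (- h + m)) = avg G (\<lambda>h. r (k + h) * r (h - m))"
    proof (rule avg_cong)
      fix h assume h: "h \<in> G"
      have "r (- h + m) = r (m - h)" using rc [of "- h" m] h m subgrpD(4) [OF sub] by simp
      also have "\<dots> = r (h - m)" using rm [of "m - h" h] h m subgrpD(5) [OF sub] by simp
      finally show "r (k + h) * r (- h + m) = r (k + h) * r (h - m)" by simp
    qed
    also have "\<dots> = avg G (\<lambda>h. r (k + (h + m)) * r h)"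
      using avg_shift_right [OF sub m, of "\<lambda>h. r (k + h) * r (h - m)"] by simp
    also have "\<dots> = avg G (\<lambda>h. r (m + k + h) * r h)"
    proof (rule avg_cong)
      fix h assume h: "h \<in> G"
      have "r ((k + h) + m) = r (m + (k + h))" by (rule rc) (use h k m subgrpD(3) [OF sub] in auto)
      then show "r (k + (h + m)) * r h = r (m + k + h) * r h" by (simp add: add.assoc)
    qed
    also have "\<dots> = msq r * r (m + k)" using k m subgrpD(3) [OF sub] by (intro F)
    also have "r (m + k) = r (k + m)" using k m by (intro rc)
    finally show "avg G (\<lambda>h. lext r (el k * el h) * lext r (el (- h) * el m)) = msq r * lext r (el k * el m)"
      by (simp flip: el_add)
  qed (use y in \<open>auto intro!: linear_avg lin_intros linear_lext linear_mult_left\<close>)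
qed (use x y in \<open>auto intro!: linear_avg lin_intros linear_lext linear_mult_right\<close>)

lemma msq_pos:
  assumes r: "sph G (r :: 'g \<Rightarrow> real)"
  shows "msq r \<ge> 1 / real (card G)" "msq r > 0"
proof -
  have "(r 0)\<^sup>2 \<le> (\<Sum>g\<in>G. (r g)\<^sup>2)"
    using subgrpD(1,2) [OF sub] by (intro member_le_sum) auto
  then have "1 \<le> (\<Sum>g\<in>G. (r g)\<^sup>2)" using r by (simp add: sph_def)
  then show 1: "msq r \<ge> 1 / real (card G)" by (simp add: msq_def avg_def divide_right_mono)
  have "1 / real (card G) > 0" using subgrp_card [OF sub] by simp
  with 1 show "msq r > 0" by linarith
qed

text \<open>In degree d, a nonzero projection has normalized trace at least \<open>1 / d\<close>.
  The weaker bound \<open>1 / d^2\<close> needs no integrality of ranks: orthogonality turns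
  \<open>msq r * lext r e\<close> into an average of products, each at most the square of
  \<open>lext r e\<close>.\<close>

lemma msq_le_projection:
  assumes r: "sph G (r :: 'g \<Rightarrow> real)" and e: "e \<in> alg G" "e * e = e" "star e = e" "lext r e \<noteq> 0"
  shows "msq r \<le> lext r e"
proof -
  note rt = sph_tpos [OF r]
  have pos: "lext r e > 0" using tpos_nonneg [OF rt e(1)] e by simp
  have "msq r * lext r e = avg G (\<lambda>h. lext r (e * el h) * lext r (el (- h) * e))"
    using sph_convolution [OF r e(1) e(1)] e by simp
  also have "\<dots> \<le> avg G (\<lambda>h. (lext r e)\<^sup>2)"
  proof (rule avg_mono)
    fix h assume h: "h \<in> G"
    have "lext r (e * el h) = lext r (el h * e)" using h e by (intro tpos_comm [OF rt]) auto
    then have "\<bar>lext r (e * el h) * lext r (el (- h) * e)\<bar> \<le> lext r e * lext r e"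
      unfolding abs_mult using tpos_bound_el [OF sub rt h e(1-3)]
        tpos_bound_el [OF sub rt subgrpD(4) [OF sub h] e(1-3)] pos by (intro mult_mono) auto
    then show "lext r (e * el h) * lext r (el (- h) * e) \<le> (lext r e)\<^sup>2"
      by (simp add: power2_eq_square)
  qed
  also have "\<dots> = lext r e * lext r e"
    by (subst avg_const_on [OF sub refl]) (simp add: power2_eq_square)
  finally show ?thesis using pos by simp
qed

text \<open>The projection is central and absorbs \<open>el h\<close> up to the factor
  \<open>\<chi> h\<close>, so its nonzero trace cancels.\<close>

lemma sph_proj_eq_lchar:
  assumes r: "sph G (r :: 'g \<Rightarrow> real)" and c: "lchar G \<chi>" and nz: "lext r (proj G \<chi>) \<noteq> 0" and h: "h \<in> G"
  shows "r h = \<chi> h"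
proof -
  have "lext r (el h * proj G \<chi>) = r h * lext r (proj G \<chi>)"
    using sph_lext_mult [OF sub r _ proj_cen [OF c sub], of "el h"] h by simp
  then show ?thesis using el_proj [OF c sub h] nz by (simp add: lext_simps)
qed

lemma sph_twist:
  assumes r: "sph G (r :: 'g \<Rightarrow> real)" and c: "lchar G \<chi>"
  shows "sph G (\<lambda>g. \<chi> g * r g)"
  unfolding sph_def
proof (intro conjI ballI)
  show "\<chi> 0 * r 0 = 1" using r lcharD(4) [OF c sub] by (simp add: sph_def)
  fix g h assume gh: "g \<in> G" "h \<in> G"
  have "\<chi> (g + (t + h - t)) = \<chi> g * \<chi> h" if t: "t \<in> G" for t
  proof -
    note m = lcharD(1) [OF c sub] and G = subgrpD(3,4) [OF sub]
    have "\<chi> (t + h - t) = \<chi> (t + h + - t)" by (simp only: diff_conv_add_uminus)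
    also have "\<dots> = \<chi> t * \<chi> h * \<chi> t"
      using m [of "t + h" "- t"] m [of t h] gh t G lcharD(3) [OF c sub t] by simp
    also have "\<dots> = \<chi> h * (\<chi> t * \<chi> t)" by simp
    finally have "\<chi> (t + h - t) = \<chi> h" using lcharD(2) [OF c sub t] by simp
    then show ?thesis using m [of g "t + h - t"] gh t G subgrpD(5) [OF sub] by simp
  qed
  then have "avg G (\<lambda>t. \<chi> (g + (t + h - t)) * r (g + (t + h - t))) =
      \<chi> g * \<chi> h * avg G (\<lambda>t. r (g + (t + h - t)))"
    unfolding avg_mult_left [symmetric] by (intro avg_cong) simp
  then show "avg G (\<lambda>t. \<chi> (g + (t + h - t)) * r (g + (t + h - t))) = \<chi> g * r g * (\<chi> h * r h)"
    using r gh by (simp add: sph_def)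
qed

text \<open>\<open>r g = 1\<close> makes \<open>el (- g) - 1\<close> a null vector, and by
  Cauchy-Schwarz null vectors are orthogonal to everything.\<close>

lemma sph_kernel:
  assumes r: "sph G (r :: 'g \<Rightarrow> real)" and g: "g \<in> G" "r g = 1" and x: "x \<in> G"
  shows "r (g + x) = r x"
proof -
  note rt = sph_tpos [OF r]
  define z where "z = el (- g) - 1"
  have z: "z \<in> alg G" unfolding z_def using g subgrpD(4) [OF sub] alg_1 [OF sub] by (intro alg_intros) auto
  have "star z * z = 2 *\<^sub>R el 0 - el g - el (- g)"
    by (simp add: z_def star_linear algebra_simps el_0 scaleR_2)
  then have "lext r (star z * z) = 0"
    using r g rt by (simp add: lext_simps sph_def tpos_def)
  then have "(lext r (star z * el x))\<^sup>2 \<le> 0"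
    using tpos_CS [OF sub rt z, of "el x"] x by simp
  then have "lext r (star z * el x) = 0" by simp
  moreover have "star z * el x = el (g + x) - el x"
    by (simp add: z_def star_linear algebra_simps el_add)
  ultimately show ?thesis by (simp add: lext_diff)
qed

text \<open>A Gelfand pair condition: if the Hecke algebra of a projection consists of self-adjoint
  elements, it is commutative, so the projection has rank at most one in each irreducible
  representation.\<close>

lemma gelfand_bound:
  assumes r: "sph G (r :: 'g \<Rightarrow> real)" and p: "p \<in> alg G" "p * p = p" "star p = p"
    and sym: "\<And>g. g \<in> G \<Longrightarrow> p * el (- g) * p = p * el g * p"
  shows "(lext r p)\<^sup>2 \<le> msq r"
proof -
  note rt = sph_tpos [OF r]
  have pp: "p * (p * x) = p * x" for x using p by (simp flip: mult.assoc)
  have sa: "star (p * x * p) = p * x * p" if "x \<in> alg G" for x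
    by (rule alg_linear_eq [where x = x and G = G])
       (use that p sym in \<open>auto intro!: lin_intros simp: star_mult mult.assoc\<close>)
  have comm: "(p * el g * p) * (p * el h * p) = (p * el h * p) * (p * el g * p)" if gh: "g \<in> G" "h \<in> G" for g h
  proof -
    have "(p * el g * p) * (p * el h * p) = p * (el g * p * el h) * p"
      by (simp add: mult.assoc pp)
    also have "\<dots> = star (p * (el g * p * el h) * p)"
      using gh p by (intro sa [symmetric] alg_mult sub) auto
    also have "\<dots> = star ((p * el g * p) * (p * el h * p))"
      by (simp add: mult.assoc pp)
    also have "\<dots> = (p * el h * p) * (p * el g * p)"
      using gh by (subst star_mult) (simp only: sa el_in_alg)
    finally show ?thesis .
  qed
  \<comment> \<open>A commutator compressed by \<open>p\<close>, to be averaged over both variables.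
    If \<open>p\<close> has rank k in degree d, orthogonality gives \<open>k / d^3\<close>, whereas
    exchanging the two commuting middle factors first gives \<open>k^3 / d^3\<close>. Hence k is at
    most 1.\<close>
  let ?F = "\<lambda>g h. lext r ((p * el g * p) * (p * el h * p) * (p * el (- g) * p) * (p * el (- h) * p))"
  have mem: "p * x * p \<in> alg G" if "x \<in> alg G" for x using p that by (intro alg_mult sub)
  have elm: "el (- g) \<in> alg G" "el g \<in> alg G" if "g \<in> G" for g using that subgrpD(4) [OF sub] by auto
  have "avg G (\<lambda>h. avg G (\<lambda>g. ?F g h)) = avg G (\<lambda>h. lext r (p * el h) * lext r (el (- h) * p))"
  proof (rule avg_cong)
    fix h assume h: "h \<in> G"
    have "?F g h = lext r ((p * el (- h) * p) * el g * (p * el h * p) * el (- g))" if g: "g \<in> G" for g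
    proof -
      have "?F g h = lext r ((p * el g * (p * el h * p) * el (- g)) * (p * el (- h) * p))"
        by (simp add: mult.assoc pp)
      also have "\<dots> = lext r ((p * el (- h) * p) * (p * el g * (p * el h * p) * el (- g)))"
        using p g h elm by (intro tpos_comm [OF rt] alg_mult sub) auto
      finally show ?thesis by (simp add: mult.assoc pp)
    qed
    then have "avg G (\<lambda>g. ?F g h) = avg G (\<lambda>g. lext r ((p * el (- h) * p) * el g * (p * el h * p) * el (- g)))"
      by (rule avg_cong)
    also have "\<dots> = lext r (p * el (- h) * p) * lext r (p * el h * p)"
      using h elm by (intro sph_avg [OF r] mem) auto
    also have "lext r (p * (el (- h) * p)) = lext r (el (- h) * p * p)"
      using p h elm by (intro tpos_comm [OF rt] alg_mult sub) auto
    then have "lext r (p * el (- h) * p) = lext r (el (- h) * p)" by (simp add: mult.assoc p)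
    also have "lext r (p * el h * p) = lext r (p * (p * el h))"
      using p h elm by (intro tpos_comm [OF rt] alg_mult sub) auto
    finally show "avg G (\<lambda>g. ?F g h) = lext r (p * el h) * lext r (el (- h) * p)" by (simp add: pp mult.commute)
  qed
  also have "\<dots> = msq r * lext r p" using sph_convolution [OF r p(1) p(1)] p by simp
  finally have 1: "avg G (\<lambda>h. avg G (\<lambda>g. ?F g h)) = msq r * lext r p" .
  have "avg G (\<lambda>h. avg G (\<lambda>g. ?F g h)) = avg G (\<lambda>h. lext r (p * el h * p * el (- h)) * lext r p)"
  proof (rule avg_cong)
    fix h assume h: "h \<in> G"
    have "?F g h = lext r ((p * el h * p * el (- h) * p) * el g * p * el (- g))" if g: "g \<in> G" for g
    proof -
      have "?F g h = lext r ((p * el g * p) * ((p * el h * p) * (p * el (- g) * p)) * (p * el (- h) * p))"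
        by (simp add: mult.assoc)
      also have "(p * el h * p) * (p * el (- g) * p) = (p * el (- g) * p) * (p * el h * p)"
        using g h subgrpD(4) [OF sub] by (intro comm) auto
      also have "lext r ((p * el g * p) * ((p * el (- g) * p) * (p * el h * p)) * (p * el (- h) * p)) =
          lext r ((p * el g * p * el (- g)) * (p * el h * p * el (- h) * p))"
        by (simp add: mult.assoc pp)
      also have "\<dots> = lext r ((p * el h * p * el (- h) * p) * (p * el g * p * el (- g)))"
        using p g h elm by (intro tpos_comm [OF rt] alg_mult sub) auto
      finally show ?thesis by (simp add: mult.assoc pp)
    qed
    then have "avg G (\<lambda>g. ?F g h) = avg G (\<lambda>g. lext r ((p * el h * p * el (- h) * p) * el g * p * el (- g)))"
      by (rule avg_cong)
    also have "\<dots> = lext r (p * el h * p * el (- h) * p) * lext r p"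
      using p h elm by (intro sph_avg [OF r] alg_mult sub) auto
    also have "lext r (p * el h * p * el (- h) * p) = lext r (p * (p * el h * p * el (- h)))"
      using p h elm by (intro tpos_comm [OF rt] alg_mult sub) auto
    also have "p * (p * el h * p * el (- h)) = p * el h * p * el (- h)" by (simp add: mult.assoc pp)
    finally show "avg G (\<lambda>g. ?F g h) = lext r (p * el h * p * el (- h)) * lext r p" .
  qed
  also have "\<dots> = lext r p * lext r p * lext r p"
    using sph_avg [OF r p(1) p(1)] by (simp add: avg_mult_right)
  finally have "lext r p * ((lext r p)\<^sup>2 - msq r) = 0" using 1 by (simp add: algebra_simps power2_eq_square)
  then show ?thesis using msq_pos [OF r] by auto
qed

end

subsection \<open>Symmetric groups, written additively\<close>

notation Perm.apply (infixl "\<langle>$\<rangle>" 999)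

text \<open>An additive copy of the composition of permutations, as required by convolution;
  \<open>p + q\<close> applies \<open>q\<close> first.\<close>

instantiation perm :: (type) group_add
begin

definition plus_perm :: "'a perm \<Rightarrow> 'a perm \<Rightarrow> 'a perm" where "p + q = p * (q :: 'a perm)"
definition zero_perm :: "'a perm" where "0 = (1 :: 'a perm)"
definition uminus_perm :: "'a perm \<Rightarrow> 'a perm" where "- p = inverse (p :: 'a perm)"
definition minus_perm :: "'a perm \<Rightarrow> 'a perm \<Rightarrow> 'a perm" where "p - q = p * inverse (q :: 'a perm)"

instance
  by standard (simp_all add: plus_perm_def zero_perm_def uminus_perm_def minus_perm_def mult.assoc)

end

lemma ap_simps [simp]: "(p + q) \<langle>$\<rangle> x = p \<langle>$\<rangle> (q \<langle>$\<rangle> x)" "0 \<langle>$\<rangle> x = x"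
  by (simp_all add: plus_perm_def zero_perm_def apply_times)

lemma ap_diff [simp]: "(p - q) \<langle>$\<rangle> x = p \<langle>$\<rangle> ((- q) \<langle>$\<rangle> x)"
  by (simp only: diff_conv_add_uminus ap_simps)

lemma ap_cancel [simp]: "(- p) \<langle>$\<rangle> (p \<langle>$\<rangle> x) = x" "p \<langle>$\<rangle> ((- p) \<langle>$\<rangle> x) = x"
  by (simp_all flip: ap_simps(1))

lemma ap_inj [simp]: "p \<langle>$\<rangle> x = p \<langle>$\<rangle> y \<longleftrightarrow> x = y"
  by (rule apply_inj)

lemma ap_uminus_eq: "(- p) \<langle>$\<rangle> x = y \<longleftrightarrow> x = p \<langle>$\<rangle> y"
  by (metis ap_cancel)

definition Sym :: "'a set \<Rightarrow> 'a perm set" where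
  "Sym S = {p. affected p \<subseteq> S}"

lemma Sym_iff: "p \<in> Sym S \<longleftrightarrow> (\<forall>x. x \<notin> S \<longrightarrow> p \<langle>$\<rangle> x = x)"
  by (auto simp: Sym_def in_affected)

lemma Sym_out: "p \<in> Sym S \<Longrightarrow> x \<notin> S \<Longrightarrow> p \<langle>$\<rangle> x = x"
  by (simp add: Sym_iff)

lemma Sym_in [simp]: "p \<in> Sym S \<Longrightarrow> p \<langle>$\<rangle> x \<in> S \<longleftrightarrow> x \<in> S"
  by (metis Sym_iff ap_inj)

lemma Sym_mono: "S \<subseteq> T \<Longrightarrow> Sym S \<subseteq> Sym T"
  by (auto simp: Sym_def)

lemma Sym_permutes: "p \<in> Sym S \<Longrightarrow> (\<langle>$\<rangle>) p permutes S"
  unfolding permutes_def by (metis Sym_out ap_cancel)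

lemma finite_Sym:
  assumes "finite S"
  shows "finite (Sym S)"
proof (rule inj_on_finite [where f = "(\<langle>$\<rangle>)"])
  show "inj_on (\<langle>$\<rangle>) (Sym S)" by (simp add: inj_on_def Perm.apply_inject)
  show "(\<langle>$\<rangle>) ` Sym S \<subseteq> {f. f permutes S}" using Sym_permutes by blast
  show "finite {f. f permutes S}" using assms by (rule finite_permutations)
qed

lemma subgrp_Sym [simp]: "finite S \<Longrightarrow> subgrp (Sym S)"
  by (auto simp: subgrp_def finite_Sym Sym_iff ap_uminus_eq)

lemma Sym_closed [simp]: "0 \<in> Sym S" "p \<in> Sym S \<Longrightarrow> q \<in> Sym S \<Longrightarrow> p + q \<in> Sym S"
  "p \<in> Sym S \<Longrightarrow> - p \<in> Sym S" "p \<in> Sym S \<Longrightarrow> q \<in> Sym S \<Longrightarrow> p - q \<in> Sym S"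
  by (auto simp: Sym_iff ap_uminus_eq)

lemma Sym_eqI: "p \<in> Sym S \<Longrightarrow> q \<in> Sym S \<Longrightarrow> (\<And>x. x \<in> S \<Longrightarrow> p \<langle>$\<rangle> x = q \<langle>$\<rangle> x) \<Longrightarrow> p = q"
  by (rule perm_eqI) (metis Sym_out)

lemma Sym_obtain:
  assumes "finite S" "bij_betw f S S"
  obtains p where "p \<in> Sym S" "\<And>x. x \<in> S \<Longrightarrow> p \<langle>$\<rangle> x = f x"
proof -
  define f' where "f' = (\<lambda>x. if x \<in> S then f x else x)"
  have "bij_betw f' S S" using assms(2) by (simp add: f'_def cong: bij_betw_cong)
  then have pm: "f' permutes S" by (intro bij_imp_permutes) (auto simp: f'_def)
  then have "bij f'" by (rule permutes_bij)
  moreover have "{x. f' x \<noteq> x} \<subseteq> S" by (auto simp: f'_def)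
  ultimately have a: "(\<langle>$\<rangle>) (Perm f') = f'" using assms(1) by (intro Perm_inverse) (auto intro: finite_subset)
  show thesis
  proof (rule that [of "Perm f'"])
    have ap: "Perm f' \<langle>$\<rangle> x = f' x" for x by (simp add: a)
    show "Perm f' \<in> Sym S" unfolding Sym_iff ap by (simp add: f'_def)
    show "Perm f' \<langle>$\<rangle> x = f x" if "x \<in> S" for x unfolding ap using that by (simp add: f'_def)
  qed
qed

lemma Sym_obtain_inj:
  assumes "finite S" "inj_on f S" "f ` S \<subseteq> S"
  obtains p where "p \<in> Sym S" "\<And>x. x \<in> S \<Longrightarrow> p \<langle>$\<rangle> x = f x"
proof -
  have "f ` S = S" using assms by (simp add: endo_inj_surj)
  then show thesis using Sym_obtain [of S f] assms that by (auto simp: bij_betw_def)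
qed

text \<open>The conjugating permutation reflects every cycle about a base point: the k-th point
  after the base point goes to the k-th point before it.\<close>

lemma Sym_ambivalent:
  assumes S: "finite S" and p: "p \<in> Sym S"
  shows "\<exists>t\<in>Sym S. t + p - t = - p"
proof -
  \<comment> \<open>Choosing from the orbit as a set makes the base point the same for all points of
    a cycle.\<close>
  define rep where "rep y = (SOME z. z \<in> orbit p y)" for y
  have rep: "rep y \<in> orbit p y" for y
    unfolding rep_def by (rule someI [of _ y]) simp
  have "\<exists>k. (p ^ k) \<langle>$\<rangle> (rep y) = y" for y
  proof -
    have "y \<in> orbit p (rep y)" using orbit_equiv [OF rep] by simp
    then obtain n where "y = (p ^ n) \<langle>$\<rangle> (rep y)" unfolding orbit_def by (rule rangeE)
    then show ?thesis by (intro exI [of _ n]) (rule sym)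
  qed
  then obtain k where k: "\<And>y. (p ^ k y) \<langle>$\<rangle> (rep y) = y" by metis
  \<comment> \<open>The exponents \<open>k\<close> are not unique, but powers of \<open>p\<close>
    and of its inverse coincide for the same exponents; this makes \<open>f\<close> injective and
    compatible with \<open>p\<close>.\<close>
  have eq: "(inverse p ^ m) \<langle>$\<rangle> z = (inverse p ^ n) \<langle>$\<rangle> z \<longleftrightarrow> (p ^ m) \<langle>$\<rangle> z = (p ^ n) \<langle>$\<rangle> z" for m n z
    by (simp add: apply_power_eq_iff)
  define f where "f y = (inverse p ^ k y) \<langle>$\<rangle> (rep y)" for y
  have forb: "f y \<in> orbit p y" for y
  proof -
    have "f y \<in> orbit (inverse p) (rep y)" unfolding f_def by (rule apply_power_self_in_orbit)
    then show ?thesis using orbit_equiv [OF rep [of y]] by simp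
  qed
  have rep_eq: "rep y = rep z" if "orbit p y = orbit p z" for y z
    using that by (simp add: rep_def)
  have orbS: "orbit p y \<subseteq> S" if "y \<in> S" for y
  proof (cases "y \<in> affected p")
    case True
    then show ?thesis using orbit_subset_eq_affected [OF True] p by (auto simp: Sym_def)
  next
    case False
    then show ?thesis using that by (simp add: not_in_affected_iff_orbit_eq_singleton)
  qed
  have "inj_on f S"
  proof (rule inj_onI)
    fix y z assume "f y = f z"
    then have "orbit p y = orbit p z" using orbit_equiv [OF forb [of y]] orbit_equiv [OF forb [of z]] by simp
    then have r: "rep y = rep z" by (rule rep_eq)
    then have "(inverse p ^ k y) \<langle>$\<rangle> (rep y) = (inverse p ^ k z) \<langle>$\<rangle> (rep y)"
      using \<open>f y = f z\<close> by (simp add: f_def)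
    then have "(p ^ k y) \<langle>$\<rangle> (rep y) = (p ^ k z) \<langle>$\<rangle> (rep y)" by (rule eq [THEN iffD1])
    then have "y = (p ^ k z) \<langle>$\<rangle> (rep y)" unfolding k [of y] .
    also have "\<dots> = z" unfolding r by (rule k)
    finally show "y = z" .
  qed
  moreover have "f ` S \<subseteq> S" using forb orbS by blast
  ultimately obtain t where t: "t \<in> Sym S" "\<And>y. y \<in> S \<Longrightarrow> t \<langle>$\<rangle> y = f y"
    using Sym_obtain_inj [OF S] by metis
  have fp: "f (p \<langle>$\<rangle> y) = (- p) \<langle>$\<rangle> (f y)" for y
  proof -
    have r: "rep (p \<langle>$\<rangle> y) = rep y" by (rule rep_eq) simp
    have "(p ^ k (p \<langle>$\<rangle> y)) \<langle>$\<rangle> (rep y) = p \<langle>$\<rangle> y" using k [of "p \<langle>$\<rangle> y"] r by simp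
    also have "\<dots> = (p ^ Suc (k y)) \<langle>$\<rangle> (rep y)" using k [of y] by (simp add: apply_times)
    finally have "(inverse p ^ k (p \<langle>$\<rangle> y)) \<langle>$\<rangle> (rep y) = (inverse p ^ Suc (k y)) \<langle>$\<rangle> (rep y)"
      by (rule eq [THEN iffD2])
    then show ?thesis using r by (simp add: f_def apply_times uminus_perm_def)
  qed
  have "t + p = - p + t"
    by (rule Sym_eqI [where S = S]) (use p t fp in auto)
  then have "t + p - t = - p" by (simp add: add.assoc)
  with t(1) show ?thesis by blast
qed

lemma ambivalent_Sym: "finite S \<Longrightarrow> ambivalent_group (Sym S)"
  by unfold_locales (auto intro: Sym_ambivalent)

subsection \<open>Transpositions and the sign\<close>

abbreviation tr :: "'a \<Rightarrow> 'a \<Rightarrow> 'a perm" where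
  "tr a b \<equiv> Perm.swap a b"

lemma ap_tr: "tr a b \<langle>$\<rangle> x = (if x = a then b else if x = b then a else x)"
  by simp

lemma tr_Sym [simp]: "a \<in> S \<Longrightarrow> b \<in> S \<Longrightarrow> tr a b \<in> Sym S"
  by (auto simp: Sym_iff ap_tr)

lemma tr_tr [simp]: "tr a b + tr a b = 0"
  by (simp add: plus_perm_def zero_perm_def)

lemma tr_tr_left [simp]: "tr a b + (tr a b + p) = p"
  by (simp flip: add.assoc)

lemma uminus_tr [simp]: "- tr a b = tr a b"
  by (simp add: uminus_perm_def)

lemma conj_tr: "t + tr a b - t = tr (t \<langle>$\<rangle> a) (t \<langle>$\<rangle> b)"
proof (rule perm_eqI)
  fix x
  obtain y where "x = t \<langle>$\<rangle> y" by (metis ap_cancel(2))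
  then show "(t + tr a b - t) \<langle>$\<rangle> x = tr (t \<langle>$\<rangle> a) (t \<langle>$\<rangle> b) \<langle>$\<rangle> x"
    by (simp add: ap_tr)
qed

text \<open>Induction on the size of the support: if \<open>p\<close> sends \<open>a\<close> to
  \<open>b\<close>, then \<open>tr a b + p\<close> fixes \<open>a\<close> and moves no new
  point.\<close>

lemma Sym_induct [consumes 2, case_names zero swap]:
  assumes "finite S" "p \<in> Sym S" "P 0"
    "\<And>a b q. a \<in> S \<Longrightarrow> b \<in> S \<Longrightarrow> a \<noteq> b \<Longrightarrow> q \<in> Sym S \<Longrightarrow> P q \<Longrightarrow> P (tr a b + q)"
  shows "P p"
  using assms(2)
proof (induction "card (affected p)" arbitrary: p rule: less_induct)
  case less
  show ?case
  proof (cases "p = 0")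
    case False
    then have "affected p \<noteq> {}" by (simp add: zero_perm_def)
    then obtain a where a: "a \<in> affected p" by blast
    define b where "b = p \<langle>$\<rangle> a"
    define q where "q = tr a b + p"
    have ab: "a \<noteq> b" using a by (simp add: b_def in_affected)
    have S: "a \<in> S" "b \<in> S" using a less.prems by (auto simp: Sym_def b_def)
    have q: "q \<in> Sym S" using S less.prems by (simp add: q_def)
    have "affected q \<subset> affected p"
    proof
      show "affected q \<subseteq> affected p"
      proof
        fix x assume "x \<in> affected q"
        then have "q \<langle>$\<rangle> x \<noteq> x" by (simp add: in_affected)
        moreover have "q \<langle>$\<rangle> x = x" if "p \<langle>$\<rangle> x = x"
        proof -
          have "x \<noteq> a" "x \<noteq> b" using that ab ap_inj [of p x a] by (auto simp: b_def)
          then show ?thesis using that by (simp add: q_def ap_tr)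
        qed
        ultimately show "x \<in> affected p" by (auto simp: in_affected)
      qed
      have "q \<langle>$\<rangle> a = a" by (simp add: q_def b_def)
      then show "affected q \<noteq> affected p" using a by (auto simp: in_affected)
    qed
    then have "card (affected q) < card (affected p)" by (intro psubset_card_mono) auto
    then have "P q" using less.hyps q by blast
    then have "P (tr a b + q)" using assms(4) S ab q by blast
    then show ?thesis by (simp add: q_def)
  qed (use assms(3) in simp)
qed

definition sg :: "'a perm \<Rightarrow> real" where
  "sg p = of_int (sign ((\<langle>$\<rangle>) p))"

lemma permutation_ap [simp]: "permutation ((\<langle>$\<rangle>) p)"
proof -
  have "finite {x. p \<langle>$\<rangle> x \<noteq> x}" using finite_affected [of p] by (simp add: affected.rep_eq)
  then show ?thesis by (simp add: permutation)
qed

lemma sg_add: "sg (p + q) = sg p * sg q"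
proof -
  have "(\<langle>$\<rangle>) (p + q) = (\<langle>$\<rangle>) p \<circ> (\<langle>$\<rangle>) q" by (simp add: fun_eq_iff)
  then show ?thesis by (simp add: sg_def sign_compose)
qed

lemma sg_0 [simp]: "sg 0 = 1"
proof -
  have "(\<langle>$\<rangle>) (0 :: 'a perm) = id" by (simp add: fun_eq_iff)
  then show ?thesis by (simp add: sg_def)
qed

lemma sg_cases: "sg p = 1 \<or> sg p = -1"
  by (simp add: sg_def sign_def)

lemma lchar_sg: "lchar H sg"
  using sg_cases by (auto simp: lchar_def sg_add)

lemma sg_tr: "a \<noteq> b \<Longrightarrow> sg (tr a b) = -1"
  by (simp add: sg_def swap.rep_eq sign_swap_id)

section \<open>Spherical functions of the symmetric group\<close>

definition proper_sph :: "'a set \<Rightarrow> ('a perm \<Rightarrow> real) \<Rightarrow> bool" where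
  "proper_sph S r \<longleftrightarrow> sph (Sym S) r \<and> (\<exists>g\<in>Sym S. r g \<noteq> 1) \<and> (\<exists>g\<in>Sym S. r g \<noteq> sg g)"

lemma sph_Sym_facts:
  assumes "finite S" "sph (Sym S) (r :: 'a perm \<Rightarrow> real)"
  shows "tpos (Sym S) r" "r 0 = 1"
    "g \<in> Sym S \<Longrightarrow> h \<in> Sym S \<Longrightarrow> r (g + h) = r (h + g)"
    "g \<in> Sym S \<Longrightarrow> r (- g) = r g"
    "g \<in> Sym S \<Longrightarrow> h \<in> Sym S \<Longrightarrow> r (h + g - h) = r g"
    "g \<in> Sym S \<Longrightarrow> \<bar>r g\<bar> \<le> 1"
proof -
  show t: "tpos (Sym S) r" using ambivalent_group.sph_tpos [OF ambivalent_Sym] assms by blast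
  show 0: "r 0 = 1" using assms by (simp add: sph_def)
  show c: "g \<in> Sym S \<Longrightarrow> h \<in> Sym S \<Longrightarrow> r (g + h) = r (h + g)" for g h
    using t by (simp add: tpos_def)
  show "g \<in> Sym S \<Longrightarrow> r (- g) = r g" using t by (simp add: tpos_def)
  show "g \<in> Sym S \<Longrightarrow> h \<in> Sym S \<Longrightarrow> r (h + g - h) = r g"
    using c [of h "g - h"] by (simp add: add_diff_eq)
  show "g \<in> Sym S \<Longrightarrow> \<bar>r g\<bar> \<le> 1" using tpos_bound_el' [OF _ t, of g] assms(1) 0 by simp
qed

lemma tr_conj_exists:
  assumes "finite S" "a \<in> S" "b \<in> S" "c \<in> S" "a' \<in> S" "b' \<in> S" "c' \<in> S"
    "distinct [a, b, c]" "distinct [a', b', c']"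
  obtains t where "t \<in> Sym S" "t \<langle>$\<rangle> a = a'" "t \<langle>$\<rangle> b = b'" "t \<langle>$\<rangle> c = c'"
proof -
  define t1 where "t1 = tr a a'"
  define t2 where "t2 = tr (t1 \<langle>$\<rangle> b) b'"
  define t3 where "t3 = tr (t2 \<langle>$\<rangle> (t1 \<langle>$\<rangle> c)) c'"
  have t1: "t1 \<in> Sym S" using assms by (simp add: t1_def)
  have t2: "t2 \<in> Sym S" using assms t1 by (simp add: t2_def)
  have t3: "t3 \<in> Sym S" using assms t1 t2 by (simp add: t3_def)
  have 1: "t1 \<langle>$\<rangle> a = a'" by (simp add: t1_def)
  have "t1 \<langle>$\<rangle> b \<noteq> a'" using 1 assms(8) ap_inj [of t1 b a] by auto
  then have 2: "t2 \<langle>$\<rangle> a' = a'" "t2 \<langle>$\<rangle> (t1 \<langle>$\<rangle> b) = b'" using assms(9) by (auto simp: t2_def ap_tr)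
  have "t2 \<langle>$\<rangle> (t1 \<langle>$\<rangle> c) \<noteq> a'" using 1 2 assms(8) ap_inj [of t2 "t1 \<langle>$\<rangle> c" "t1 \<langle>$\<rangle> a"] by auto
  moreover have "t2 \<langle>$\<rangle> (t1 \<langle>$\<rangle> c) \<noteq> b'"
    using 2 assms(8) ap_inj [of t2 "t1 \<langle>$\<rangle> c" "t1 \<langle>$\<rangle> b"] by auto
  ultimately have 3: "t3 \<langle>$\<rangle> a' = a'" "t3 \<langle>$\<rangle> b' = b'" "t3 \<langle>$\<rangle> (t2 \<langle>$\<rangle> (t1 \<langle>$\<rangle> c)) = c'"
    using assms(9) by (auto simp: t3_def ap_tr)
  show thesis by (rule that [of "t3 + t2 + t1"]) (use t1 t2 t3 1 2 3 in auto)
qed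

text \<open>The commutator of \<open>s\<close> with a transposition that moves the fixed point \<open>y\<close> of \<open>s\<close> is a
  3-cycle, and two 3-cycles compose to a product of two transpositions.\<close>

lemma two_transpositions_bound:
  assumes S: "finite S" and r: "sph (Sym S) (r :: 'a perm \<Rightarrow> real)"
    and s: "s \<in> Sym S" "s \<noteq> 0" and y: "y \<in> S" "s \<langle>$\<rangle> y = y"
    and ab: "a \<in> S" "b \<in> S" "a \<noteq> b" "c \<in> S" "d \<in> S" "c \<noteq> d"
  shows "1 - r (tr a b + tr c d) \<le> 16 * (1 - r s)"
proof -
  note f = sph_Sym_facts [OF S r]
  note G = subgrp_Sym [OF S]
  have tri: "1 - r (g + h) \<le> 2 * (1 - r g) + 2 * (1 - r h)" if "g \<in> Sym S" "h \<in> Sym S" for g h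
    using tpos_length_triangle [OF G f(1) that] f(2) by simp
  have nn: "0 \<le> 1 - r s" using f(6) [OF s(1)] by simp
  obtain x where x: "s \<langle>$\<rangle> x \<noteq> x" using s(2) by (metis ap_simps(2) perm_eqI)
  then have xS: "x \<in> S" using s(1) by (metis Sym_out)
  have sx: "s \<langle>$\<rangle> x \<in> S" "s \<langle>$\<rangle> x \<noteq> y" "x \<noteq> y"
    using s(1) xS x y ap_inj [of s x y] by auto
  \<comment> \<open>The commutator is a product of \<open>s\<close> and a conjugate of
    \<open>- s\<close>, so it costs \<open>2 + 2\<close> times \<open>1 - r s\<close>; conjugation
    reaches all pairs of transpositions that share one point. Combining two such pairs costs
    \<open>2 * 4 + 2 * 4 = 16\<close>.\<close>
  have three: "1 - r (tr u v + tr w v) \<le> 4 * (1 - r s)"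
    if uvw: "u \<in> S" "v \<in> S" "w \<in> S" "distinct [u, w, v]" for u v w
  proof -
    have "s + tr x y - s = tr (s \<langle>$\<rangle> x) y" using y by (simp add: conj_tr)
    then have "tr (s \<langle>$\<rangle> x) y + tr x y = s + (tr x y - s + tr x y)"
      by (metis add.assoc add_diff_eq)
    then have e: "tr (s \<langle>$\<rangle> x) y + tr x y = s + (tr x y + - s - tr x y)"
      by (simp only: diff_conv_add_uminus uminus_tr add.assoc)
    have "1 - r (s + (tr x y + - s - tr x y)) \<le> 2 * (1 - r s) + 2 * (1 - r (tr x y + - s - tr x y))"
      by (rule tri) (use s xS y in auto)
    also have "r (tr x y + - s - tr x y) = r s"
      using f(5) [of "- s" "tr x y"] f(4) [OF s(1)] s xS y by simp
    finally have b: "1 - r (tr (s \<langle>$\<rangle> x) y + tr x y) \<le> 4 * (1 - r s)" by (simp add: e)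
    obtain t where t: "t \<in> Sym S" "t \<langle>$\<rangle> (s \<langle>$\<rangle> x) = u" "t \<langle>$\<rangle> x = w" "t \<langle>$\<rangle> y = v"
      by (rule tr_conj_exists [OF S sx(1) xS y(1) uvw(1,3,2)]) (use x sx uvw in auto)
    have "t + (tr (s \<langle>$\<rangle> x) y + tr x y) - t = (t + tr (s \<langle>$\<rangle> x) y - t) + (t + tr x y - t)"
      by (simp only: diff_conv_add_uminus add.assoc minus_add_cancel)
    also have "\<dots> = tr u v + tr w v" by (simp only: conj_tr t)
    finally show ?thesis using f(5) [of "tr (s \<langle>$\<rangle> x) y + tr x y" t] b t(1) sx xS y by simp
  qed
  have le16: "4 * (1 - r s) \<le> 16 * (1 - r s)" using nn by simp
  consider "{a, b} = {c, d}" | "b = d" "a \<noteq> c" | "b = c" "a \<noteq> d" | "a = c" "b \<noteq> d" | "a = d" "b \<noteq> c"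
    | "a \<noteq> c" "a \<noteq> d" "b \<noteq> c" "b \<noteq> d" by blast
  then show ?thesis
  proof cases
    case 1
    then have "tr a b = tr c d" by (auto simp: doubleton_eq_iff swap_sym)
    then show ?thesis using f(2) nn by simp
  next
    case 2
    then have "1 - r (tr a b + tr c d) \<le> 4 * (1 - r s)" using three [of a b c] ab by simp
    then show ?thesis using le16 by linarith
  next
    case 3
    then have e: "tr c d = tr d b" by (simp add: swap_sym)
    have "1 - r (tr a b + tr d b) \<le> 4 * (1 - r s)" by (rule three) (use 3 ab in auto)
    then show ?thesis unfolding e using le16 by linarith
  next
    case 4
    then have e: "tr c d = tr d a" by (simp add: swap_sym)
    have "1 - r (tr b a + tr d a) \<le> 4 * (1 - r s)" by (rule three) (use 4 ab in auto)
    then show ?thesis unfolding e swap_sym [of b a] using le16 by linarith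
  next
    case 5
    have "1 - r (tr b a + tr c a) \<le> 4 * (1 - r s)" by (rule three) (use 5 ab in auto)
    then show ?thesis unfolding 5(1) [symmetric] swap_sym [of b a] using le16 by linarith
  next
    case 6
    \<comment> \<open>Inserting \<open>tr c b\<close> twice turns two disjoint transpositions into
      two 3-cycles.\<close>
    have "tr a b + tr c d = (tr a b + tr c b) + (tr c b + tr c d)"
      by (simp only: add.assoc tr_tr_left)
    then have e: "tr a b + tr c d = (tr a b + tr c b) + (tr b c + tr d c)"
      by (simp only: swap_sym [of b c] swap_sym [of d c])
    have x: "1 - r ((tr a b + tr c b) + (tr b c + tr d c))
        \<le> 2 * (1 - r (tr a b + tr c b)) + 2 * (1 - r (tr b c + tr d c))"
      by (rule tri) (use ab in auto)
    have y: "1 - r (tr a b + tr c b) \<le> 4 * (1 - r s)" by (rule three) (use 6 ab in auto)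
    have z: "1 - r (tr b c + tr d c) \<le> 4 * (1 - r s)" by (rule three) (use 6 ab in auto)
    have "A \<le> 16 * D" if "A \<le> 2 * B + 2 * C" "B \<le> 4 * D" "C \<le> 4 * D" for A B C D :: real
      using that by linarith
    then show ?thesis unfolding e using x y z by blast
  qed
qed

text \<open>Otherwise all products of two transpositions lie in the kernel, so \<open>r\<close> is
  constant on even and on odd permutations and must be trivial or the sign. The fixed point matters:
  on four points the products of two disjoint transpositions lie in the kernel of the representation
  of degree 2.\<close>

lemma proper_sph_not_one:
  assumes S: "finite S" and pr: "proper_sph S r"
    and s: "s \<in> Sym S" "s \<noteq> 0" and y: "y \<in> S" "s \<langle>$\<rangle> y = y"
  shows "r s < 1"
proof (rule ccontr)
  assume "\<not> r s < 1"
  have r: "sph (Sym S) r" using pr by (simp add: proper_sph_def)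
  note f = sph_Sym_facts [OF S r]
  have rs: "r s = 1" using f(6) [OF s(1)] \<open>\<not> r s < 1\<close> by simp
  interpret ambivalent_group "Sym S" using S by (rule ambivalent_Sym)
  have two: "r (tr a b + tr c d) = 1" if "a \<in> S" "b \<in> S" "a \<noteq> b" "c \<in> S" "d \<in> S" "c \<noteq> d" for a b c d
    using two_transpositions_bound [OF S r s y that] rs f(6) [of "tr a b + tr c d"] that by simp
  obtain x where x: "s \<langle>$\<rangle> x \<noteq> x" using s(2) by (metis ap_simps(2) perm_eqI)
  then have xS: "x \<in> S" using s(1) by (metis Sym_out)
  have xy: "x \<noteq> y" using x y by auto
  define u where "u = tr x y"
  have u: "u \<in> Sym S" "sg u = -1" using xS y xy by (simp_all add: u_def sg_tr)
  have cl: "r (g + h) = r h" if "r g = 1" "g \<in> Sym S" "h \<in> Sym S" for g h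
    by (rule sph_kernel [OF r that(2,1,3)])
  have par: "(sg g = 1 \<and> r g = 1) \<or> (sg g = -1 \<and> r (u + g) = 1)" if "g \<in> Sym S" for g
    using S that
  proof (induction rule: Sym_induct)
    case zero
    then show ?case using f(2) by simp
  next
    case (swap a b q)
    have t: "tr a b \<in> Sym S" "sg (tr a b) = -1" using swap by (simp_all add: sg_tr)
    have ut: "r (u + tr a b) = 1" "r (tr a b + u) = 1"
      using two [of x y a b] two [of a b x y] swap xS y xy by (simp_all add: u_def)
    have qS: "q \<in> Sym S" by (rule swap)
    from swap.IH show ?case
    proof (elim disjE conjE)
      assume q: "sg q = 1" "r q = 1"
      have "r ((u + tr a b) + q) = r q" by (rule cl [OF ut(1)]) (intro Sym_closed u t qS)+
      then have "r (u + (tr a b + q)) = r q" unfolding add.assoc .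
      with q(2) have 1: "r (u + (tr a b + q)) = 1" by (rule trans [rotated])
      have 2: "sg (tr a b + q) = -1" unfolding sg_add q(1) t(2) by simp
      show ?thesis by (rule disjI2, rule conjI, rule 2, rule 1)
    next
      assume q: "sg q = -1" "r (u + q) = 1"
      have e: "(tr a b + u) + (u + q) = tr a b + q" unfolding u_def add.assoc tr_tr_left ..
      have "r ((tr a b + u) + (u + q)) = r (u + q)" by (rule cl [OF ut(2)]) (intro Sym_closed u t qS)+
      then have "r (tr a b + q) = r (u + q)" unfolding e .
      with q(2) have 1: "r (tr a b + q) = 1" by (rule trans [rotated])
      have 2: "sg (tr a b + q) = 1" unfolding sg_add q(1) t(2) by simp
      show ?thesis by (rule disjI1, rule conjI, rule 2, rule 1)
    qed
  qed
  \<comment> \<open>\<open>u\<close> plus any conjugate of \<open>u\<close> is a product of two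
    transpositions, so the average in the functional equation is 1.\<close>
  have ru: "r u * r u = 1"
  proof -
    have "avg (Sym S) (\<lambda>t. r (u + (t + u - t))) = r u * r u" using r u by (simp add: sph_def)
    moreover have "avg (Sym S) (\<lambda>t. r (u + (t + u - t))) = 1"
    proof (rule avg_const_on [OF sub])
      fix t assume t: "t \<in> Sym S"
      then have "r (tr x y + tr (t \<langle>$\<rangle> x) (t \<langle>$\<rangle> y)) = 1"
        using xS y xy by (intro two) simp_all
      then show "r (u + (t + u - t)) = 1" by (simp only: u_def conj_tr)
    qed
    ultimately show ?thesis by (rule trans [OF sym])
  qed
  have odd: "r g = r u" if "sg g = -1" "g \<in> Sym S" for g
  proof -
    have 1: "r (u + g) = 1" using par [OF that(2)] that(1) by (elim disjE conjE) simp_all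
    have "r (u + g + - g) = r (- g)"
      by (rule cl [OF 1]) (rule Sym_closed u that)+
    then show ?thesis using f(4) [OF that(2)] by (simp add: add.assoc)
  qed
  have "r u = 1 \<or> r u = -1" using ru by (simp add: square_eq_1_iff)
  then show False
  proof
    assume "r u = 1"
    then have "r g = 1" if "g \<in> Sym S" for g using par [OF that] odd [OF _ that] by auto
    then show False using pr by (auto simp: proper_sph_def)
  next
    assume "r u = -1"
    then have "r g = sg g" if "g \<in> Sym S" for g using par [OF that] odd [OF _ that] by auto
    then show False using pr by (auto simp: proper_sph_def)
  qed
qed

abbreviation msqS :: "'a set \<Rightarrow> ('a perm \<Rightarrow> real) \<Rightarrow> real" where
  "msqS S r \<equiv> ambivalent_group.msq (Sym S) r"

subsection \<open>Lower bound for the dimension\<close>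

text \<open>Allows permutations to be defined on labels, later subsets of a finite set, instead of
  on the points of \<open>S\<close> that carry the labels.\<close>

lemma Sym_lift:
  assumes S: "finite S" and e: "inj_on e D" "e ` D \<subseteq> S" and f: "inj_on f D" "f ` D \<subseteq> D"
  shows "\<exists>p. p \<in> Sym S \<and> (\<forall>X\<in>D. p \<langle>$\<rangle> (e X) = e (f X)) \<and> (\<forall>z. z \<notin> e ` D \<longrightarrow> p \<langle>$\<rangle> z = z)"
proof -
  define g where "g z = (if z \<in> e ` D then e (f (inv_into D e z)) else z)" for z
  have ge: "g (e X) = e (f X)" if "X \<in> D" for X
    using that e(1) by (simp add: g_def)
  have out: "g z = z" if "z \<notin> e ` D" for z using that by (simp add: g_def)
  have into: "g z \<in> e ` D" if "z \<in> e ` D" for z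
    using that ge f(2) by auto
  have "inj_on g S"
  proof (rule inj_onI)
    fix y z assume yz: "g y = g z"
    show "y = z"
    proof (cases "y \<in> e ` D")
      case True
      then have z: "z \<in> e ` D" using yz into [of y] out [of z] by metis
      obtain X Y where XY: "X \<in> D" "y = e X" "Y \<in> D" "z = e Y" using True z by blast
      then have "e (f X) = e (f Y)" using yz ge by simp
      moreover have "f X \<in> D" "f Y \<in> D" using f(2) XY by auto
      ultimately have "f X = f Y" using e(1) by (simp add: inj_on_eq_iff)
      then have "X = Y" using f(1) XY by (simp add: inj_on_eq_iff)
      then show ?thesis using XY by simp
    next
      case False
      then have "z \<notin> e ` D" using yz into [of z] out [of y] by metis
      then show ?thesis using yz out False by metis
    qed
  qed
  moreover have "g ` S \<subseteq> S"
  proof safe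
    fix z assume "z \<in> S"
    then show "g z \<in> S" using into [of z] out [of z] e(2) by (cases "z \<in> e ` D") auto
  qed
  ultimately obtain p where p: "p \<in> Sym S" "\<And>x. x \<in> S \<Longrightarrow> p \<langle>$\<rangle> x = g x"
    using Sym_obtain_inj [OF S] by blast
  have "p \<langle>$\<rangle> (e X) = e (f X)" if "X \<in> D" for X
    using p(2) [of "e X"] ge [OF that] e(2) that by auto
  moreover have "p \<langle>$\<rangle> z = z" if "z \<notin> e ` D" for z
    using p(2) [of z] out [OF that] Sym_out [OF p(1), of z] by (cases "z \<in> S") auto
  ultimately show ?thesis using p(1) by blast
qed

text \<open>The elementary abelian group of all translations of \<open>Pow {..<l}\<close> acts regularly on
  \<open>2 ^ l\<close> points, and its non-trivial elements are conjugate. So the projection onto any of its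
  non-trivial characters has a small non-zero trace, which bounds the dimension from below.\<close>

lemma msq_bound_pow2:
  assumes S: "finite S" and pr: "proper_sph S r" and l: "1 \<le> l" "2 ^ l < card S"
  shows "msqS S r \<le> 2 / 2 ^ l"
proof -
  have r: "sph (Sym S) r" using pr by (simp add: proper_sph_def)
  note f = sph_Sym_facts [OF S r]
  interpret ambivalent_group "Sym S" using S by (rule ambivalent_Sym)
  define D :: "nat set set" where "D = Pow {..<l}"
  have cD: "card D = 2 ^ l" "finite D" by (simp_all add: D_def card_Pow)
  then obtain A where A: "A \<subseteq> S" "card A = card D" "finite A"
    using obtain_subset_with_card_n [of "card D" S] l by auto
  then obtain e where "bij_betw e D A" using finite_same_card_bij cD by metis
  then have e: "inj_on e D" "e ` D = A" by (auto simp: bij_betw_def)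
  then have eS: "e ` D \<subseteq> S" using A by simp
  \<comment> \<open>This point exists since \<open>2 ^ l\<close> is strictly below
    \<open>card S\<close>. All translations fix it, as \<open>proper_sph_not_one\<close>
    requires.\<close>
  obtain y where y: "y \<in> S" "y \<notin> e ` D"
  proof -
    have "A \<noteq> S" using A cD l by auto
    then show thesis using that A e by blast
  qed
  \<comment> \<open>Symmetric difference, the addition of a vector space over the field with two
    elements; \<open>\<kappa> T\<close> will be the translation by \<open>T\<close>.\<close>
  define sd :: "nat set \<Rightarrow> nat set \<Rightarrow> nat set" where "sd X T = (X - T) \<union> (T - X)" for X T
  have sdD: "sd X T \<in> D" if "X \<in> D" "T \<in> D" for X T using that by (auto simp: sd_def D_def)
  have sd_sd: "sd (sd X T) T = X" for X T by (auto simp: sd_def)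
  have sd_assoc: "sd (sd X T) T' = sd X (sd T T')" for X T T' by (auto simp: sd_def)
  have sd_e: "sd {} T = T" for T by (auto simp: sd_def)
  define P where "P T p \<longleftrightarrow> p \<in> Sym S \<and> (\<forall>X\<in>D. p \<langle>$\<rangle> (e X) = e (sd X T)) \<and> (\<forall>z. z \<notin> e ` D \<longrightarrow> p \<langle>$\<rangle> z = z)" for T p
  define \<kappa> where "\<kappa> T = (SOME p. P T p)" for T
  have PK: "P T (\<kappa> T)" if "T \<in> D" for T
  proof -
    have "inj_on (\<lambda>X. sd X T) D" by (rule inj_onI) (metis sd_sd)
    moreover have "(\<lambda>X. sd X T) ` D \<subseteq> D" using sdD that by auto
    ultimately have "\<exists>p. P T p" unfolding P_def by (rule Sym_lift [OF S e(1) eS])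
    then show ?thesis unfolding \<kappa>_def by (rule someI_ex)
  qed
  have kS: "\<kappa> T \<in> Sym S" and kap: "X \<in> D \<Longrightarrow> \<kappa> T \<langle>$\<rangle> (e X) = e (sd X T)"
    and kout: "z \<notin> e ` D \<Longrightarrow> \<kappa> T \<langle>$\<rangle> z = z" if "T \<in> D" for T X z
    using PK [OF that] by (simp_all add: P_def)
  have D0: "{} \<in> D" by (simp add: D_def)
  have uniq: "p = q" if "\<And>X. X \<in> D \<Longrightarrow> p \<langle>$\<rangle> (e X) = q \<langle>$\<rangle> (e X)"
    "\<And>z. z \<notin> e ` D \<Longrightarrow> p \<langle>$\<rangle> z = q \<langle>$\<rangle> z" for p q
    by (rule perm_eqI) (metis that imageE)
  have kadd: "\<kappa> T + \<kappa> T' = \<kappa> (sd T T')" if "T \<in> D" "T' \<in> D" for T T'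
  proof (rule uniq)
    fix X assume X: "X \<in> D"
    have "sd (sd X T') T = sd X (sd T T')" by (auto simp: sd_def)
    then show "(\<kappa> T + \<kappa> T') \<langle>$\<rangle> (e X) = \<kappa> (sd T T') \<langle>$\<rangle> (e X)"
      using that X sdD by (simp add: kap)
  qed (use that sdD in \<open>simp add: kout\<close>)
  have k0: "\<kappa> {} = 0"
    by (rule uniq) (use D0 in \<open>auto simp: kap kout sd_def\<close>)
  have kneg: "- \<kappa> T = \<kappa> T" if "T \<in> D" for T
  proof -
    have "sd T T = {}" by (auto simp: sd_def)
    then have "\<kappa> T + \<kappa> T = 0" using kadd [OF that that] k0 by simp
    then show ?thesis by (simp add: add_eq_0_iff)
  qed
  have kinj: "inj_on \<kappa> D"
  proof (rule inj_onI)
    fix T T' assume T: "T \<in> D" "T' \<in> D" "\<kappa> T = \<kappa> T'"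
    then have "e T = e T'" using kap [OF T(1) D0] kap [OF T(2) D0] by (simp add: sd_e)
    then show "T = T'" using e(1) T by (simp add: inj_on_eq_iff)
  qed
  define H where "H = \<kappa> ` D"
  have H: "subgrp H"
    unfolding subgrp_def H_def
  proof (intro conjI ballI)
    show "finite (\<kappa> ` D)" using cD by simp
    show "0 \<in> \<kappa> ` D" using k0 D0 by (metis imageI)
    show "g + h \<in> \<kappa> ` D" if "g \<in> \<kappa> ` D" "h \<in> \<kappa> ` D" for g h
      using that kadd sdD by auto
    show "- g \<in> \<kappa> ` D" if "g \<in> \<kappa> ` D" for g using that kneg by auto
  qed
  have HS: "H \<subseteq> Sym S" using kS by (auto simp: H_def)
  \<comment> \<open>The character tests whether 0 belongs to \<open>T\<close>, that is, it reads off
    one coordinate of the translation.\<close>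
  define \<chi> where "\<chi> p = (if 0 \<in> inv_into D \<kappa> p then - 1 else 1 :: real)" for p
  have chi: "\<chi> (\<kappa> T) = (if 0 \<in> T then - 1 else 1)" if "T \<in> D" for T
    using that kinj by (simp add: \<chi>_def)
  have lc: "lchar H \<chi>"
    unfolding lchar_def H_def
  proof (intro conjI ballI)
    fix g h assume "g \<in> \<kappa> ` D" "h \<in> \<kappa> ` D"
    then obtain T T' where T: "T \<in> D" "T' \<in> D" "g = \<kappa> T" "h = \<kappa> T'" by blast
    then show "\<chi> (g + h) = \<chi> g * \<chi> h"
      using chi [OF T(1)] chi [OF T(2)] chi [OF sdD [OF T(1,2)]] kadd [OF T(1,2)]
      by (auto simp: sd_def)
  qed (auto simp: \<chi>_def)
  have single: "r (\<kappa> T) = r (\<kappa> {i})" if T: "T \<in> D" "i \<in> T" for T i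
  proof -
    \<comment> \<open>A linear involution of the label space that sends \<open>T\<close> to
      \<open>{i}\<close>, and so conjugates one translation into the other.\<close>
    define g where "g X = (if i \<in> X then sd X (T - {i}) else X)" for X
    have Ti: "T - {i} \<in> D" "{i} \<in> D" using T by (auto simp: D_def)
    have gi: "i \<in> g X \<longleftrightarrow> i \<in> X" for X by (auto simp: g_def sd_def)
    have gg: "g (g X) = X" for X using gi [of X] sd_sd by (simp add: g_def)
    have "inj_on g D" by (rule inj_onI) (metis gg)
    moreover have "g ` D \<subseteq> D" using sdD Ti by (auto simp: g_def)
    ultimately obtain t where t: "t \<in> Sym S" "\<And>X. X \<in> D \<Longrightarrow> t \<langle>$\<rangle> (e X) = e (g X)"
      "\<And>z. z \<notin> e ` D \<Longrightarrow> t \<langle>$\<rangle> z = z"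
      using Sym_lift [OF S e(1) eS, of g] by blast
    have "t + \<kappa> T = \<kappa> {i} + t"
    proof (rule uniq)
      fix X assume X: "X \<in> D"
      have gD: "g X \<in> D" using X sdD Ti by (simp add: g_def)
      have "g (sd X T) = sd (g X) {i}"
        using T(2) by (auto simp: g_def sd_def)
      then show "(t + \<kappa> T) \<langle>$\<rangle> (e X) = (\<kappa> {i} + t) \<langle>$\<rangle> (e X)"
        using X gD T Ti sdD by (simp add: t kap)
    qed (use t T Ti in \<open>simp add: kout\<close>)
    then have "t + \<kappa> T - t = \<kappa> {i}" by (simp add: add.assoc)
    then show ?thesis using f(5) [OF kS [OF T(1)] t(1)] by simp
  qed
  have i0: "{0} \<in> D" using l by (auto simp: D_def)
  have all: "r (\<kappa> T) = r (\<kappa> {0})" if T: "T \<in> D" "T \<noteq> {}" for T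
  proof -
    obtain i where i: "i \<in> T" using T by blast
    \<comment> \<open>This set contains both labels, so its translation is conjugate to those of
      both singletons.\<close>
    then have "{i, 0} \<in> D" using T l by (auto simp: D_def)
    then have "r (\<kappa> {i, 0}) = r (\<kappa> {i})" "r (\<kappa> {i, 0}) = r (\<kappa> {0})" using single by blast+
    then show ?thesis using single [OF T(1) i] by simp
  qed
  define r0 where "r0 = r (\<kappa> {0})"
  have "\<kappa> {0} \<noteq> 0"
  proof
    assume "\<kappa> {0} = 0"
    then have "e {0} = e {}" using kap [OF i0 D0] by (simp add: sd_e)
    then show False using e(1) i0 D0 by (auto simp: inj_on_eq_iff)
  qed
  then have r01: "r0 < 1"
    unfolding r0_def using proper_sph_not_one [OF S pr kS [OF i0] _ y(1)] kout [OF i0 y(2)] by blast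
  have r0m: "r0 \<ge> - 1" using f(6) [OF kS [OF i0]] by (simp add: r0_def)
  have sumchi: "(\<Sum>T\<in>D. \<chi> (\<kappa> T)) = 0"
  proof -
    have "(\<Sum>T\<in>D. \<chi> (\<kappa> T)) = (\<Sum>T\<in>D. - \<chi> (\<kappa> T))"
    proof (rule sum.reindex_bij_witness [where i = "\<lambda>T. sd T {0}" and j = "\<lambda>T. sd T {0}"])
      fix T assume T: "T \<in> D"
      show "sd (sd T {0}) {0} = T" "sd (sd T {0}) {0} = T" by (simp_all add: sd_sd)
      show "sd T {0} \<in> D" "sd T {0} \<in> D" using sdD T i0 by auto
      show "- \<chi> (\<kappa> (sd T {0})) = \<chi> (\<kappa> T)"
        using chi [OF T] chi [OF sdD [OF T i0]] by (auto simp: sd_def)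
    qed
    then show ?thesis by (simp add: sum_negf)
  qed
  \<comment> \<open>All non-trivial translations have the value \<open>r0\<close>, and \<chi> sums
    to -1 over them. What remains is \<open>1 - r0\<close>, which is positive because
    \<open>\<kappa> {0}\<close> is not in the kernel.\<close>
  have "lext r (proj H \<chi>) = (1 / 2 ^ l) * (\<Sum>T\<in>D. \<chi> (\<kappa> T) * r (\<kappa> T))"
    unfolding lext_proj avg_def H_def using kinj cD by (simp add: sum.reindex card_image)
  also have "(\<Sum>T\<in>D. \<chi> (\<kappa> T) * r (\<kappa> T)) = 1 + (\<Sum>T\<in>D - {{}}. \<chi> (\<kappa> T) * r (\<kappa> T))"
    using cD D0 chi [OF D0] k0 f(2) by (subst sum.remove [of _ "{}"]) auto
  also have "(\<Sum>T\<in>D - {{}}. \<chi> (\<kappa> T) * r (\<kappa> T)) = (\<Sum>T\<in>D - {{}}. \<chi> (\<kappa> T)) * r0"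
    unfolding sum_distrib_right by (rule sum.cong) (use all in \<open>auto simp: r0_def\<close>)
  also have "(\<Sum>T\<in>D - {{}}. \<chi> (\<kappa> T)) = - 1"
    using sumchi cD D0 chi [OF D0] by (subst (asm) sum.remove [of _ "{}"]) auto
  finally have tr: "lext r (proj H \<chi>) = (1 - r0) / 2 ^ l" by simp
  have "msq r \<le> lext r (proj H \<chi>)"
    by (rule msq_le_projection [OF r]) (use proj_alg [OF HS] proj_idem [OF lc H] star_proj [OF lc H] tr r01 in auto)
  also have "\<dots> \<le> 2 / 2 ^ l" unfolding tr using r0m by (intro divide_right_mono) auto
  finally show ?thesis .
qed

text \<open>The largest power of 2 below \<open>card S\<close> is at least half of
  \<open>card S\<close>, which doubles the constant 2 to 4.\<close>

lemma msq_bound: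
  assumes S: "finite S" and pr: "proper_sph S r" and n: "card S \<ge> 3"
  shows "msqS S r \<le> 4 / card S"
proof -
  define l where "l = (GREATEST l. 2 ^ l < card S)"
  have bd: "k \<le> card S" if "2 ^ k < card S" for k
    using that less_exp [of k] by linarith
  have 1: "2 ^ l < card S"
    unfolding l_def by (rule GreatestI_nat [of _ 1, OF _ bd]) (use n in auto)
  have 2: "1 \<le> l"
    unfolding l_def by (rule Greatest_le_nat [OF _ bd]) (use n in auto)
  have "\<not> 2 ^ Suc l < card S"
  proof
    assume "2 ^ Suc l < card S"
    then have "Suc l \<le> l" unfolding l_def by (rule Greatest_le_nat [OF _ bd])
    then show False by simp
  qed
  then have "real (card S) \<le> 2 * 2 ^ l"
    by (metis not_less of_nat_le_iff of_nat_numeral of_nat_power power_Suc)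
  moreover have "msqS S r \<le> 2 / 2 ^ l" by (rule msq_bound_pow2 [OF S pr 2 1])
  moreover have "2 / 2 ^ l \<le> 4 / real (card S)"
    using calculation(1) n by (simp add: field_simps)
  ultimately show ?thesis by linarith
qed

subsection \<open>Young subgroups with two blocks\<close>

lemma Sym_disjoint_commute:
  assumes "p \<in> Sym A" "q \<in> Sym B" "A \<inter> B = {}"
  shows "p + q = q + p"
proof (rule perm_eqI)
  fix x
  have "x \<notin> A \<or> x \<notin> B" using assms(3) by blast
  then show "(p + q) \<langle>$\<rangle> x = (q + p) \<langle>$\<rangle> x"
  proof
    assume x: "x \<notin> A"
    then have "q \<langle>$\<rangle> x \<notin> A \<or> q \<langle>$\<rangle> x = x" using Sym_out [OF assms(2), of x] Sym_in [OF assms(2), of x] assms(3) by blast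
    then have "p \<langle>$\<rangle> (q \<langle>$\<rangle> x) = q \<langle>$\<rangle> x" using Sym_out [OF assms(1)] x by auto
    then show ?thesis using Sym_out [OF assms(1) x] by simp
  next
    assume x: "x \<notin> B"
    then have "p \<langle>$\<rangle> x \<notin> B \<or> p \<langle>$\<rangle> x = x" using Sym_out [OF assms(1), of x] Sym_in [OF assms(1), of x] assms(3) by blast
    then have "q \<langle>$\<rangle> (p \<langle>$\<rangle> x) = p \<langle>$\<rangle> x" using Sym_out [OF assms(2)] x by auto
    then show ?thesis using Sym_out [OF assms(2) x] by simp
  qed
qed

lemma alg_Sym_disjoint_commute:
  assumes "x \<in> alg (Sym A)" "y \<in> alg (Sym B)" "A \<inter> B = {}"
  shows "x * y = y * x"
proof (rule alg_linear_eq [where x = x and G = "Sym A"])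
  fix p assume p: "p \<in> Sym A"
  show "el p * y = y * el p"
    by (rule alg_linear_eq [where x = y and G = "Sym B"])
       (use assms p Sym_disjoint_commute [OF p _ assms(3)] in \<open>auto intro!: lin_intros simp flip: el_add\<close>)
qed (use assms in \<open>auto intro!: lin_intros\<close>)

lemma Sym_map_sets:
  assumes B: "finite B" and UV: "U \<subseteq> B" "V \<subseteq> B" "card U = card V"
  obtains b where "b \<in> Sym B" "(\<langle>$\<rangle>) b ` U = V"
proof -
  have fin: "finite U" "finite V" using B UV finite_subset by auto
  obtain f where f: "bij_betw f U V" using finite_same_card_bij [OF fin UV(3)] by blast
  have "card (B - U) = card (B - V)" using B UV fin by (simp add: card_Diff_subset)
  then obtain g where g: "bij_betw g (B - U) (B - V)"
    using finite_same_card_bij [of "B - U" "B - V"] B by auto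
  define h where "h x = (if x \<in> U then f x else g x)" for x
  have "bij_betw h U V" using f by (simp add: h_def cong: bij_betw_cong)
  moreover have "bij_betw h (B - U) (B - V)"
    using g by (subst bij_betw_cong [of _ _ g]) (auto simp: h_def)
  ultimately have "bij_betw h (U \<union> (B - U)) (V \<union> (B - V))"
    by (rule bij_betw_combine) auto
  moreover have "U \<union> (B - U) = B" "V \<union> (B - V) = B" using UV by auto
  ultimately have "bij_betw h B B" by simp
  then obtain b where b: "b \<in> Sym B" "\<And>x. x \<in> B \<Longrightarrow> b \<langle>$\<rangle> x = h x"
    using Sym_obtain [OF B] by blast
  have "(\<langle>$\<rangle>) b ` U = f ` U" using UV b(2) by (intro image_cong) (auto simp: h_def)
  also have "\<dots> = V" using f by (simp add: bij_betw_def)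
  finally show thesis using that b(1) by blast
qed

lemma Sym_stabilizer:
  assumes S: "finite (B \<union> C)" "B \<inter> C = {}" and k: "k \<in> Sym (B \<union> C)" "(\<langle>$\<rangle>) k ` B = B"
  obtains b c where "b \<in> Sym B" "c \<in> Sym C" "k = b + c"
proof -
  have "bij_betw ((\<langle>$\<rangle>) k) B B" using k(2) by (auto simp: bij_betw_def inj_on_def)
  then obtain b where b: "b \<in> Sym B" "\<And>x. x \<in> B \<Longrightarrow> b \<langle>$\<rangle> x = k \<langle>$\<rangle> x"
    using Sym_obtain [of B] S by auto
  have "- b + k \<in> Sym C"
    unfolding Sym_iff
  proof (intro allI impI)
    fix x assume "x \<notin> C"
    show "(- b + k) \<langle>$\<rangle> x = x"
    proof (cases "x \<in> B")
      case True
      then show ?thesis using b by (simp add: ap_uminus_eq)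
    next
      case False
      then have "k \<langle>$\<rangle> x = x" "b \<langle>$\<rangle> x = x"
        using \<open>x \<notin> C\<close> Sym_out [OF k(1)] Sym_out [OF b(1)] by auto
      then show ?thesis by (simp add: ap_uminus_eq)
    qed
  qed
  then show thesis using that [of b "- b + k"] b(1) by (simp flip: add.assoc)
qed

definition inva :: "'a set \<Rightarrow> 'a perm grp_alg" where
  "inva A = proj (Sym A) (\<lambda>_. 1)"

lemma inva_simps:
  assumes "finite A"
  shows "inva A * inva A = inva A" "star (inva A) = inva A"
    "p \<in> Sym A \<Longrightarrow> el p * inva A = inva A" "p \<in> Sym A \<Longrightarrow> inva A * el p = inva A"
    "inva A \<in> cen (Sym A)" "A \<subseteq> S \<Longrightarrow> inva A \<in> alg (Sym S)"
  using proj_idem [OF lchar_one] star_proj [OF lchar_one] el_proj [OF lchar_one] proj_el [OF lchar_one]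
    proj_cen [OF lchar_one] subgrp_Sym [OF assms] proj_alg [OF Sym_mono]
  by (simp_all add: inva_def)

text \<open>The double coset of \<open>g\<close> modulo the Young subgroup depends only on the
  number of points of \<open>B\<close> that \<open>g\<close> keeps in \<open>B\<close>, and this
  number is the same for \<open>- g\<close>. That gives the symmetry required by
  \<open>gelfand_bound\<close>.\<close>

lemma young_bound:
  assumes S: "finite B" "finite C" "B \<inter> C = {}" and r: "sph (Sym (B \<union> C)) r"
  shows "(lext r (inva B * inva C))\<^sup>2 \<le> msqS (B \<union> C) r"
proof -
  have fS: "finite (B \<union> C)" using S by simp
  interpret ambivalent_group "Sym (B \<union> C)" using fS by (rule ambivalent_Sym)
  note iB = inva_simps [OF S(1)] and iC = inva_simps [OF S(2)]
  have comm: "inva B * inva C = inva C * inva B"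
    using iB(5) iC(5) S(3) by (intro alg_Sym_disjoint_commute) (auto simp: cen_alg)
  define p where "p = inva B * inva C"
  have p': "p = inva C * inva B" by (simp add: p_def comm)
  have pb: "el b * p = p" "p * el b = p" if "b \<in> Sym B" for b
    using iB(3,4) [OF that] by (simp_all add: p_def mult.assoc [symmetric]) (simp add: comm mult.assoc)
  have pc: "el c * p = p" "p * el c = p" if "c \<in> Sym C" for c
    using iC(3,4) [OF that] by (simp_all add: p' mult.assoc [symmetric]) (simp add: comm [symmetric] mult.assoc)
  have pk: "el k * p = p" "p * el k = p" if k: "k \<in> Sym (B \<union> C)" "(\<langle>$\<rangle>) k ` B = B" for k
  proof -
    obtain b c where bc: "b \<in> Sym B" "c \<in> Sym C" "k = b + c"
      using Sym_stabilizer [OF fS S(3) k] by blast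
    show "el k * p = p" by (simp add: bc(3) el_add mult.assoc pc(1) [OF bc(2)] pb(1) [OF bc(1)])
    have "p * el k = p * el b * el c" by (simp add: bc(3) el_add mult.assoc)
    then show "p * el k = p" by (simp add: pb(2) [OF bc(1)] pc(2) [OF bc(2)])
  qed
  show ?thesis
    unfolding p_def [symmetric]
  proof (rule gelfand_bound [OF r])
    show "p \<in> alg (Sym (B \<union> C))" unfolding p_def by (intro alg_mult sub iB iC) auto
    have "p * p = inva B * (inva C * inva B) * inva C" by (simp add: p_def mult.assoc)
    also have "\<dots> = inva B * inva B * (inva C * inva C)" by (simp add: mult.assoc flip: comm)
    finally show "p * p = p" by (simp add: iB iC p_def)
    show "star p = p" by (simp add: p_def star_mult iB iC comm)
    fix g assume g: "g \<in> Sym (B \<union> C)"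
    define X where "X = (\<langle>$\<rangle>) g ` B"
    define Y where "Y = (\<langle>$\<rangle>) (- g) ` B"
    have inj: "inj_on ((\<langle>$\<rangle>) q) Z" for q :: "'a perm" and Z by (simp add: inj_on_def)
    have XS: "X \<subseteq> B \<union> C" "Y \<subseteq> B \<union> C" 
      using Sym_in [OF g] Sym_in [OF Sym_closed(3) [OF g]] unfolding X_def Y_def by blast+
    have Y_iff: "y \<in> Y \<longleftrightarrow> g \<langle>$\<rangle> y \<in> B" for y
    proof
      show "g \<langle>$\<rangle> y \<in> B" if "y \<in> Y" using that by (auto simp: Y_def)
      show "y \<in> Y" if "g \<langle>$\<rangle> y \<in> B"
        unfolding Y_def by (rule image_eqI [OF _ that]) simp
    qed
    have gY: "(\<langle>$\<rangle>) g ` (Y \<inter> B) = X \<inter> B" by (auto simp: X_def Y_iff)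
    have cB: "card (X \<inter> B) = card (Y \<inter> B)" using card_image [OF inj, of g "Y \<inter> B"] gY by simp
    have cX: "card X = card Y" using card_image [OF inj] by (simp add: X_def Y_def)
    have fin: "finite X" "finite Y" using XS fS finite_subset by auto
    have dec: "Z \<inter> C = Z - (Z \<inter> B)" if "Z \<subseteq> B \<union> C" for Z using that S(3) by auto
    have cC: "card (X \<inter> C) = card (Y \<inter> C)"
      using dec [OF XS(1)] dec [OF XS(2)] cX cB fin by (simp add: card_Diff_subset)
    obtain b where b: "b \<in> Sym B" "(\<langle>$\<rangle>) b ` (X \<inter> B) = Y \<inter> B"
      using Sym_map_sets [OF S(1), of "X \<inter> B" "Y \<inter> B"] cB by auto
    obtain c where c: "c \<in> Sym C" "(\<langle>$\<rangle>) c ` (X \<inter> C) = Y \<inter> C"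
      using Sym_map_sets [OF S(2), of "X \<inter> C" "Y \<inter> C"] cC by auto
    \<comment> \<open>\<open>h\<close> carries the image of \<open>B\<close> under \<open>g\<close>
      to its preimage, so \<open>g + h + g\<close> preserves \<open>B\<close>; solving for
      \<open>- g\<close> places it in the double coset of \<open>g\<close>.\<close>
    define h where "h = b + c"
    have hS: "h \<in> Sym (B \<union> C)"
      unfolding h_def
      by (intro Sym_closed(2) subsetD [OF Sym_mono b(1)] subsetD [OF Sym_mono c(1)]) auto
    have hB: "h \<langle>$\<rangle> x = b \<langle>$\<rangle> x" if "x \<in> B" for x
    proof -
      have "x \<notin> C" using that S(3) by auto
      then show ?thesis using Sym_out [OF c(1)] by (simp add: h_def)
    qed
    have hC: "h \<langle>$\<rangle> x = c \<langle>$\<rangle> x" if "x \<in> C" for x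
    proof -
      have "c \<langle>$\<rangle> x \<notin> B" using that S(3) c(1) by auto
      then show ?thesis using Sym_out [OF b(1)] by (simp add: h_def)
    qed
    have "(\<langle>$\<rangle>) h ` X = (\<langle>$\<rangle>) h ` (X \<inter> B) \<union> (\<langle>$\<rangle>) h ` (X \<inter> C)" using XS by auto
    also have "(\<langle>$\<rangle>) h ` (X \<inter> B) = Y \<inter> B" unfolding b(2) [symmetric] using hB by (intro image_cong) auto
    also have "(\<langle>$\<rangle>) h ` (X \<inter> C) = Y \<inter> C" unfolding c(2) [symmetric] using hC by (intro image_cong) auto
    also have "Y \<inter> B \<union> Y \<inter> C = Y" using XS by auto
    finally have hX: "(\<langle>$\<rangle>) h ` X = Y" .
    define k where "k = g + h + g"
    have kS: "k \<in> Sym (B \<union> C)" using g hS by (simp add: k_def)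
    have "(\<langle>$\<rangle>) k ` B = (\<langle>$\<rangle>) g ` ((\<langle>$\<rangle>) h ` X)" by (auto simp: k_def X_def image_iff)
    also have "\<dots> = B" unfolding hX by (auto simp: Y_def image_iff)
    finally have kB: "(\<langle>$\<rangle>) k ` B = B" .
    have "(\<langle>$\<rangle>) (- k) ` B = (\<langle>$\<rangle>) (- k) ` ((\<langle>$\<rangle>) k ` B)" by (simp only: kB)
    then have kB': "(\<langle>$\<rangle>) (- k) ` B = B" by (simp add: image_image)
    have "- g = h + g + - k"
      by (simp only: k_def minus_add add.assoc add_minus_cancel)
    then have "p * el (- g) * p = (p * el b) * el c * el g * (el (- k) * p)"
      by (simp only: h_def el_add mult.assoc)
    also have "\<dots> = p * el g * p"
      using pb(2) [OF b(1)] pc(2) [OF c(1)] pk(1) [OF _ kB'] kS by simp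
    finally show "p * el (- g) * p = p * el g * p" .
  qed
qed

subsection \<open>Permutations without fixed points\<close>

definition altp :: "'a set \<Rightarrow> 'a perm grp_alg" where
  "altp A = proj (Sym A) sg"

text \<open>Removes the parts on which \<open>Sym A\<close> acts by a linear character; there class
  sums have eigenvalues 1 or -1, and averaging over conjugates gains nothing.\<close>

definition rest :: "'a set \<Rightarrow> 'a perm grp_alg" where
  "rest A = 1 - inva A - altp A"

lemma altp_simps:
  assumes "finite A"
  shows "altp A * altp A = altp A" "star (altp A) = altp A" "altp A \<in> cen (Sym A)"
  using proj_idem [OF lchar_sg] star_proj [OF lchar_sg] proj_cen [OF lchar_sg] subgrp_Sym [OF assms]
  by (simp_all add: altp_def)

lemma inva_altp_orth:
  assumes A: "finite A" "2 \<le> card A"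
  shows "inva A * altp A = 0" "altp A * inva A = 0"
proof -
  obtain a b where ab: "a \<in> A" "b \<in> A" "a \<noteq> b"
    using A(2) by (metis card_2_iff' card_le_Suc0_iff_eq A(1) not_less_eq_eq numeral_2_eq_2)
  then have t: "tr a b \<in> Sym A" "sg (tr a b) \<noteq> 1" by (simp_all add: sg_tr)
  show "inva A * altp A = 0" "altp A * inva A = 0"
    unfolding inva_def altp_def
    using proj_orth [OF lchar_one lchar_sg subgrp_Sym [OF A(1)] t(1)]
      proj_orth [OF lchar_sg lchar_one subgrp_Sym [OF A(1)] t(1)] t(2) by auto
qed

lemma rest_simps:
  assumes A: "finite A" "2 \<le> card A"
  shows "rest A * rest A = rest A" "star (rest A) = rest A" "rest A \<in> cen (Sym A)"
    "rest A * inva A = 0" "rest A * altp A = 0"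
proof -
  note i = inva_simps [OF A(1)] and a = altp_simps [OF A(1)] and o = inva_altp_orth [OF A]
  show ri: "rest A * inva A = 0" and ra: "rest A * altp A = 0"
    by (simp_all add: rest_def left_diff_distrib i a o)
  have "rest A * rest A = rest A * (1 - inva A - altp A)" by (simp add: rest_def)
  then show "rest A * rest A = rest A" by (simp add: right_diff_distrib ri ra)
  show "star (rest A) = rest A" by (simp add: rest_def star_linear i a)
  show "rest A \<in> cen (Sym A)"
    unfolding rest_def by (intro cen_closed cen_1 subgrp_Sym A i a)
qed

text \<open>On the block of a character \<open>r i\<close> of \<open>Sym A\<close> the class sum of
  \<open>q\<close> acts as \<open>r i q\<close>, so averaging over \<open>q\<close> produces
  \<open>msq (r i)\<close>. The factor \<open>rest A\<close> kills the two characters to which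
  \<open>msq_bound\<close> does not apply.\<close>

lemma rest_square_mean:
  assumes A: "finite A" "3 \<le> card A" and phi: "tpos (Sym A) \<phi>" and phi0: "\<phi> 0 = 1"
  shows "avg (Sym A) (\<lambda>q. lext \<phi> (csum (Sym A) q * csum (Sym A) q * rest A)) \<le> 4 / card A"
proof -
  interpret ambivalent_group "Sym A" using A(1) by (rule ambivalent_Sym)
  have A2: "2 \<le> card A" using A by simp
  note rs = rest_simps [OF A(1) A2] and i = inva_simps [OF A(1)] and al = altp_simps [OF A(1)]
  obtain n :: nat and w r where w: "\<And>i. i < n \<Longrightarrow> 0 \<le> w i" and r: "\<And>i. i < n \<Longrightarrow> sph (Sym A) (r i)"
    and dec: "\<And>x. x \<in> alg (Sym A) \<Longrightarrow> lext \<phi> x = (\<Sum>i<n. w i * lext (r i) x :: real)"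
    using tpos_decomposition [OF phi] by blast
  have zc: "csum (Sym A) q * csum (Sym A) q * rest A \<in> cen (Sym A)" if "q \<in> Sym A" for q
    using that by (intro cen_mult sub csum_cen rs)
  have val: "lext (r i) (csum (Sym A) q * csum (Sym A) q * rest A) = (r i q)\<^sup>2 * lext (r i) (rest A)"
    if "i < n" "q \<in> Sym A" for i q
  proof -
    note z = csum_cen [OF sub that(2)]
    have c: "lext (r i) (csum (Sym A) q) = r i q"
      by (rule tpos_csum [OF sph_tpos [OF r [OF that(1)]] that(2)])
    have "lext (r i) (csum (Sym A) q * csum (Sym A) q * rest A) =
        lext (r i) (csum (Sym A) q * csum (Sym A) q) * lext (r i) (rest A)"
      by (rule sph_lext_mult [OF sub r [OF that(1)] _ rs(3)]) (intro cen_alg cen_mult sub z)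
    also have "lext (r i) (csum (Sym A) q * csum (Sym A) q) = r i q * r i q"
      using sph_lext_mult [OF sub r [OF that(1)] cen_alg [OF z] z] by (simp add: c)
    finally show ?thesis by (simp add: power2_eq_square)
  qed
  have one: "msq (r i) * lext (r i) (rest A) \<le> 4 / card A" if "i < n" for i
  proof (cases "proper_sph A (r i)")
    case True
    note ri = r [OF that]
    have "\<exists>g\<in>Sym A. r i g \<noteq> 1" "\<exists>g\<in>Sym A. r i g \<noteq> sg g"
      using True by (auto simp: proper_sph_def)
    then have "lext (r i) (inva A) = 0" "lext (r i) (altp A) = 0"
      using sph_proj_eq_lchar [OF ri lchar_one] sph_proj_eq_lchar [OF ri lchar_sg]
      unfolding inva_def altp_def by blast+
    moreover have "lext (r i) 1 = 1" using lext_el [of "r i" 0] ri by (simp add: el_0 sph_def)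
    ultimately have "lext (r i) (rest A) = 1" by (simp add: rest_def lext_simps)
    then show ?thesis using msq_bound [OF A(1) True A(2)] by simp
  next
    case False
    note ri = r [OF that]
    have "lext (r i) (rest A) = 0"
    proof (cases "\<forall>g\<in>Sym A. r i g = 1")
      case True
      have "lext (r i) (inva A) = avg (Sym A) (\<lambda>g. 1 * r i g)" by (simp add: inva_def lext_proj)
      also have "\<dots> = 1" by (rule avg_const_on [OF sub]) (use True in simp)
      finally have "lext (r i) (rest A * inva A) = lext (r i) (rest A)"
        using sph_lext_mult [OF sub ri cen_alg [OF rs(3)] i(5)] by simp
      then show ?thesis by (simp add: rs lext_simps)
    next
      case F: False
      then have sgn: "\<forall>g\<in>Sym A. r i g = sg g" using False ri by (auto simp: proper_sph_def)
      have "lext (r i) (altp A) = avg (Sym A) (\<lambda>g. sg g * r i g)" by (simp add: altp_def lext_proj)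
      also have "\<dots> = 1"
        by (rule avg_const_on [OF sub]) (use sgn lcharD(2) [OF lchar_sg sub] in simp)
      finally have "lext (r i) (rest A * altp A) = lext (r i) (rest A)"
        using sph_lext_mult [OF sub ri cen_alg [OF rs(3)] al(3)] by simp
      then show ?thesis by (simp add: rs lext_simps)
    qed
    then show ?thesis by simp
  qed
  have sumw: "(\<Sum>i<n. w i) = 1"
  proof -
    have "lext \<phi> (el 0) = (\<Sum>i<n. w i * lext (r i) (el 0))" by (rule dec) simp
    also have "\<dots> = (\<Sum>i<n. w i)" using r by (intro sum.cong) (auto simp: sph_def)
    finally show ?thesis using phi0 by simp
  qed
  have "avg (Sym A) (\<lambda>q. lext \<phi> (csum (Sym A) q * csum (Sym A) q * rest A)) =
      avg (Sym A) (\<lambda>q. \<Sum>i<n. w i * ((r i q)\<^sup>2 * lext (r i) (rest A)))"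
  proof (rule avg_cong)
    fix q assume q: "q \<in> Sym A"
    have "lext \<phi> (csum (Sym A) q * csum (Sym A) q * rest A) =
        (\<Sum>i<n. w i * lext (r i) (csum (Sym A) q * csum (Sym A) q * rest A))"
      by (rule dec [OF cen_alg [OF zc [OF q]]])
    also have "\<dots> = (\<Sum>i<n. w i * ((r i q)\<^sup>2 * lext (r i) (rest A)))"
      by (rule sum.cong) (use val q in auto)
    finally show "lext \<phi> (csum (Sym A) q * csum (Sym A) q * rest A) =
        (\<Sum>i<n. w i * ((r i q)\<^sup>2 * lext (r i) (rest A)))" .
  qed
  also have "\<dots> = (\<Sum>i<n. w i * (msq (r i) * lext (r i) (rest A)))"
    by (simp add: avg_sum avg_mult_left avg_mult_right msq_def)
  also have "\<dots> \<le> (\<Sum>i<n. w i * (4 / card A))"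
    using w one by (intro sum_mono mult_left_mono) auto
  also have "\<dots> = (\<Sum>i<n. w i) * (4 / card A)" by (simp only: sum_distrib_right)
  also have "\<dots> = 4 / card A" by (simp only: sumw mult_1)
  finally show ?thesis .
qed

text \<open>Conjugating \<open>s\<close> by \<open>h\<close> in \<open>Sym A\<close> gives
  \<open>s + c h - h\<close>, where \<open>c h\<close> lives on a block disjoint from
  \<open>A\<close>. Averaging over \<open>h\<close> and Cauchy-Schwarz reduce the claim to the mean
  of the correlations \<open>f q\<close>, in which \<open>q\<close> may be replaced by its class
  sum; \<open>rest_square_mean\<close> controls that.\<close>

lemma rest_bound:
  assumes S: "finite S" and r: "sph (Sym S) r" and s: "s \<in> Sym S"
    and A: "A \<subseteq> S" "3 \<le> card A" "(\<langle>$\<rangle>) s ` A \<inter> A = {}"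
  shows "(lext r (el s * rest A))\<^sup>2 \<le> 2 / sqrt (card A)"
proof -
  have fA: "finite A" using A(1) S finite_subset by auto
  have A2: "2 \<le> card A" using A by simp
  interpret ambivalent_group "Sym S" using S by (rule ambivalent_Sym)
  interpret A: ambivalent_group "Sym A" using fA by (rule ambivalent_Sym)
  note rt = sph_tpos [OF r]
  have AS: "Sym A \<subseteq> Sym S" by (rule Sym_mono [OF A(1)])
  note rs = rest_simps [OF fA A2]
  define e0 where "e0 = rest A"
  have e0A: "e0 \<in> alg (Sym A)" using rs by (simp add: e0_def cen_alg)
  have e0S: "e0 \<in> alg (Sym S)" using alg_mono [OF AS e0A] .
  have e0c: "el h * e0 = e0 * el h" if "h \<in> Sym A" for h
    using rs(3) that by (simp add: e0_def cen_def)
  have e0: "e0 * e0 = e0" "star e0 = e0" using rs by (simp_all add: e0_def)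
  have inS: "h \<in> Sym S" if "h \<in> Sym A" for h using AS that by blast
  \<comment> \<open>Disjoint from \<open>A\<close> because \<open>s\<close> moves \<open>A\<close>
    off itself; hence \<open>c h\<close> commutes with \<open>Sym A\<close>.\<close>
  define B where "B = (\<langle>$\<rangle>) (- s) ` A"
  have "A \<inter> B = {}" using A(3) by (auto simp: B_def)
  define c where "c h = - s + h + s" for h
  have cB: "c h \<in> Sym B" if "h \<in> Sym A" for h
    unfolding Sym_iff
  proof (intro allI impI)
    fix x assume "x \<notin> B"
    then have "s \<langle>$\<rangle> x \<notin> A" unfolding B_def by (metis ap_cancel(1) image_eqI)
    then show "c h \<langle>$\<rangle> x = x" using Sym_out [OF that] by (simp add: c_def)
  qed
  have cS: "c h \<in> Sym S" if "h \<in> Sym A" for h using inS [OF that] s by (simp add: c_def)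
  have comm: "h + c k = c k + h" if "h \<in> Sym A" "k \<in> Sym A" for h k
    by (rule Sym_disjoint_commute [OF that(1) cB [OF that(2)] \<open>A \<inter> B = {}\<close>])
  have c_add: "c (h + k) = c h + c k" for h k
    unfolding c_def by (simp only: add.assoc add_minus_cancel)
  have c_neg: "c (- h) = - c h" for h
    unfolding c_def by (simp only: minus_add add.assoc minus_minus)
  have e0cc: "el (c k) * e0 = e0 * el (c k)" if "k \<in> Sym A" for k
    by (rule alg_Sym_disjoint_commute [of _ B _ A]) (use cB [OF that] e0A \<open>A \<inter> B = {}\<close> in auto)
  define x where "x = avg (Sym A) (\<lambda>h. el (c h) * el (- h))"
  have xS: "x \<in> alg (Sym S)"
    unfolding x_def by (intro avg_alg alg_mult sub) (use cS inS in auto)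
  have yS: "x * e0 \<in> alg (Sym S)" by (intro alg_mult sub xS e0S)
  have eq1: "lext r (el s * e0) = lext r (el s * (x * e0))"
  proof -
    have "lext r (el s * e0) = lext r (el s * (el (c h) * el (- h) * e0))" if h: "h \<in> Sym A" for h
    proof -
      have "lext r (el s * e0) = lext r (el h * (el s * e0) * el (- h))"
        by (rule tpos_conj [OF sub rt inS [OF h], symmetric]) (intro alg_mult sub e0S, use s in simp)
      also have "el h * (el s * e0) * el (- h) = el h * el s * (el (- h) * e0)"
        using e0c [of "- h"] h by (simp add: mult.assoc)
      also have "el h * el s = el s * el (c h)"
        by (simp add: c_def add.assoc flip: el_add)
      finally show ?thesis by (simp add: mult.assoc)
    qed
    then have "lext r (el s * e0) = avg (Sym A) (\<lambda>h. lext r (el s * (el (c h) * el (- h) * e0)))"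
      by (intro avg_const_on [OF A.sub, symmetric]) simp
    then show ?thesis by (simp add: x_def avg_lext flip: avg_mult_left avg_mult_right)
  qed
  \<comment> \<open>The inner product of the terms for \<open>h\<close> and \<open>k\<close> in the
    average \<open>x\<close> depends only on \<open>- k + h\<close>.\<close>
  define f where "f q = lext r (el (c (- q)) * el q * e0)" for q
  have F: "lext r (e0 * (el h * el (- c h)) * (el (c k) * el (- k) * e0)) = f (- k + h)"
    if h: "h \<in> Sym A" and k: "k \<in> Sym A" for h k
  proof -
    have hk: "- h + k \<in> Sym A" "- k + h \<in> Sym A" using h k by simp_all
    have "el h * el (- c h) * (el (c k) * el (- k)) = el h * el (c (- h + k)) * el (- k)"
      by (simp add: c_add c_neg el_add mult.assoc)
    also have "el h * el (c (- h + k)) = el (c (- h + k)) * el h"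
      using comm [OF h hk(1)] by (simp flip: el_add)
    finally have 1: "el h * el (- c h) * (el (c k) * el (- k)) = el (c (- h + k)) * el h * el (- k)" .
    have "e0 * (el h * el (- c h)) * (el (c k) * el (- k) * e0) =
        e0 * (el h * el (- c h) * (el (c k) * el (- k))) * e0"
      by (simp add: mult.assoc)
    also have "\<dots> = e0 * el (c (- h + k)) * el h * (el (- k) * e0)"
      unfolding 1 by (simp add: mult.assoc)
    also have "\<dots> = el (c (- h + k)) * (el h * (e0 * e0)) * el (- k)"
    proof -
      have "e0 * el (c (- h + k)) = el (c (- h + k)) * e0" using e0cc [OF hk(1)] by simp
      moreover have "el (- k) * e0 = e0 * el (- k)" using e0c [of "- k"] k by simp
      moreover have "e0 * el h = el h * e0" using e0c [OF h] by simp
      ultimately show ?thesis by (simp add: mult.assoc)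
    qed
    also have "\<dots> = el (c (- h + k)) * el h * e0 * el (- k)" by (simp add: e0 mult.assoc)
    finally have 2: "e0 * (el h * el (- c h)) * (el (c k) * el (- k) * e0) =
        el (c (- h + k)) * el h * e0 * el (- k)" .
    have "lext r (el (c (- h + k)) * el h * e0 * el (- k)) =
        lext r (el (- k) * (el (c (- h + k)) * el h * e0 * el (- k)) * el (- (- k)))"
      by (rule tpos_conj [OF sub rt, symmetric])
         (use h k inS cS [OF hk(1)] e0S in \<open>auto intro!: alg_mult sub\<close>)
    also have "el (- k) * (el (c (- h + k)) * el h * e0 * el (- k)) * el (- (- k)) =
        el (- k) * el (c (- h + k)) * el h * e0" by (simp add: mult.assoc)
    also have "el (- k) * el (c (- h + k)) = el (c (- h + k)) * el (- k)"
      using comm [of "- k" "- h + k"] h k by (simp flip: el_add)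
    finally show ?thesis
      unfolding f_def 2 by (simp add: minus_add el_add mult.assoc)
  qed
  have "lext r (star (x * e0) * (x * e0)) = avg (Sym A) (\<lambda>h. avg (Sym A) (\<lambda>k. f (- k + h)))"
  proof -
    have "star (x * e0) = avg (Sym A) (\<lambda>h. e0 * (el h * el (- c h)))"
      unfolding star_mult e0 x_def avg_star avg_mult_left by (simp add: star_mult)
    then have "star (x * e0) * (x * e0) = avg (Sym A) (\<lambda>h. avg (Sym A) (\<lambda>k.
        e0 * (el h * el (- c h)) * (el (c k) * el (- k) * e0)))"
      unfolding x_def avg_mult_left avg_mult_right by simp
    then show ?thesis by (simp add: avg_lext F cong: avg_cong)
  qed
  also have "\<dots> = avg (Sym A) f"
  proof (rule avg_const_on [OF A.sub])
    fix h assume h: "h \<in> Sym A"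
    have "avg (Sym A) (\<lambda>k. f (- k + h)) = avg (Sym A) (\<lambda>k. f (k + h))"
      using avg_uminus [OF A.sub, of "\<lambda>k. f (k + h)"] by simp
    then show "avg (Sym A) (\<lambda>k. f (- k + h)) = avg (Sym A) f"
      using avg_shift_right [OF A.sub h] by simp
  qed
  finally have nrm: "lext r (star (x * e0) * (x * e0)) = avg (Sym A) f" .
  define z where "z q = csum (Sym A) q" for q
  \<comment> \<open>Conjugation by \<open>Sym A\<close> leaves \<open>c (- q)\<close> and
    \<open>e0\<close> unchanged, so \<open>q\<close> can be averaged over its class.\<close>
  have fz: "f q = lext r (el (c (- q)) * (z q * e0))" if q: "q \<in> Sym A" for q
  proof -
    have "f q = lext r (el (c (- q)) * (el (m + q - m) * e0))" if m: "m \<in> Sym A" for m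
    proof -
      have "f q = lext r (el m * (el (c (- q)) * el q * e0) * el (- m))"
        unfolding f_def
        by (rule tpos_conj [OF sub rt, symmetric])
           (use m q inS cS [of "- q"] e0S in \<open>auto intro!: alg_mult sub\<close>)
      also have "el m * (el (c (- q)) * el q * e0) * el (- m) =
          (el m * el (c (- q))) * el q * (e0 * el (- m))" by (simp add: mult.assoc)
      also have "el m * el (c (- q)) = el (c (- q)) * el m"
        using comm [of m "- q"] m q by (simp flip: el_add)
      also have "e0 * el (- m) = el (- m) * e0" using e0c [of "- m"] m by simp
      finally show ?thesis by (simp add: mult.assoc flip: el_conj)
    qed
    then have "f q = avg (Sym A) (\<lambda>m. lext r (el (c (- q)) * (el (m + q - m) * e0)))"
      by (intro avg_const_on [OF A.sub, symmetric]) simp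
    then show ?thesis by (simp add: z_def csum_def avg_lext flip: avg_mult_left avg_mult_right)
  qed
  \<comment> \<open>Balances the two terms: with mean square \<open>4 / card A\<close>, both
    \<open>l\<close> and \<open>(4 / card A) / l\<close> equal
    \<open>2 / sqrt (card A)\<close>.\<close>
  define l where "l = 2 / sqrt (card A)"
  have l: "l > 0" using A by (simp add: l_def)
  have fle: "f q \<le> (l + lext r (z q * z q * e0) / l) / 2" if q: "q \<in> Sym A" for q
  proof -
    have zc: "z q \<in> cen (Sym A)" unfolding z_def by (rule csum_cen [OF A.sub q])
    have zs: "star (z q) = z q" by (rule A.star_cen [OF zc])
    have zS: "z q * e0 \<in> alg (Sym S)"
      using zc cen_alg alg_mono [OF AS] by (intro alg_mult sub e0S) blast
    define v where "v = el (- c (- q))"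
    have v: "v \<in> alg (Sym S)" "star v = el (c (- q))" "star v * v = el 0"
      using cS [of "- q"] q by (simp_all add: v_def el_0)
    have "2 * lext r (star v * (z q * e0)) \<le> l * lext r (star v * v) + lext r (star (z q * e0) * (z q * e0)) / l"
      by (rule tpos_bessel [OF sub rt v(1) zS l])
    also have "star (z q * e0) * (z q * e0) = z q * z q * e0"
    proof -
      have "e0 * z q = z q * e0" using cen_comm [OF zc e0A] by simp
      then have "star (z q * e0) * (z q * e0) = z q * e0 * (z q * e0)" by (simp add: star_mult e0 zs)
      also have "\<dots> = z q * (e0 * z q) * e0" by (simp add: mult.assoc)
      also have "\<dots> = z q * z q * (e0 * e0)" using cen_comm [OF zc e0A] by (simp add: mult.assoc)
      finally show ?thesis by (simp add: e0)
    qed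
    finally show ?thesis using fz [OF q] v r by (simp add: sph_def)
  qed
  have "avg (Sym A) f \<le> avg (Sym A) (\<lambda>q. (l + lext r (z q * z q * e0) / l) / 2)"
    by (rule avg_mono) (rule fle)
  also have "\<dots> = (l + avg (Sym A) (\<lambda>q. lext r (z q * z q * e0)) / l) / 2"
  proof -
    have "avg (Sym A) (\<lambda>q. (l + lext r (z q * z q * e0) / l) / 2) =
        avg (Sym A) (\<lambda>q. l * (1/2) + lext r (z q * z q * e0) * (1 / (2 * l)))"
      by (simp add: field_simps)
    also have "\<dots> = l * (1/2) + avg (Sym A) (\<lambda>q. lext r (z q * z q * e0)) * (1 / (2 * l))"
      using avg_const_on [OF A.sub, of "\<lambda>_. l * (1/2)"] by (simp only: avg_add avg_mult_right)
    finally show ?thesis by (simp add: field_simps)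
  qed
  also have "\<dots> \<le> (l + (4 / card A) / l) / 2"
  proof -
    have "avg (Sym A) (\<lambda>q. lext r (z q * z q * e0)) \<le> 4 / card A"
      unfolding z_def e0_def
      by (rule rest_square_mean [OF fA A(2) tpos_mono [OF AS rt]]) (use r in \<open>simp add: sph_def\<close>)
    then show ?thesis using l by (intro divide_right_mono add_left_mono) auto
  qed
  also have "\<dots> = 2 / sqrt (card A)"
  proof -
    have "sqrt (card A) * sqrt (card A) = card A" by simp
    then show ?thesis using A by (simp add: l_def field_simps)
  qed
  finally have fin: "avg (Sym A) f \<le> 2 / sqrt (card A)" .
  have "(lext r (star (el (- s)) * (x * e0)))\<^sup>2 \<le>
      lext r (star (el (- s)) * el (- s)) * lext r (star (x * e0) * (x * e0))"
    by (rule tpos_CS [OF sub rt _ yS]) (use s in simp)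
  also have "\<dots> = avg (Sym A) f" using r nrm lext_el [of r 0] by (simp add: sph_def el_0)
  finally show ?thesis using eq1 fin by (simp add: e0_def)
qed

lemma inva_avg: "inva A = avg (Sym A) el"
  by (simp add: inva_def proj_def)

lemma lext_inva_pair:
  "lext r (x * (inva B * inva C)) = avg (Sym B) (\<lambda>b. avg (Sym C) (\<lambda>c. lext r (x * (el b * el c))))"
proof -
  have "inva B * inva C = avg (Sym B) (\<lambda>b. el b * inva C)"
    by (simp only: inva_avg [of B] avg_mult_right)
  also have "\<dots> = avg (Sym B) (\<lambda>b. avg (Sym C) (\<lambda>c. el b * el c))"
    by (simp only: inva_avg [of C] avg_mult_left)
  finally show ?thesis by (simp only: avg_mult_left [symmetric] avg_lext)
qed

lemma lext_inva_le_1: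
  assumes S: "finite S" and r: "sph (Sym S) (r :: 'a perm \<Rightarrow> real)" and A: "A \<subseteq> S"
  shows "lext r (inva A) \<le> 1" "0 \<le> lext r (inva A)"
proof -
  have fA: "finite A" using A S finite_subset by auto
  note f = sph_Sym_facts [OF S r]
  have "avg (Sym A) r \<le> avg (Sym A) (\<lambda>_. 1)"
  proof (rule avg_mono)
    fix g assume "g \<in> Sym A"
    then have "g \<in> Sym S" using Sym_mono [OF A] by blast
    then show "r g \<le> 1" using f(6) [of g] by simp
  qed
  also have "\<dots> = 1" by (rule avg_const_on) (use fA in auto)
  finally show "lext r (inva A) \<le> 1" by (simp add: inva_avg avg_lext)
  have "0 \<le> lext r (star (inva A) * inva A)"
    by (rule tpos_nonneg [OF f(1)]) (use inva_simps(6) [OF fA A] in simp)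
  then show "0 \<le> lext r (inva A)" using inva_simps [OF fA] by simp
qed

lemma proper_twist:
  assumes S: "finite S" and pr: "proper_sph S r"
  shows "proper_sph S (\<lambda>g. sg g * r g)"
proof -
  have ss: "sg g * sg g = 1" for g :: "'a perm" using sg_cases [of g] by auto
  have "sph (Sym S) (\<lambda>g. sg g * r g)"
    using pr ambivalent_group.sph_twist [OF ambivalent_Sym [OF S] _ lchar_sg] by (simp add: proper_sph_def)
  moreover have "\<exists>g\<in>Sym S. sg g * r g \<noteq> 1"
  proof -
    obtain g where g: "g \<in> Sym S" "r g \<noteq> sg g" using pr by (auto simp: proper_sph_def)
    have "sg g * r g \<noteq> 1" using g(2) sg_cases [of g] by auto
    then show ?thesis using g by blast
  qed
  moreover have "\<exists>g\<in>Sym S. sg g * r g \<noteq> sg g"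
  proof -
    obtain g where g: "g \<in> Sym S" "r g \<noteq> 1" using pr by (auto simp: proper_sph_def)
    have "sg g * r g \<noteq> sg g" using g(2) sg_cases [of g] by auto
    then show ?thesis using g by blast
  qed
  ultimately show ?thesis by (simp add: proper_sph_def)
qed

lemma proper_sph_lext_zero:
  assumes S: "finite S" and pr: "proper_sph S r"
  shows "lext r (inva S) = 0" "lext r (altp S) = 0"
proof -
  have r: "sph (Sym S) r" using pr by (simp add: proper_sph_def)
  interpret ambivalent_group "Sym S" using S by (rule ambivalent_Sym)
  obtain g h where "g \<in> Sym S" "r g \<noteq> 1" "h \<in> Sym S" "r h \<noteq> sg h" using pr by (auto simp: proper_sph_def)
  then show "lext r (inva S) = 0" "lext r (altp S) = 0"
    using sph_proj_eq_lchar [OF r lchar_one] sph_proj_eq_lchar [OF r lchar_sg]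
    unfolding inva_def altp_def by blast+
qed

text \<open>For the trivial character both traces are 1; for the sign the left one is 0, since a
  transposition in \<open>B\<close> acts as -1; otherwise the Gelfand bound and the degree bound
  apply. With the term \<open>inva (B \<union> C)\<close> one inequality covers all constituents and
  can be summed over them.\<close>

lemma inva_pair_le:
  assumes D: "finite B" "finite C" "B \<inter> C = {}" "2 \<le> card B" "3 \<le> card (B \<union> C)"
    and r: "sph (Sym (B \<union> C)) r"
  shows "lext r (inva B * inva C) \<le> lext r (inva (B \<union> C)) + sqrt (4 / card (B \<union> C))"
proof -
  have fD: "finite (B \<union> C)" using D by simp
  interpret ambivalent_group "Sym (B \<union> C)" using fD by (rule ambivalent_Sym)
  have alg: "inva B * inva C \<in> alg (Sym (B \<union> C))"
    by (intro alg_mult sub inva_simps(6) D) auto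
  show ?thesis
  proof (cases "proper_sph (B \<union> C) r")
    case True
    have "(lext r (inva B * inva C))\<^sup>2 \<le> 4 / card (B \<union> C)"
      using young_bound [OF D(1-3) r] msq_bound [OF fD True D(5)] by linarith
    then have "lext r (inva B * inva C) \<le> sqrt (4 / card (B \<union> C))" by (rule real_le_rsqrt)
    then show ?thesis using proper_sph_lext_zero [OF fD True] by simp
  next
    case False
    show ?thesis
    proof (cases "\<forall>g\<in>Sym (B \<union> C). r g = 1")
      case True
      have "lext r (inva (B \<union> C)) = 1"
        unfolding inva_avg avg_lext by (rule avg_const_on [OF sub]) (use True in simp)
      moreover have "lext r (inva B * inva C) = 1"
      proof -
        have "r (b + c) = 1" if "b \<in> Sym B" "c \<in> Sym C" for b c
        proof -
          have "b + c \<in> Sym (B \<union> C)"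
            by (intro Sym_closed(2) subsetD [OF Sym_mono that(1)] subsetD [OF Sym_mono that(2)]) auto
          then show ?thesis using True by simp
        qed
        then have "avg (Sym B) (\<lambda>b. avg (Sym C) (\<lambda>c. r (b + c))) = 1"
          by (intro avg_const_on subgrp_Sym D)
        then show ?thesis
          using lext_inva_pair [of r 1 B C] by (simp flip: el_add)
      qed
      ultimately show ?thesis by simp
    next
      case F: False
      then have sgn: "\<forall>g\<in>Sym (B \<union> C). r g = sg g" using False r by (auto simp: proper_sph_def)
      obtain a b where ab: "a \<in> B" "b \<in> B" "a \<noteq> b"
        using D(4) by (metis card_2_iff' card_le_Suc0_iff_eq D(1) not_less_eq_eq numeral_2_eq_2)
      have t: "tr a b \<in> Sym B" "tr a b \<in> Sym (B \<union> C)" "sg (tr a b) = -1" using ab by (simp_all add: sg_tr)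
      have "lext r (el (tr a b) * x) = - lext r x" if "x \<in> alg (Sym (B \<union> C))" for x
      proof (rule alg_linear_eq [where x = x and G = "Sym (B \<union> C)"])
        fix g assume g: "g \<in> Sym (B \<union> C)"
        have "r (tr a b + g) = sg (tr a b + g)" using sgn g t(2) by simp
        then show "lext r (el (tr a b) * el g) = - lext r (el g)"
          using sgn g t by (simp add: sg_add flip: el_add)
      qed (use that in \<open>auto intro!: lin_intros linear_lext linear_compose_neg\<close>)
      from this [OF alg] have "lext r (inva B * inva C) = - lext r (inva B * inva C)"
        using inva_simps(3) [OF D(1) t(1)] by (simp flip: mult.assoc)
      then have "lext r (inva B * inva C) = 0" by simp
      then show ?thesis using lext_inva_le_1(2) [OF fD r subset_refl] by simp
    qed
  qed
qed

text \<open>Young subgroups with three blocks need not give Gelfand pairs, so two blocks are used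
  twice: for the constituents on \<open>B \<union> C\<close> of the \<open>Sym A\<close> invariants,
  and then for \<open>A\<close> against \<open>B \<union> C\<close>.\<close>

lemma inva_triple_bound:
  assumes S: "finite (A \<union> (B \<union> C))" and dis: "A \<inter> (B \<union> C) = {}" "B \<inter> C = {}"
    and card: "2 \<le> card B" "3 \<le> card (B \<union> C)"
    and pr: "proper_sph (A \<union> (B \<union> C)) r"
  shows "lext r (inva A * (inva B * inva C)) \<le>
    sqrt (4 / card (A \<union> (B \<union> C))) + sqrt (4 / card (B \<union> C))"
proof -
  define D where "D = B \<union> C"
  define T where "T = A \<union> D"
  have fT: "finite T" using S by (simp add: T_def D_def)
  have fin: "finite A" "finite B" "finite C" "finite D" using S by (auto simp: D_def)
  have pr: "proper_sph T r" using pr by (simp add: T_def D_def)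
  have r: "sph (Sym T) r" using pr by (simp add: proper_sph_def)
  interpret ambivalent_group "Sym T" using fT by (rule ambivalent_Sym)
  interpret D: ambivalent_group "Sym D" using fin(4) by (rule ambivalent_Sym)
  note rt = sph_tpos [OF r]
  have DT: "Sym D \<subseteq> Sym T" by (rule Sym_mono) (simp add: T_def)
  have PA: "inva A \<in> alg (Sym T)" by (rule inva_simps(6) [OF fin(1)]) (simp add: T_def)
  have comm: "inva A * x = x * inva A" if "x \<in> alg (Sym D)" for x
    using inva_simps(6) [OF fin(1) subset_refl] that dis(1)
    by (intro alg_Sym_disjoint_commute) (auto simp: D_def)
  have toT: "x \<in> alg (Sym T)" if "x \<in> alg (Sym D)" for x using alg_mono [OF DT that] .
  \<comment> \<open>The trace on the \<open>Sym A\<close> invariants as a functional on the group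
    algebra of \<open>Sym D\<close>. It is not normalized: its total weight
    \<open>lext r (inva A)\<close> is at most 1.\<close>
  define \<psi> where "\<psi> g = lext r (inva A * el g)" for g
  have psi: "lext \<psi> x = lext r (inva A * x)" for x
    by (rule alg_linear_eq [where x = x and G = UNIV])
       (auto intro!: lin_intros linear_lext in_alg_UNIV simp: \<psi>_def)
  have tp: "tpos (Sym D) \<psi>"
    unfolding tpos_def
  proof (intro conjI ballI)
    fix g h assume gh: "g \<in> Sym D" "h \<in> Sym D"
    have "lext r ((inva A * el g) * el h) = lext r (el h * (inva A * el g))"
      using gh DT PA by (intro tpos_comm [OF rt] alg_mult sub) auto
    also have "el h * (inva A * el g) = inva A * (el h * el g)"
      using comm [of "el h"] gh by (simp flip: mult.assoc)
    finally show "\<psi> (g + h) = \<psi> (h + g)" by (simp add: \<psi>_def el_add mult.assoc)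
  next
    fix g assume g: "g \<in> Sym D"
    have "lext r (star (inva A * el g)) = lext r (inva A * el g)"
      using g DT PA by (intro tpos_star [OF rt] alg_mult sub) auto
    then show "\<psi> (- g) = \<psi> g"
      using comm [of "el (- g)"] g by (simp add: \<psi>_def star_mult inva_simps(2) [OF fin(1)])
  next
    fix x assume x: "x \<in> alg (Sym D)"
    have "star x * x \<in> alg (Sym D)" by (intro alg_mult alg_star D.sub x)
    have "star (x * inva A) * (x * inva A) = inva A * (star x * x) * inva A"
      by (simp add: star_mult inva_simps(2) [OF fin(1)] mult.assoc)
    also have "\<dots> = inva A * ((star x * x) * inva A)" by (simp only: mult.assoc)
    also have "(star x * x) * inva A = inva A * (star x * x)"
      by (rule comm [OF \<open>star x * x \<in> alg (Sym D)\<close>, symmetric])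
    also have "inva A * (inva A * (star x * x)) = inva A * inva A * (star x * x)"
      by (simp only: mult.assoc)
    also have "\<dots> = inva A * (star x * x)" by (simp only: inva_simps(1) [OF fin(1)])
    finally have "lext \<psi> (star x * x) = lext r (star (x * inva A) * (x * inva A))" by (simp add: psi)
    also have "\<dots> \<ge> 0" by (intro tpos_nonneg [OF rt] alg_mult sub toT x PA)
    finally show "0 \<le> lext \<psi> (star x * x)" .
  qed
  obtain n :: nat and w s where w: "\<And>i. i < n \<Longrightarrow> 0 \<le> w i" and s: "\<And>i. i < n \<Longrightarrow> sph (Sym D) (s i)"
    and dec: "\<And>x. x \<in> alg (Sym D) \<Longrightarrow> lext \<psi> x = (\<Sum>i<n. w i * lext (s i) x :: real)"
    using D.tpos_decomposition [OF tp] by blast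
  have BC: "inva B * inva C \<in> alg (Sym D)"
    by (intro alg_mult D.sub inva_simps(6) fin) (auto simp: D_def)
  have PD: "inva D \<in> alg (Sym D)" by (intro inva_simps(6) fin subset_refl)
  have sumw: "(\<Sum>i<n. w i) \<le> 1" "0 \<le> (\<Sum>i<n. w i)"
  proof -
    have "lext \<psi> (el 0) = (\<Sum>i<n. w i * lext (s i) (el 0))" by (rule dec) simp
    also have "\<dots> = (\<Sum>i<n. w i)" using s by (intro sum.cong) (auto simp: sph_def)
    finally have "\<psi> 0 = (\<Sum>i<n. w i)" by (simp only: lext_el)
    then have "(\<Sum>i<n. w i) = lext r (inva A)" by (simp add: \<psi>_def el_0)
    then show "(\<Sum>i<n. w i) \<le> 1" using lext_inva_le_1(1) [OF fT r, of A] by (simp add: T_def)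
    show "0 \<le> (\<Sum>i<n. w i)" by (rule sum_nonneg) (use w in auto)
  qed
  have "lext r (inva A * (inva B * inva C)) = (\<Sum>i<n. w i * lext (s i) (inva B * inva C))"
    using dec [OF BC] by (simp add: psi)
  also have "\<dots> \<le> (\<Sum>i<n. w i * (lext (s i) (inva D) + sqrt (4 / card D)))"
  proof (intro sum_mono mult_left_mono)
    fix i assume "i \<in> {..<n}"
    then have i: "i < n" by simp
    show "0 \<le> w i" using w i .
    show "lext (s i) (inva B * inva C) \<le> lext (s i) (inva D) + sqrt (4 / card D)"
      using inva_pair_le [OF fin(2,3) dis(2) card(1)] card(2) s [OF i] unfolding D_def by blast
  qed
  also have "\<dots> = (\<Sum>i<n. w i * lext (s i) (inva D)) + (\<Sum>i<n. w i) * sqrt (4 / card D)"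
    by (simp only: distrib_left sum.distrib sum_distrib_right)
  also have "(\<Sum>i<n. w i * lext (s i) (inva D)) = lext r (inva A * inva D)"
    using dec [OF PD] by (simp add: psi)
  also have "lext r (inva A * inva D) \<le> sqrt (4 / card T)"
  proof (rule real_le_rsqrt)
    have dAD: "A \<inter> D = {}" using dis by (simp add: D_def)
    have "card D \<le> card T" using fT by (intro card_mono) (auto simp: T_def)
    then have "3 \<le> card T" using card(2) by (simp add: D_def)
    then show "(lext r (inva A * inva D))\<^sup>2 \<le> 4 / card T"
      using young_bound [OF fin(1,4) dAD] r msq_bound [OF fT pr] unfolding T_def by fastforce
  qed
  also have "(\<Sum>i<n. w i) * sqrt (4 / card D) \<le> 1 * sqrt (4 / card D)"
    using sumw by (intro mult_right_mono) auto
  finally show ?thesis by (simp add: T_def D_def)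
qed

text \<open>Invariance propagates along \<open>s\<close>: conjugation by \<open>s\<close> takes
  \<open>Sym A\<close> to \<open>Sym B\<close> and \<open>Sym C\<close> into \<open>Sym A\<close>,
  so the trace absorbs the projections for \<open>B\<close> and \<open>C\<close> as well. The three
  projections commute, and \<open>tpos_bound_el\<close> applies to their product.\<close>

lemma fpf_inva_le:
  assumes S: "finite (A \<union> (B \<union> C))" and dis: "A \<inter> (B \<union> C) = {}" "B \<inter> C = {}"
    and r: "sph (Sym (A \<union> (B \<union> C))) (r :: 'a perm \<Rightarrow> real)" and s: "s \<in> Sym (A \<union> (B \<union> C))"
    and AB: "(\<langle>$\<rangle>) s ` A = B" and CA: "(\<langle>$\<rangle>) s ` C \<subseteq> A"
  shows "\<bar>lext r (el s * inva A)\<bar> \<le> lext r (inva A * (inva B * inva C))"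
proof -
  define T where "T = A \<union> (B \<union> C)"
  have fT: "finite T" using S by (simp add: T_def)
  have fin: "finite A" "finite B" "finite C" using S by auto
  have r: "sph (Sym T) r" and sT: "s \<in> Sym T" using r s by (simp_all add: T_def)
  interpret ambivalent_group "Sym T" using fT by (rule ambivalent_Sym)
  note rt = sph_tpos [OF r]
  have sub3: "A \<subseteq> T" "B \<subseteq> T" "C \<subseteq> T" by (auto simp: T_def)
  note PA = inva_simps(6) [OF fin(1) sub3(1)] and PB = inva_simps(6) [OF fin(2) sub3(2)]
    and PC = inva_simps(6) [OF fin(3) sub3(3)]
  have comm: "inva X * inva Y = inva Y * inva X" if "finite X" "finite Y" "X \<inter> Y = {}" for X Y :: "'a set"
    using that inva_simps(6) [OF _ subset_refl] by (intro alg_Sym_disjoint_commute) auto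
  have AB0: "A \<inter> B = {}" "A \<inter> C = {}" using dis by auto
  note c1 = comm [OF fin(1,2) AB0(1)] and c2 = comm [OF fin(1,3) AB0(2)] and c3 = comm [OF fin(2,3) dis(2)]
  have inv: "lext r (el s * inva A * (el b * el c)) = lext r (el s * inva A)"
    if b: "b \<in> Sym B" and c: "c \<in> Sym C" for b c
  proof -
    have bT: "b \<in> Sym T" "c \<in> Sym T" using b c Sym_mono sub3 by blast+
    define b1 where "b1 = - s + b + s"
    define c1 where "c1 = s + c - s"
    have b1: "b1 \<in> Sym A"
      unfolding Sym_iff
    proof (intro allI impI)
      fix x assume "x \<notin> A"
      then have "s \<langle>$\<rangle> x \<notin> B" unfolding AB [symmetric] by auto
      then show "b1 \<langle>$\<rangle> x = x" using Sym_out [OF b] by (simp add: b1_def)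
    qed
    have c1A: "c1 \<in> Sym A"
      unfolding Sym_iff
    proof (intro allI impI)
      fix x assume "x \<notin> A"
      then have "(- s) \<langle>$\<rangle> x \<notin> C" using CA by (metis ap_cancel(2) image_subset_iff)
      then show "c1 \<langle>$\<rangle> x = x" using Sym_out [OF c] by (simp add: c1_def)
    qed
    have c1T: "c1 \<in> Sym T" using c1A Sym_mono sub3 by blast
    have bc: "el b * el c = el c * el b"
      using Sym_disjoint_commute [OF b c dis(2)] by (simp flip: el_add)
    have "lext r (el s * inva A * (el b * el c)) = lext r (el b * el c * (el s * inva A))"
      using bT sT PA by (intro tpos_comm [OF rt] alg_mult sub) auto
    also have "el b * el c * (el s * inva A) = el c * (el b * el s) * inva A"
      by (simp add: bc mult.assoc)
    also have "el b * el s = el s * el b1"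
      by (simp add: b1_def add.assoc flip: el_add)
    also have "el c * (el s * el b1) * inva A = el c * (el s * inva A)"
      using inva_simps(3) [OF fin(1) b1] by (simp add: mult.assoc)
    also have "lext r (el c * (el s * inva A)) = lext r (el s * inva A * el c)"
      using bT sT PA by (intro tpos_comm [OF rt] alg_mult sub) auto
    also have "el s * inva A * el c = el s * el c * inva A"
    proof -
      have "inva A * el c = el c * inva A"
        using c AB0 inva_simps(6) [OF fin(1) subset_refl]
        by (intro alg_Sym_disjoint_commute [of _ A _ C]) auto
      then show ?thesis by (simp add: mult.assoc)
    qed
    also have "el s * el c = el c1 * el s"
      by (simp add: c1_def flip: el_add)
    also have "lext r (el c1 * el s * inva A) = lext r (el s * inva A * el c1)"
      unfolding mult.assoc using c1T sT PA by (subst tpos_comm [OF rt]) (auto intro!: alg_mult sub simp: mult.assoc)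
    also have "el s * inva A * el c1 = el s * inva A"
      using inva_simps(4) [OF fin(1) c1A] by (simp add: mult.assoc)
    finally show ?thesis .
  qed
  have "lext r (el s * inva A * (inva B * inva C)) = avg (Sym B) (\<lambda>b. avg (Sym C) (\<lambda>c. lext r (el s * inva A * (el b * el c))))"
    by (rule lext_inva_pair)
  also have "\<dots> = lext r (el s * inva A)"
    by (intro avg_const_on subgrp_Sym fin inv)
  finally have eq: "lext r (el s * (inva A * (inva B * inva C))) = lext r (el s * inva A)"
    by (simp add: mult.assoc)
  define e where "e = inva A * (inva B * inva C)"
  note iA = inva_simps [OF fin(1)] and iB = inva_simps [OF fin(2)] and iC = inva_simps [OF fin(3)]
  have A2: "inva A * (inva A * x) = inva A * x" and B2: "inva B * (inva B * x) = inva B * x" for x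
    by (simp_all add: iA iB flip: mult.assoc)
  have ba: "inva B * (inva A * x) = inva A * (inva B * x)" and ca: "inva C * (inva A * x) = inva A * (inva C * x)"
    and cb: "inva C * (inva B * x) = inva B * (inva C * x)" for x
    using c1 c2 c3 by (simp_all flip: mult.assoc)
  have "e * e = e" by (simp add: e_def mult.assoc ba ca cb A2 B2 iC)
  moreover have "star e = e"
    by (simp add: e_def star_mult iA iB iC mult.assoc ba ca cb c1 c2 c3)
       (simp add: c1 [symmetric] c2 [symmetric] c3 [symmetric] ba ca cb)?
  moreover have "e \<in> alg (Sym T)" unfolding e_def by (intro alg_mult sub PA PB PC)
  ultimately have "\<bar>lext r (el s * e)\<bar> \<le> lext r e"
    using tpos_bound_el [OF sub rt sT] by blast
  then show ?thesis using eq by (simp add: e_def)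
qed

text \<open>The first summand is \<open>rest_bound\<close> with at least \<open>n / 3\<close> points
  in \<open>A\<close>. The second covers the trivial and the sign part, each bounded by
  \<open>inva_triple_bound\<close> with at least \<open>n / 2\<close> points in
  \<open>B \<union> C\<close>, hence \<open>8 / n\<close>.\<close>

definition fpf_eps :: "nat \<Rightarrow> real" where
  "fpf_eps n = sqrt (2 / sqrt (n / 3)) + 2 * (sqrt (4 / n) + sqrt (8 / n))"

lemma fpf_bound:
  assumes S: "finite S" and pr: "proper_sph S r" and s: "s \<in> Sym S" "\<And>x. x \<in> S \<Longrightarrow> s \<langle>$\<rangle> x \<noteq> x"
    and n: "9 \<le> card S"
  shows "\<bar>r s\<bar> \<le> fpf_eps (card S)"
proof -
  \<comment> \<open>A largest set that \<open>s\<close> moves off itself is taken. If some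
    \<open>x\<close> in the remainder \<open>C\<close> did not go into \<open>A\<close>, then
    \<open>insert x A\<close> would still qualify, as \<open>s\<close> does not fix
    \<open>x\<close>. So \<open>B\<close> and \<open>C\<close> are no larger than \<open>A\<close>,
    which therefore has a third of the points.\<close>
  define F where "F = {A. A \<subseteq> S \<and> (\<langle>$\<rangle>) s ` A \<inter> A = {}}"
  have finF: "finite F" unfolding F_def using S by simp
  have "{} \<in> F" by (simp add: F_def)
  then have "Max (card ` F) \<in> card ` F" using finF by (intro Max_in) auto
  then obtain A where A: "A \<in> F" "card A = Max (card ` F)" by auto
  have Amax: "card X \<le> card A" if "X \<in> F" for X using A(2) finF that by simp
  have AS: "A \<subseteq> S" "(\<langle>$\<rangle>) s ` A \<inter> A = {}" using A by (auto simp: F_def)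
  define B where "B = (\<langle>$\<rangle>) s ` A"
  define C where "C = S - A - B"
  have BS: "B \<subseteq> S" using AS s(1) by (auto simp: B_def)
  have SABC: "A \<union> (B \<union> C) = S" using AS BS by (auto simp: C_def)
  have fin: "finite A" "finite B" "finite C" using AS BS S finite_subset by (auto simp: C_def)
  have dis: "A \<inter> (B \<union> C) = {}" "B \<inter> C = {}" using AS by (auto simp: B_def C_def)
  have CA: "(\<langle>$\<rangle>) s ` C \<subseteq> A"
  proof safe
    fix x assume x: "x \<in> C"
    show "s \<langle>$\<rangle> x \<in> A"
    proof (rule ccontr)
      assume ns: "s \<langle>$\<rangle> x \<notin> A"
      have xx: "x \<in> S" "x \<notin> A" "x \<notin> B" using x by (auto simp: C_def)
      have "insert x A \<in> F"
        unfolding F_def using AS xx s(2) [OF xx(1)] ns by (auto simp: B_def)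
      then have "card (insert x A) \<le> card A" by (rule Amax)
      then show False using fin xx by simp
    qed
  qed
  have inj: "inj_on ((\<langle>$\<rangle>) s) Z" for Z by (simp add: inj_on_def)
  have cB: "card B = card A" unfolding B_def by (rule card_image [OF inj])
  have cC: "card C \<le> card A" using CA fin by (intro card_inj_on_le [OF inj CA])
  have cS: "card S = card A + card (B \<union> C)" "card (B \<union> C) = card B + card C"
    using fin dis by (simp_all flip: SABC add: card_Un_disjoint)
  have cA3: "card S \<le> 3 * card A" using cS cB cC by simp
  \<comment> \<open>The reason for requiring nine points: the degree bound on \<open>Sym A\<close>
    needs three.\<close>
  then have A3: "3 \<le> card A" using n by simp
  have D2: "card S \<le> 2 * card (B \<union> C)" using cS cB by simp
  have r: "sph (Sym S) r" using pr by (simp add: proper_sph_def)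
  define b where "b = sqrt (4 / card S) + sqrt (8 / card S)"
  have main: "\<bar>lext q (el s * inva A)\<bar> \<le> b" if q: "proper_sph S q" for q
  proof -
    have 1: "sph (Sym (A \<union> (B \<union> C))) q" "finite (A \<union> (B \<union> C))" "s \<in> Sym (A \<union> (B \<union> C))"
      using q S s(1) by (simp_all add: SABC proper_sph_def)
    have "\<bar>lext q (el s * inva A)\<bar> \<le> lext q (inva A * (inva B * inva C))"
      by (rule fpf_inva_le [OF 1(2) dis 1(1,3) B_def [symmetric] CA])
    also have "\<dots> \<le> sqrt (4 / card (A \<union> (B \<union> C))) + sqrt (4 / card (B \<union> C))"
      using S q A3 cB cS by (intro inva_triple_bound dis) (simp_all add: SABC)
    also have "\<dots> \<le> b"
    proof -
      have "4 / real (card (B \<union> C)) \<le> 8 / real (card S)"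
        using D2 n by (simp add: field_simps)
      then show ?thesis by (simp add: b_def SABC)
    qed
    finally show ?thesis .
  qed
  \<comment> \<open>Up to sign, the sign part of \<open>r\<close> is the trivial part of its twist
    by the sign, which is proper again.\<close>
  have "lext r (el s * altp A) = sg s * lext (\<lambda>g. sg g * r g) (el s * inva A)"
  proof -
    have ss: "sg s * sg s = 1" using sg_cases [of s] by auto
    have "lext r (el s * altp A) = avg (Sym A) (\<lambda>h. sg h * r (s + h))"
      unfolding altp_def proj_def avg_mult_left [symmetric] avg_lext
      by (simp add: lext_simps flip: el_add)
    moreover have "lext (\<lambda>g. sg g * r g) (el s * inva A) = sg s * avg (Sym A) (\<lambda>h. sg h * r (s + h))"
      unfolding inva_avg avg_mult_left [symmetric] avg_lext
      by (simp add: sg_add mult.assoc flip: el_add)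
    ultimately show ?thesis using ss by (metis mult.assoc mult_1)
  qed
  then have alt: "\<bar>lext r (el s * altp A)\<bar> \<le> b"
    using main [OF proper_twist [OF S pr]] sg_cases [of s] by (auto simp: abs_mult)
  have "(lext r (el s * rest A))\<^sup>2 \<le> 2 / sqrt (card A)"
    by (rule rest_bound [OF S r s(1) AS(1) A3 AS(2)])
  also have "\<dots> \<le> 2 / sqrt (card S / 3)"
    using cA3 n by (intro divide_left_mono) (auto simp: field_simps)
  finally have "\<bar>lext r (el s * rest A)\<bar> \<le> sqrt (2 / sqrt (card S / 3))"
    by (intro real_le_rsqrt) simp
  moreover have "r s = lext r (el s * rest A) + lext r (el s * inva A) + lext r (el s * altp A)"
    by (simp add: rest_def right_diff_distrib lext_simps)
  moreover have "\<bar>x + y + z\<bar> \<le> E + 2 * c" if "\<bar>x\<bar> \<le> E" "\<bar>y\<bar> \<le> c" "\<bar>z\<bar> \<le> c" for x y z E c :: real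
    using that by linarith
  ultimately show ?thesis using alt main [OF pr] unfolding fpf_eps_def b_def by metis
qed

lemma fpf_eps_tendsto: "fpf_eps \<longlonglongrightarrow> 0"
  unfolding fpf_eps_def [abs_def] by real_asymp

subsection \<open>Branching\<close>

text \<open>If \<open>r\<close> comes from a representation with a vector fixed by a point stabilizer, it is the
  normalized character of the standard representation.\<close>

lemma standard_character:
  assumes S: "finite S" and r: "sph (Sym S) (r :: 'a perm \<Rightarrow> real)" and y: "y \<in> S"
    and z: "lext r (inva S) = 0" and nz: "lext r (inva (S - {y})) \<noteq> 0" and g: "g \<in> Sym S"
    and n2: "2 \<le> card S"
  shows "r g = (real (card {x \<in> S. g \<langle>$\<rangle> x = x}) - 1) / (real (card S) - 1)"
proof -
  interpret ambivalent_group "Sym S" using S by (rule ambivalent_Sym)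
  note rt = sph_tpos [OF r]
  define P where "P = inva (S - {y})"
  have fS': "finite (S - {y})" using S by simp
  note iP = inva_simps [OF fS', folded P_def]
  have PS: "P \<in> alg (Sym S)" by (rule iP(6)) auto
  \<comment> \<open>The matrix coefficients of the fixed vector: by \<open>toP\<close>,
    \<open>el k * P\<close> depends only on the image of \<open>y\<close> under
    \<open>k\<close>.\<close>
  define V where "V x = lext r (el (tr y x) * P)" for x
  define p where "p = lext r P"
  have Vy: "V y = p" by (simp add: V_def p_def flip: zero_perm_def) (simp add: el_0)
  have toP: "el k * P = el (tr y (k \<langle>$\<rangle> y)) * P" if k: "k \<in> Sym S" for k
  proof -
    have "tr y (k \<langle>$\<rangle> y) + k \<in> Sym (S - {y})"
      unfolding Sym_iff
    proof (intro allI impI)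
      fix x assume "x \<notin> S - {y}"
      then show "(tr y (k \<langle>$\<rangle> y) + k) \<langle>$\<rangle> x = x"
        using Sym_out [OF k, of x] y Sym_in [OF k, of y] by (cases "x = y") (auto simp: ap_tr)
    qed
    then have "el (tr y (k \<langle>$\<rangle> y) + k) * P = P" by (rule iP(3))
    then have "el (tr y (k \<langle>$\<rangle> y)) * P = el (tr y (k \<langle>$\<rangle> y)) * el (tr y (k \<langle>$\<rangle> y) + k) * P"
      by (simp add: mult.assoc)
    then show ?thesis by (simp flip: el_add)
  qed
  have trS: "tr y x \<in> Sym S" if "x \<in> S" for x using y that by simp
  have Vk: "lext r (el k * P) = V (k \<langle>$\<rangle> y)" if "k \<in> Sym S" for k
    using toP [OF that] by (simp add: V_def)
  have Veq: "V x = V x'" if x: "x \<in> S - {y}" "x' \<in> S - {y}" for x x'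
  proof -
    define h where "h = tr x x'"
    have h: "h \<in> Sym (S - {y})" "h \<in> Sym S" using x by (auto simp: h_def)
    have "h \<langle>$\<rangle> y = y" "h \<langle>$\<rangle> x = x'" using x by (auto simp: h_def)
    then have "h + tr y x - h = tr y x'" by (simp only: conj_tr)
    then have "el (tr y x') = el h * el (tr y x) * el (- h)" by (simp only: el_conj)
    then have "el (tr y x') * P = el h * el (tr y x) * (el (- h) * P)" by (simp only: mult.assoc)
    also have "el (- h) * P = P" using iP(3) [of "- h"] h by simp
    also have "lext r (el h * el (tr y x) * P) = lext r (el (tr y x) * P * el h)"
      unfolding mult.assoc
      using h x trS PS by (subst tpos_comm [OF rt]) (auto intro!: alg_mult sub simp: mult.assoc)
    also have "el (tr y x) * P * el h = el (tr y x) * P" using iP(4) [OF h(1)] by (simp add: mult.assoc)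
    finally show ?thesis by (simp add: V_def)
  qed
  have bij: "bij_betw ((\<langle>$\<rangle>) k) S S" if "k \<in> Sym S" for k
    using Sym_permutes [OF that] by (rule permutes_imp_bij)
  \<comment> \<open>The orbit sum of the fixed vector is invariant under all of
    \<open>Sym S\<close>, so its trace vanishes by \<open>z\<close>; this forces the values
    \<open>V x\<close> to sum to 0.\<close>
  define Q where "Q = (\<Sum>x\<in>S. el (tr y x) * P)"
  have QS: "Q \<in> alg (Sym S)" unfolding Q_def by (intro alg_intros(6) alg_mult sub PS) (use trS in simp)
  have gtr: "el k * (el (tr y x) * P) = el (tr y (k \<langle>$\<rangle> x)) * P" if "k \<in> Sym S" "x \<in> S" for k x
  proof -
    have "el (k + tr y x) * P = el (tr y ((k + tr y x) \<langle>$\<rangle> y)) * P"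
      by (rule toP) (use that trS in simp)
    then show ?thesis by (simp add: el_add mult.assoc)
  qed
  have kQ: "el k * Q = Q" if k: "k \<in> Sym S" for k
  proof -
    have "el k * Q = (\<Sum>x\<in>S. el (tr y (k \<langle>$\<rangle> x)) * P)"
      unfolding Q_def sum_distrib_left by (rule sum.cong) (use gtr [OF k] in auto)
    also have "\<dots> = Q" unfolding Q_def by (rule sum.reindex_bij_betw [OF bij [OF k]])
    finally show ?thesis .
  qed
  have "inva S * Q = Q"
    unfolding inva_avg avg_mult_right [symmetric] by (rule avg_const_on [OF sub kQ])
  moreover have "lext r (inva S * Q) = 0"
  proof -
    have "lext r (inva S * Q) = lext r (Q * inva S)"
      using QS inva_simps(6) [OF S subset_refl] by (intro tpos_comm [OF rt])
    also have "\<dots> = lext r Q * lext r (inva S)"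
      by (rule sph_lext_mult [OF sub r QS inva_simps(5) [OF S]])
    finally show ?thesis using z by simp
  qed
  ultimately have "lext r Q = 0" by simp
  then have sumV: "(\<Sum>x\<in>S. V x) = 0" by (simp add: Q_def V_def lext_sum)
  have n1: "real (card S) - 1 > 0" using n2 by simp
  have Vx: "V x = - p / (real (card S) - 1)" if x: "x \<in> S - {y}" for x
  proof -
    have "(\<Sum>x\<in>S. V x) = p + (\<Sum>x'\<in>S - {y}. V x')" using S y Vy by (simp add: sum.remove)
    also have "(\<Sum>x'\<in>S - {y}. V x') = (\<Sum>x'\<in>S - {y}. V x)" using Veq [OF x] by (intro sum.cong) auto
    also have "\<dots> = (real (card S) - 1) * V x" using S y n2 by (simp add: card_Diff_singleton of_nat_diff)
    finally show ?thesis using sumV n1 by (simp add: field_simps)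
  qed
  \<comment> \<open>The conjugates of \<open>P\<close>, one for each point, add up to a central
    element. Its trace against \<open>g\<close> is both \<open>r g * lext r M\<close> and a count in
    which a fixed point of \<open>g\<close> contributes \<open>p\<close> and any other point
    \<open>- p / (card S - 1)\<close>.\<close>
  define M where "M = (\<Sum>x\<in>S. el (tr y x) * P * el (tr y x))"
  have M: "M \<in> cen (Sym S)"
    unfolding cen_def
  proof safe
    show "M \<in> alg (Sym S)" unfolding M_def by (intro alg_intros(6) alg_mult sub PS) (use trS in simp_all)
    fix k assume k: "k \<in> Sym S"
    have st: "P * el (tr y x) * el (- k) = P * el (tr y (k \<langle>$\<rangle> x))" if "x \<in> S" for x
    proof -
      have "star (el k * (el (tr y x) * P)) = star (el (tr y (k \<langle>$\<rangle> x)) * P)"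
        by (simp only: gtr [OF k that])
      then show ?thesis by (simp add: star_mult iP(2) mult.assoc)
    qed
    have "el k * M * el (- k) = (\<Sum>x\<in>S. el (tr y (k \<langle>$\<rangle> x)) * P * el (tr y (k \<langle>$\<rangle> x)))"
      unfolding M_def sum_distrib_left sum_distrib_right
    proof (rule sum.cong)
      fix x assume x: "x \<in> S"
      have "el k * (el (tr y x) * P * el (tr y x)) * el (- k) =
          el k * (el (tr y x) * (P * P)) * el (tr y x) * el (- k)"
        by (simp only: iP(1) mult.assoc)
      also have "\<dots> = (el k * (el (tr y x) * P)) * (P * el (tr y x) * el (- k))"
        by (simp only: mult.assoc)
      also have "\<dots> = el (tr y (k \<langle>$\<rangle> x)) * P * (P * el (tr y (k \<langle>$\<rangle> x)))"
        by (simp only: gtr [OF k x] st [OF x])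
      also have "\<dots> = el (tr y (k \<langle>$\<rangle> x)) * (P * P) * el (tr y (k \<langle>$\<rangle> x))" by (simp only: mult.assoc)
      finally show "el k * (el (tr y x) * P * el (tr y x)) * el (- k) =
          el (tr y (k \<langle>$\<rangle> x)) * P * el (tr y (k \<langle>$\<rangle> x))" by (simp only: iP(1))
    qed simp
    also have "\<dots> = M" unfolding M_def by (rule sum.reindex_bij_betw [OF bij [OF k]])
    finally have "el k * M * el (- k) * el k = M * el k" by simp
    then show "el k * M = M * el k" by (simp add: mult.assoc)
  qed
  have trm: "lext r (el k * (el (tr y x) * P * el (tr y x))) = V (tr y x \<langle>$\<rangle> (k \<langle>$\<rangle> x))"
    if k: "k \<in> Sym S" and x: "x \<in> S" for k x
  proof -
    have "lext r ((el k * el (tr y x) * P) * el (tr y x)) = lext r (el (tr y x) * (el k * el (tr y x) * P))"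
      using k trS [OF x] PS by (intro tpos_comm [OF rt] alg_mult sub) auto
    also have "el (tr y x) * (el k * el (tr y x) * P) = el (tr y x + k + tr y x) * P"
      by (simp add: el_add mult.assoc)
    also have "lext r \<dots> = V ((tr y x + k + tr y x) \<langle>$\<rangle> y)"
      by (rule Vk) (use k trS [OF x] in simp)
    finally show ?thesis by (simp add: mult.assoc)
  qed
  have lM: "lext r (el k * M) = (\<Sum>x\<in>S. V (tr y x \<langle>$\<rangle> (k \<langle>$\<rangle> x)))" if k: "k \<in> Sym S" for k
    unfolding M_def sum_distrib_left lext_sum by (rule sum.cong) (use trm [OF k] in auto)
  have "lext r M = (\<Sum>x\<in>S. V (tr y x \<langle>$\<rangle> (0 \<langle>$\<rangle> x)))" using lM [of 0] by (simp add: el_0)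
  then have M1: "lext r M = card S * p" by (simp add: Vy)
  have "lext r (el g * M) = r g * lext r M" using sph_lext_mult [OF sub r _ M, of "el g"] g by simp
  then have "r g * (card S * p) = (\<Sum>x\<in>S. V (tr y x \<langle>$\<rangle> (g \<langle>$\<rangle> x)))" using lM [OF g] M1 by simp
  also have "\<dots> = (\<Sum>x\<in>S. if g \<langle>$\<rangle> x = x then p else - p / (real (card S) - 1))"
  proof (rule sum.cong)
    fix x assume x: "x \<in> S"
    show "V (tr y x \<langle>$\<rangle> (g \<langle>$\<rangle> x)) = (if g \<langle>$\<rangle> x = x then p else - p / (real (card S) - 1))"
    proof (cases "g \<langle>$\<rangle> x = x")
      case False
      have "tr y x \<langle>$\<rangle> (g \<langle>$\<rangle> x) \<in> S" using g x trS by simp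
      moreover have "tr y x \<langle>$\<rangle> (g \<langle>$\<rangle> x) \<noteq> y" using False by simp
      ultimately show ?thesis using Vx False by auto
    qed (simp add: Vy)
  qed simp
  also have "\<dots> = card {x \<in> S. g \<langle>$\<rangle> x = x} * p + card {x \<in> S. g \<langle>$\<rangle> x \<noteq> x} * (- p / (real (card S) - 1))"
    using S by (simp add: sum.If_cases Int_def Collect_neg_eq [symmetric])
  also have "real (card {x \<in> S. g \<langle>$\<rangle> x \<noteq> x}) = real (card S) - card {x \<in> S. g \<langle>$\<rangle> x = x}"
  proof -
    have "S = {x \<in> S. g \<langle>$\<rangle> x = x} \<union> {x \<in> S. g \<langle>$\<rangle> x \<noteq> x}" by auto
    then have "card S = card {x \<in> S. g \<langle>$\<rangle> x = x} + card {x \<in> S. g \<langle>$\<rangle> x \<noteq> x}"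
      using S by (subst card_Un_disjoint [symmetric]) auto
    then show ?thesis by simp
  qed
  finally have eq: "r g * (card S * p) = card {x \<in> S. g \<langle>$\<rangle> x = x} * p
      + (real (card S) - card {x \<in> S. g \<langle>$\<rangle> x = x}) * (- p / (real (card S) - 1))" .
  define N where "N = real (card S) - 1"
  define f where "f = real (card {x \<in> S. g \<langle>$\<rangle> x = x})"
  have p0: "p \<noteq> 0" using nz by (simp add: p_def P_def)
  have N0: "N > 0" using n1 by (simp add: N_def)
  have "r g * ((N + 1) * p) = f * p + (N + 1 - f) * (- p / N)"
    using eq by (simp add: N_def f_def)
  then have "(r g * N) * ((N + 1) * p) = (f - 1) * ((N + 1) * p)"
    using N0 by (simp add: field_simps)
  then have "r g * N = f - 1" using p0 N0 by simp
  then show ?thesis using N0 by (simp add: N_def f_def field_simps)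
qed

lemma card_fixed:
  assumes "finite S" "g \<in> Sym S"
  shows "real (card {x \<in> S. g \<langle>$\<rangle> x = x}) = real (card S) - card (affected g)"
proof -
  have "S = {x \<in> S. g \<langle>$\<rangle> x = x} \<union> affected g" using assms(2) by (auto simp: Sym_def in_affected)
  then have "card S = card {x \<in> S. g \<langle>$\<rangle> x = x} + card (affected g)"
    using assms(1) by (subst card_Un_disjoint [symmetric]) (auto simp: in_affected)
  then show ?thesis by simp
qed

text \<open>If the trivial character occurs in the restriction, \<open>standard_character\<close>
  applies to \<open>r\<close>; if the sign occurs, it applies to the twist. Otherwise
  \<open>r s\<close> is a convex combination of values of proper characters, one of which is at
  least the mean.\<close>

lemma branching:
  assumes S: "finite S" and pr: "proper_sph S r" and y: "y \<in> S" and s: "s \<in> Sym (S - {y})" and n2: "2 \<le> card S"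
  shows "r s \<le> 1 - card (affected s) / (real (card S) - 1) \<or>
    (\<exists>r'. proper_sph (S - {y}) r' \<and> r s \<le> r' s)"
proof -
  have r: "sph (Sym S) r" using pr by (simp add: proper_sph_def)
  have fS': "finite (S - {y})" using S by simp
  have SS: "Sym (S - {y}) \<subseteq> Sym S" by (rule Sym_mono) auto
  have sS: "s \<in> Sym S" using s SS by blast
  have n1: "real (card S) - 1 > 0" using n2 by simp
  note f = sph_Sym_facts [OF S r]
  define v where "v = (real (card {x \<in> S. s \<langle>$\<rangle> x = x}) - 1) / (real (card S) - 1)"
  have v: "v = 1 - card (affected s) / (real (card S) - 1)"
    unfolding v_def card_fixed [OF S sS] using n1 by (simp add: field_simps)
  consider (inv) "lext r (inva (S - {y})) \<noteq> 0" | (alt) "lext r (altp (S - {y})) \<noteq> 0"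
    | (none) "lext r (inva (S - {y})) = 0" "lext r (altp (S - {y})) = 0" by blast
  then show ?thesis
  proof cases
    case inv
    then have "r s = v"
      unfolding v_def using standard_character [OF S r y proper_sph_lext_zero(1) [OF S pr] inv sS n2] by simp
    then show ?thesis using v by simp
  next
    case alt
    define r' where "r' g = sg g * r g" for g
    have pr': "proper_sph S r'" using proper_twist [OF S pr] by (simp add: r'_def [abs_def])
    then have r': "sph (Sym S) r'" by (simp add: proper_sph_def)
    have "lext r' (inva (S - {y})) = lext r (altp (S - {y}))"
      by (simp add: inva_def altp_def lext_proj r'_def)
    then have "r' s = v"
      unfolding v_def using standard_character [OF S r' y proper_sph_lext_zero(1) [OF S pr'] _ sS n2] alt by simp
    then have "\<bar>r s\<bar> = \<bar>v\<bar>" using sg_cases [of s] by (auto simp: r'_def abs_mult)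
    \<comment> \<open>As \<open>s\<close> fixes \<open>y\<close>, the standard value is nonnegative,
      so the sign introduced by the twist can only lower it.\<close>
    moreover have "v \<ge> 0"
    proof -
      have "y \<in> {x \<in> S. s \<langle>$\<rangle> x = x}" using y Sym_out [OF s, of y] by simp
      then have "{x \<in> S. s \<langle>$\<rangle> x = x} \<noteq> {}" by blast
      then have "0 < card {x \<in> S. s \<langle>$\<rangle> x = x}" using S by (simp add: card_gt_0_iff)
      then show ?thesis unfolding v_def using n1 by simp
    qed
    ultimately have "r s \<le> v" by linarith
    then show ?thesis using v by simp
  next
    case none
    interpret S': ambivalent_group "Sym (S - {y})" using fS' by (rule ambivalent_Sym)
    obtain n :: nat and w q where w: "\<And>i. i < n \<Longrightarrow> 0 \<le> w i" and q: "\<And>i. i < n \<Longrightarrow> sph (Sym (S - {y})) (q i)"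
      and dec: "\<And>x. x \<in> alg (Sym (S - {y})) \<Longrightarrow> lext r x = (\<Sum>i<n. w i * lext (q i) x :: real)"
      using S'.tpos_decomposition [OF tpos_mono [OF SS f(1)]] by blast
    have sumw: "(\<Sum>i<n. w i) = 1"
    proof -
      have "lext r (el 0) = (\<Sum>i<n. w i * lext (q i) (el 0))" by (rule dec) simp
      also have "\<dots> = (\<Sum>i<n. w i)" using q by (intro sum.cong) (auto simp: sph_def)
      finally show ?thesis using f(2) by simp
    qed
    \<comment> \<open>For a projection all terms of the decomposition are nonnegative, so a
      vanishing total makes each of them vanish.\<close>
    have zero: "w i * lext (q i) e = 0" if e: "e \<in> alg (Sym (S - {y}))" "e * e = e" "star e = e" "lext r e = 0"
      and i: "i < n" for i e
    proof -
      have nn: "0 \<le> w j * lext (q j) e" if "j < n" for j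
        using w [OF that] tpos_nonneg [OF S'.sph_tpos [OF q [OF that]] e(1)] e by simp
      have "(\<Sum>j<n. w j * lext (q j) e) = 0" using dec [OF e(1)] e by simp
      then have "\<forall>j\<in>{..<n}. w j * lext (q j) e = 0"
        using nn by (subst (asm) sum_nonneg_eq_0_iff) auto
      then show ?thesis using i by simp
    qed
    have pp: "proper_sph (S - {y}) (q i)" if i: "i < n" "w i > 0" for i
    proof -
      have "lext (q i) (inva (S - {y})) = 0"
        using zero [OF inva_simps(6,1,2) [OF fS'] none(1) i(1)] i(2) by simp
      moreover have "lext (q i) (altp (S - {y})) = 0"
        using zero [OF cen_alg [OF altp_simps(3)] altp_simps(1,2) none(2) i(1)] fS' i(2) by simp
      moreover have "lext (q i) (inva (S - {y})) = 1" if "\<forall>g\<in>Sym (S - {y}). q i g = 1"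
        unfolding inva_avg avg_lext by (rule avg_const_on [OF S'.sub]) (use that in simp)
      moreover have "lext (q i) (altp (S - {y})) = 1" if "\<forall>g\<in>Sym (S - {y}). q i g = sg g"
        unfolding altp_def lext_proj
        by (rule avg_const_on [OF S'.sub]) (use that lcharD(2) [OF lchar_sg S'.sub] in simp)
      ultimately show ?thesis using q [OF i(1)] by (auto simp: proper_sph_def)
    qed
    have "\<exists>i<n. w i > 0 \<and> r s \<le> q i s"
    proof (rule ccontr)
      assume no: "\<not> (\<exists>i<n. w i > 0 \<and> r s \<le> q i s)"
      have lt: "q i s < r s" if "i < n" "w i > 0" for i using no that by (meson not_le)
      have le: "w i * q i s \<le> w i * r s" if "i < n" for i
      proof (cases "w i = 0")
        case False
        then have "q i s < r s" using lt [OF that] w [OF that] by simp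
        then show ?thesis using w [OF that] by (intro mult_left_mono) auto
      qed simp
      obtain k where k: "k < n" "w k > 0"
      proof -
        have "\<exists>k<n. w k \<noteq> 0" using sumw sum.neutral [of "{..<n}" w] by fastforce
        then show thesis using that w by fastforce
      qed
      have "(\<Sum>i<n. w i * q i s) < (\<Sum>i<n. w i * r s)"
      proof (rule sum_strict_mono_ex1)
        show "\<exists>i\<in>{..<n}. w i * q i s < w i * r s"
          by (rule bexI [of _ k]) (use k lt [OF k] in auto)
      qed (use le in auto)
      also have "\<dots> = r s" using sumw by (simp flip: sum_distrib_right)
      also have "\<dots> = (\<Sum>i<n. w i * q i s)" using dec [of "el s"] s by simp
      finally show False by simp
    qed
    then show ?thesis using pp by blast
  qed
qed

text \<open>The exceptional value in \<open>branching\<close> increases with the number of points,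
  so a descent that stops early is still covered by the value for the original set.\<close>

lemma branch_down:
  assumes "finite S" "T \<subseteq> S" "s \<in> Sym T" "2 \<le> card T" "proper_sph S r"
    and "\<And>r'. proper_sph T r' \<Longrightarrow> r' s \<le> c"
  shows "r s \<le> max c (1 - card (affected s) / (real (card S) - 1))"
  using assms
proof (induction "card (S - T)" arbitrary: S r)
  case 0
  then have "S = T" by auto
  then show ?case using 0 by fastforce
next
  case (Suc k)
  then obtain y where y: "y \<in> S" "y \<notin> T" by (metis DiffE card.empty all_not_in_conv nat.distinct(1))
  have fT: "finite T" using Suc.prems finite_subset by auto
  have sub: "T \<subseteq> S - {y}" using Suc.prems y by auto
  have c: "card T \<le> card (S - {y})" using Suc.prems sub by (intro card_mono) auto
  have cS: "card S = Suc (card (S - {y}))" by (rule card_Suc_Diff1 [OF Suc.prems(1) y(1), symmetric])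
  have sS: "s \<in> Sym (S - {y})" using Suc.prems(3) Sym_mono [OF sub] by blast
  have mono: "1 - card (affected s) / (real (card (S - {y})) - 1) \<le> 1 - card (affected s) / (real (card S) - 1)"
    using c Suc.prems(4) cS by (intro diff_left_mono divide_left_mono) auto
  from branching [OF Suc.prems(1,5) y(1) sS] show ?case
  proof
    show "2 \<le> card S" using c cS Suc.prems(4) by simp
    assume "r s \<le> 1 - card (affected s) / (real (card S) - 1)"
    then show ?thesis by simp
  next
    assume "\<exists>r'. proper_sph (S - {y}) r' \<and> r s \<le> r' s"
    then obtain r' where r': "proper_sph (S - {y}) r'" "r s \<le> r' s" by blast
    have "S - {y} - T = (S - T) - {y}" by auto
    then have "k = card (S - {y} - T)" using Suc.hyps(2) y Suc.prems(1) by simp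
    then have "r' s \<le> max c (1 - card (affected s) / (real (card (S - {y})) - 1))"
      using Suc.prems sub r'(1) by (intro Suc.hyps(1)) auto
    then show ?thesis using r'(2) mono by linarith
  qed
qed

subsection \<open>The uniform character bound\<close>

lemma card_Sym_le: "finite S \<Longrightarrow> card (Sym S) \<le> fact (card S)"
proof -
  assume S: "finite S"
  have "card (Sym S) \<le> card {f. f permutes S}"
    by (rule card_inj_on_le [where f = "(\<langle>$\<rangle>)"])
       (use S Sym_permutes in \<open>auto simp: inj_on_def Perm.apply_inject finite_permutations\<close>)
  then show ?thesis using S by (simp add: card_permutations)
qed

text \<open>The sets it is applied to have bounded size, so a crude constant is enough. A product
  \<open>g\<close> of two transpositions yields the nonzero projection \<open>E\<close>, whose trace
  is at least \<open>msq r\<close>, and the unit alone contributes \<open>1 / card (Sym S)\<close>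
  to that mean square.\<close>

lemma small_support_bound:
  assumes S: "finite S" "5 \<le> card S" and pr: "proper_sph S r"
    and s: "s \<in> Sym S" "s \<noteq> 0" and y: "y \<in> S" "s \<langle>$\<rangle> y = y"
  shows "r s \<le> 1 - 1 / (8 * fact (card S))"
proof -
  have r: "sph (Sym S) r" using pr by (simp add: proper_sph_def)
  interpret ambivalent_group "Sym S" using S(1) by (rule ambivalent_Sym)
  note f = sph_Sym_facts [OF S(1) r]
  \<comment> \<open>Four points for \<open>g\<close> and a fifth one that \<open>g\<close> fixes, so
    that \<open>proper_sph_not_one\<close> applies to \<open>g\<close>.\<close>
  obtain A where A: "A \<subseteq> S" "card A = 5" using obtain_subset_with_card_n [OF S(2)] by metis
  have "finite A" using A(2) card.infinite by fastforce
  then obtain xs where xs: "set xs = A" "distinct xs" using finite_distinct_list by metis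
  then have "length xs = 5" using A(2) distinct_card by metis
  then obtain a b c d e where "xs = [a, b, c, d, e]"
    by (auto simp: numeral_eq_Suc length_Suc_conv)
  then have d: "a \<in> S" "b \<in> S" "c \<in> S" "d \<in> S" "e \<in> S" "distinct [a, b, c, d, e]"
    using xs A by auto
  define g where "g = tr a b + tr c d"
  have gS: "g \<in> Sym S" using d by (simp add: g_def)
  have "g \<langle>$\<rangle> a = b" "g \<langle>$\<rangle> e = e" using d(6) by (auto simp: g_def ap_tr)
  then have g0: "g \<noteq> 0" using d(6) by auto
  have rg: "r g < 1" by (rule proper_sph_not_one [OF S(1) pr gS g0 d(5) \<open>g \<langle>$\<rangle> e = e\<close>])
  have gg: "g + g = 0"
    by (rule perm_eqI) (use d(6) in \<open>auto simp: g_def ap_tr\<close>)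
  then have mg: "- g = g" by (simp add: add_eq_0_iff)
  define E where "E = (1/2) *\<^sub>R (1 - el g)"
  have ee: "el g * el g = 1" using gg by (simp add: el_0 flip: el_add)
  have "E * E = (1/4) *\<^sub>R ((1 - el g) * (1 - el g))" by (simp add: E_def)
  also have "(1 - el g) * (1 - el g) = 2 *\<^sub>R (1 - el g)" by (simp add: algebra_simps ee scaleR_2)
  finally have EE: "E * E = E" by (simp add: E_def)
  have Es: "star E = E" by (simp add: E_def star_linear mg)
  have EA: "E \<in> alg (Sym S)" unfolding E_def by (intro alg_intros(3,4) alg_1 sub) (use gS in simp)
  have lE: "lext r E = (1 - r g) / 2"
    using lext_el [of r 0] f(2) by (simp add: E_def lext_simps el_0)
  then have "msq r \<le> (1 - r g) / 2"
    using msq_le_projection [OF r EA EE Es] rg by simp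
  moreover have "1 / fact (card S) \<le> msq r"
  proof -
    have "real (card (Sym S)) \<le> fact (card S)"
      using card_Sym_le [OF S(1)] by (metis of_nat_fact of_nat_le_iff)
    then have "1 / fact (card S) \<le> 1 / real (card (Sym S))"
      using subgrp_card [OF sub] by (intro divide_left_mono) auto
    then show ?thesis using msq_pos(1) [OF r] by linarith
  qed
  moreover have "1 - r g \<le> 16 * (1 - r s)"
    unfolding g_def by (rule two_transpositions_bound [OF S(1) r s y]) (use d in auto)
  \<comment> \<open>The 8 is the 16 of \<open>two_transpositions_bound\<close> divided by the 2 in
    the trace of \<open>E\<close>.\<close>
  moreover have "u \<le> 8 * t" if "m \<le> v / 2" "u \<le> m" "v \<le> 16 * t" for u m v t :: real
    using that by linarith
  ultimately have "1 / fact (card S) \<le> 8 * (1 - r s)" by blast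
  then have "1 / (8 * fact (card S)) \<le> 1 - r s" by simp
  then show ?thesis by linarith
qed

theorem uniform_character_bound:
  fixes \<eta> :: real
  assumes eta: "\<eta> > 0"
  obtains N where "\<And>(S::'a set) r s. finite S \<Longrightarrow> N \<le> card S \<Longrightarrow> proper_sph S r \<Longrightarrow> s \<in> Sym S \<Longrightarrow>
    r s \<le> 1 - (1 - \<eta>) * (card (affected s) / (real (card S) - 1))"
proof -
  have "\<forall>\<^sub>F n in sequentially. fpf_eps n < \<eta> / 2"
    using fpf_eps_tendsto eta by (intro order_tendstoD) auto
  then obtain s1 where s1: "\<And>n. s1 \<le> n \<Longrightarrow> fpf_eps n < \<eta> / 2" by (auto simp: eventually_sequentially)
  \<comment> \<open>From \<open>s0\<close> moved points on, \<open>fpf_bound\<close> applies, which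
    takes 9 points, and its error is below \<open>\<eta> / 2\<close>.\<close>
  define s0 where "s0 = max s1 9"
  \<comment> \<open>A gap for all sets made of fewer than \<open>s0\<close> moved points and three
    fixed ones.\<close>
  define c0 :: real where "c0 = 1 / (8 * fact (s0 + 3))"
  have c0: "c0 > 0" by (simp add: c0_def)
  \<comment> \<open>\<open>N1\<close> makes the ratio \<open>x\<close> at most \<open>c0\<close>
    when fewer than \<open>s0\<close> points move; \<open>N2\<close> makes
    \<open>1 / (card S - 1)\<close> at most \<open>\<eta> / 2\<close>.\<close>
  obtain N1 :: nat where N1: "real s0 / c0 < N1" using reals_Archimedean2 by blast
  obtain N2 :: nat where N2: "2 / \<eta> < N2" using reals_Archimedean2 by blast
  define N where "N = N1 + N2 + s0 + 3"
  show thesis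
  proof (rule that [of N])
    fix S :: "'a set" and r s
    assume S: "finite S" and n: "N \<le> card S" and pr: "proper_sph S r" and s: "s \<in> Sym S"
    define x where "x = card (affected s) / (real (card S) - 1)"
    have n1: "real (card S) - 1 > 0" using n by (simp add: N_def)
    have x0: "x \<ge> 0" using n1 by (simp add: x_def)
    have xle: "1 - x \<le> 1 - (1 - \<eta>) * x" using eta x0 by (simp add: algebra_simps)
    have aS: "affected s \<subseteq> S" using s by (simp add: Sym_def)
    have r: "sph (Sym S) r" using pr by (simp add: proper_sph_def)
    have r1: "r s \<le> 1" using sph_Sym_facts(6) [OF S r s] by simp
    have "r s \<le> 1 - (1 - \<eta>) * x"
    proof (cases "s = 0")
      case True
      then have "x = 0" by (simp add: x_def zero_perm_def)
      then show ?thesis using r1 by simp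
    next
      case s_nz: False
      then have a2: "2 \<le> card (affected s)"
        using card_affected_not_one [of s] by (cases "card (affected s)" rule: nat.exhaust) (auto simp: zero_perm_def)
      show ?thesis
      proof (cases "card (affected s) < s0")
        case True
        \<comment> \<open>Three fixed points besides at least two moved ones reach the five points
          needed in \<open>small_support_bound\<close>.\<close>
        have "3 \<le> card (S - affected s)"
          using True n aS by (simp add: card_Diff_subset N_def)
        then obtain U where U: "U \<subseteq> S - affected s" "card U = 3" "finite U"
          using obtain_subset_with_card_n by metis
        define T where "T = affected s \<union> U"
        have TS: "T \<subseteq> S" "finite T" using aS U by (auto simp: T_def)
        have cT: "card T = card (affected s) + 3" unfolding T_def using U by (subst card_Un_disjoint) auto
        have sT: "s \<in> Sym T" by (simp add: Sym_def T_def)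
        obtain y where y: "y \<in> U" using U by fastforce
        have "r' s \<le> 1 - c0" if "proper_sph T r'" for r'
        proof -
          have "r' s \<le> 1 - 1 / (8 * fact (card T))"
          proof (rule small_support_bound [OF TS(2) _ that sT s_nz])
            show "5 \<le> card T" using cT a2 by simp
            show "y \<in> T" using y by (simp add: T_def)
            have "y \<notin> affected s" using y U by auto
            then show "s \<langle>$\<rangle> y = y" by (simp add: in_affected)
          qed
          moreover have "c0 \<le> 1 / (8 * fact (card T))"
          proof -
            have "fact (card T) \<le> (fact (s0 + 3) :: real)" using cT True by (intro fact_mono) simp
            then show ?thesis unfolding c0_def by (intro divide_left_mono) auto
          qed
          ultimately show ?thesis by linarith
        qed
        then have "r s \<le> max (1 - c0) (1 - x)"
          unfolding x_def by (intro branch_down [OF S TS(1) sT _ pr]) (use cT in simp)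
        moreover have "x \<le> c0"
        proof -
          have "real s0 < c0 * N1" using N1 c0 by (simp add: field_simps)
          also have "\<dots> \<le> c0 * (real (card S) - 1)" using n c0 by (intro mult_left_mono) (auto simp: N_def)
          finally have "real (card (affected s)) \<le> c0 * (real (card S) - 1)" using True by simp
          then show ?thesis unfolding x_def using n1 by (simp add: pos_divide_le_eq)
        qed
        ultimately show ?thesis using xle by linarith
      next
        case False
        have sT: "s \<in> Sym (affected s)" by (simp add: Sym_def)
        have "r' s \<le> \<eta> / 2" if "proper_sph (affected s) r'" for r'
        proof -
          have "\<bar>r' s\<bar> \<le> fpf_eps (card (affected s))"
            by (rule fpf_bound [OF finite_affected that sT]) (use False in \<open>auto simp: in_affected s0_def\<close>)
          also have "\<dots> < \<eta> / 2" using False by (intro s1) (simp add: s0_def)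
          finally show ?thesis by linarith
        qed
        then have "r s \<le> max (\<eta> / 2) (1 - x)"
          unfolding x_def by (intro branch_down [OF S aS sT a2 pr])
        \<comment> \<open>If \<open>s\<close> moves every point, \<open>x\<close> exceeds 1 by
          \<open>1 / m\<close>. One half of \<eta> pays for this excess, the other for the error of
          \<open>fpf_bound\<close>.\<close>
        moreover have "\<eta> / 2 \<le> 1 - (1 - \<eta>) * x" if "\<eta> \<le> 1"
        proof -
          define m where "m = real (card S) - 1"
          have "real (card (affected s)) \<le> m + 1" using card_mono [OF S aS] by (simp add: m_def)
          then have "x \<le> (m + 1) / m" unfolding x_def m_def [symmetric] using n1 by (intro divide_right_mono) (auto simp: m_def)
          then have "(1 - \<eta>) * x \<le> (1 - \<eta>) * ((m + 1) / m)" using that by (intro mult_left_mono) auto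
          also have "(m + 1) / m = 1 + 1 / m" using n1 by (simp add: m_def field_simps)
          also have "(1 - \<eta>) * (1 + 1 / m) = 1 - \<eta> + (1 - \<eta>) * (1 / m)" by (simp add: algebra_simps)
          also have "(1 - \<eta>) * (1 / m) \<le> 1 * (1 / m)" using n1 eta by (intro mult_right_mono) (auto simp: m_def)
          also have "1 * (1 / m) \<le> \<eta> / 2"
          proof -
            have "2 / \<eta> \<le> m" using N2 n by (simp add: N_def m_def)
            then show ?thesis using eta n1 by (simp add: m_def field_simps)
          qed
          finally show ?thesis by linarith
        qed
        moreover have "1 \<le> 1 - (1 - \<eta>) * x" if "\<eta> > 1"
          using that x0 by (simp add: mult_nonpos_nonneg)
        ultimately show ?thesis using xle r1 by linarith
      qed
    qed
    then show "r s \<le> 1 - (1 - \<eta>) * (card (affected s) / (real (card S) - 1))" by (simp add: x_def)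
  qed
qed

subsection \<open>Schur's lemma\<close>

text \<open>The size \<open>d\<close> is an argument since an empty sum still has to be a
  \<open>d\<close> by \<open>d\<close> matrix.\<close>

definition msum :: "nat \<Rightarrow> 'b set \<Rightarrow> ('b \<Rightarrow> complex mat) \<Rightarrow> complex mat" where
  "msum d G F = mat d d (\<lambda>ij. \<Sum>g\<in>G. F g $$ ij)"

lemma msum_carrier [simp]: "msum d G F \<in> carrier_mat d d"
  by (simp add: msum_def)

lemma msum_index [simp]: "i < d \<Longrightarrow> j < d \<Longrightarrow> msum d G F $$ (i, j) = (\<Sum>g\<in>G. F g $$ (i, j))"
  by (simp add: msum_def)

lemma msum_dim [simp]: "dim_row (msum d G F) = d" "dim_col (msum d G F) = d"
  by (simp_all add: msum_def)

lemma mult_index: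
  assumes "A \<in> carrier_mat d d" "B \<in> carrier_mat d d" "i < d" "j < d"
  shows "(A * B) $$ (i, j) = (\<Sum>k<d. A $$ (i, k) * B $$ (k, j))"
  using assms by (simp add: scalar_prod_def atLeast0LessThan)

lemma msum_left:
  assumes A: "A \<in> carrier_mat d d" and F: "\<And>g. g \<in> G \<Longrightarrow> F g \<in> carrier_mat d d"
  shows "A * msum d G F = msum d G (\<lambda>g. A * F g)"
proof (rule eq_matI)
  fix i j assume "i < dim_row (msum d G (\<lambda>g. A * F g))" "j < dim_col (msum d G (\<lambda>g. A * F g))"
  then have ij: "i < d" "j < d" by simp_all
  have "(A * msum d G F) $$ (i, j) = (\<Sum>k<d. \<Sum>g\<in>G. A $$ (i, k) * F g $$ (k, j))"
    by (subst mult_index [OF A msum_carrier ij]) (auto simp: ij sum_distrib_left)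
  also have "\<dots> = (\<Sum>g\<in>G. \<Sum>k<d. A $$ (i, k) * F g $$ (k, j))" by (rule sum.swap)
  also have "\<dots> = (\<Sum>g\<in>G. (A * F g) $$ (i, j))"
    by (rule sum.cong [OF refl], rule mult_index [OF A F ij, symmetric])
  finally show "(A * msum d G F) $$ (i, j) = msum d G (\<lambda>g. A * F g) $$ (i, j)" by (simp add: ij)
qed (use A in auto)

lemma msum_right:
  assumes A: "A \<in> carrier_mat d d" and F: "\<And>g. g \<in> G \<Longrightarrow> F g \<in> carrier_mat d d"
  shows "msum d G F * A = msum d G (\<lambda>g. F g * A)"
proof (rule eq_matI)
  fix i j assume "i < dim_row (msum d G (\<lambda>g. F g * A))" "j < dim_col (msum d G (\<lambda>g. F g * A))"
  then have ij: "i < d" "j < d" by simp_all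
  have "(msum d G F * A) $$ (i, j) = (\<Sum>k<d. \<Sum>g\<in>G. F g $$ (i, k) * A $$ (k, j))"
    by (subst mult_index [OF msum_carrier A ij]) (auto simp: ij sum_distrib_right)
  also have "\<dots> = (\<Sum>g\<in>G. \<Sum>k<d. F g $$ (i, k) * A $$ (k, j))" by (rule sum.swap)
  also have "\<dots> = (\<Sum>g\<in>G. (F g * A) $$ (i, j))"
    by (rule sum.cong [OF refl], rule mult_index [OF F A ij, symmetric])
  finally show "(msum d G F * A) $$ (i, j) = msum d G (\<lambda>g. F g * A) $$ (i, j)" by (simp add: ij)
qed (use A in auto)

lemma msum_cong: "(\<And>g. g \<in> G \<Longrightarrow> F g = F' g) \<Longrightarrow> msum d G F = msum d G F'"
  by (simp add: msum_def)

lemma msum_scalar: "msum d G (\<lambda>g. c g \<cdot>\<^sub>m 1\<^sub>m d) = (\<Sum>g\<in>G. c g) \<cdot>\<^sub>m 1\<^sub>m d"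
  by (rule eq_matI) (auto simp: sum_distrib_right)

lemma msum_smult:
  assumes "\<And>g. g \<in> G \<Longrightarrow> F g \<in> carrier_mat d d"
  shows "msum d G (\<lambda>g. c \<cdot>\<^sub>m F g) = c \<cdot>\<^sub>m msum d G F"
proof (rule eq_matI)
  fix i j assume "i < dim_row (c \<cdot>\<^sub>m msum d G F)" "j < dim_col (c \<cdot>\<^sub>m msum d G F)"
  then have ij: "i < d" "j < d" by simp_all
  have "(\<Sum>g\<in>G. (c \<cdot>\<^sub>m F g) $$ (i, j)) = (\<Sum>g\<in>G. c * F g $$ (i, j))"
  proof (rule sum.cong [OF refl])
    fix g assume "g \<in> G"
    then have "dim_row (F g) = d" "dim_col (F g) = d" using assms by (auto intro: carrier_matD)
    then show "(c \<cdot>\<^sub>m F g) $$ (i, j) = c * F g $$ (i, j)" using ij by simp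
  qed
  then show "msum d G (\<lambda>g. c \<cdot>\<^sub>m F g) $$ (i, j) = (c \<cdot>\<^sub>m msum d G F) $$ (i, j)"
    using ij by (simp add: sum_distrib_left)
qed auto

lemma msum_swap: "msum d G (\<lambda>g. msum d H (\<lambda>h. F g h)) = msum d H (\<lambda>h. msum d G (\<lambda>g. F g h))"
  by (rule eq_matI) (auto intro: sum.swap)

lemma msum_reindex: "bij_betw f G G \<Longrightarrow> msum d G (\<lambda>g. F (f g)) = msum d G F"
  by (rule eq_matI) (auto intro: sum.reindex_bij_betw)

lemma scalar_mat_eq: "0 < d \<Longrightarrow> c \<cdot>\<^sub>m 1\<^sub>m d = c' \<cdot>\<^sub>m 1\<^sub>m d \<longleftrightarrow> c = (c' :: complex)"
proof
  assume d: "0 < d" and "c \<cdot>\<^sub>m 1\<^sub>m d = c' \<cdot>\<^sub>m 1\<^sub>m d"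
  then have "(c \<cdot>\<^sub>m 1\<^sub>m d) $$ (0, 0) = (c' \<cdot>\<^sub>m 1\<^sub>m d) $$ (0, 0)" by simp
  then show "c = c'" using d by simp
qed simp

lemma mat_eq_on_vecs:
  assumes "A \<in> carrier_mat d d" "B \<in> carrier_mat d d"
    "\<And>v. v \<in> carrier_vec d \<Longrightarrow> A *\<^sub>v v = B *\<^sub>v (v :: complex vec)"
  shows "A = B"
proof (rule eq_matI)
  fix i j assume "i < dim_row B" "j < dim_col B"
  then have ij: "i < d" "j < d" using assms by auto
  have "(A *\<^sub>v unit_vec d j) $ i = (B *\<^sub>v unit_vec d j) $ i" using assms(3) [of "unit_vec d j"] by simp
  then show "A $$ (i, j) = B $$ (i, j)" using assms(1,2) ij by simp
qed (use assms in auto)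

lemma subspaceI_vec:
  assumes "W \<subseteq> carrier_vec d" "0\<^sub>v d \<in> W" "\<And>v w. v \<in> W \<Longrightarrow> w \<in> W \<Longrightarrow> v + w \<in> W"
    "\<And>c v. v \<in> W \<Longrightarrow> c \<cdot>\<^sub>v v \<in> W"
  shows "VectorSpace.subspace class_ring W (module_vec TYPE(complex) d)"
proof -
  interpret vectorspace "class_ring :: complex ring" "module_vec TYPE(complex) d" by (rule vec_vs)
  have "LinearCombinations.submodule class_ring W (module_vec TYPE(complex) d)"
    unfolding submodule_def submodule_axioms_def
    using assms by (auto simp: module_vec_simps intro: is_module module_axioms)
  then show ?thesis by (simp add: subspace_def vec_vs)
qed

locale irrep =
  fixes n d :: nat and \<rho> :: "(nat \<Rightarrow> nat) \<Rightarrow> complex mat"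
  assumes irr: "irreducible_rep n d \<rho>"
begin

definition R :: "nat perm \<Rightarrow> complex mat" where "R g = \<rho> ((\<langle>$\<rangle>) g)"

abbreviation G :: "nat perm set" where "G \<equiv> Sym {1..n}"

lemma d_pos: "0 < d" and rep: "is_rep n d \<rho>"
  using irr by (simp_all add: irreducible_rep_def)

lemma rep_carrier: "p permutes {1..n} \<Longrightarrow> \<rho> p \<in> carrier_mat d d"
  and rep_comp: "p permutes {1..n} \<Longrightarrow> q permutes {1..n} \<Longrightarrow> \<rho> (p \<circ> q) = \<rho> p * \<rho> q"
  and rep_unit: "p permutes {1..n} \<Longrightarrow> \<exists>B\<in>carrier_mat d d. B * \<rho> p = 1\<^sub>m d"
  using rep by (auto simp: is_rep_def hom_def units_of_def Units_def ring_mat_def sym_group_def)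

lemma rep_id: "\<rho> id = 1\<^sub>m d"
proof -
  have p: "(id :: nat \<Rightarrow> nat) permutes {1..n}" by (rule permutes_id)
  obtain B where B: "B \<in> carrier_mat d d" "B * \<rho> id = 1\<^sub>m d" using rep_unit [OF p] by blast
  note c = rep_carrier [OF p]
  have "\<rho> id = 1\<^sub>m d * \<rho> id" using c by simp
  also have "\<dots> = B * (\<rho> id * \<rho> id)" unfolding B(2) [symmetric] by (rule assoc_mult_mat [OF B(1) c c])
  also have "\<rho> id * \<rho> id = \<rho> id" using rep_comp [OF p p] by simp
  finally show ?thesis unfolding B(2) .
qed

lemma R_carrier [simp]: "g \<in> G \<Longrightarrow> R g \<in> carrier_mat d d"
  unfolding R_def by (rule rep_carrier [OF Sym_permutes])

lemma R_add: "g \<in> G \<Longrightarrow> h \<in> G \<Longrightarrow> R (g + h) = R g * R h"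
proof -
  assume gh: "g \<in> G" "h \<in> G"
  have "(\<langle>$\<rangle>) (g + h) = (\<langle>$\<rangle>) g \<circ> (\<langle>$\<rangle>) h" by (simp add: fun_eq_iff)
  then show ?thesis unfolding R_def using rep_comp [OF Sym_permutes [OF gh(1)] Sym_permutes [OF gh(2)]] by simp
qed

lemma R_0: "R 0 = 1\<^sub>m d"
proof -
  have "(\<langle>$\<rangle>) (0 :: nat perm) = id" by (simp add: fun_eq_iff)
  then show ?thesis by (simp add: R_def rep_id)
qed

lemma irreducible:
  assumes "W \<subseteq> carrier_vec d" "0\<^sub>v d \<in> W" "\<And>v w. v \<in> W \<Longrightarrow> w \<in> W \<Longrightarrow> v + w \<in> W"
    "\<And>c v. v \<in> W \<Longrightarrow> c \<cdot>\<^sub>v v \<in> W" "\<And>g v. g \<in> G \<Longrightarrow> v \<in> W \<Longrightarrow> R g *\<^sub>v v \<in> W" "v \<in> W" "v \<noteq> 0\<^sub>v d"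
  shows "W = carrier_vec d"
proof -
  have "\<rho> p *\<^sub>v w \<in> W" if p: "p \<in> carrier (sym_group n)" and w: "w \<in> W" for p w
  proof -
    have pm: "p permutes {1..n}" using p by (simp add: sym_group_def)
    obtain g where g: "g \<in> G" "\<And>x. x \<in> {1..n} \<Longrightarrow> g \<langle>$\<rangle> x = p x"
      using Sym_obtain [of "{1..n}" p] permutes_imp_bij [OF pm] by auto
    have "(\<langle>$\<rangle>) g = p"
    proof
      fix x show "g \<langle>$\<rangle> x = p x"
        using g Sym_out [OF g(1), of x] permutes_not_in [OF pm, of x] by (cases "x \<in> {1..n}") auto
    qed
    then show ?thesis using assms(5) [OF g(1) w] by (simp add: R_def)
  qed
  then have "W = {0\<^sub>v d} \<or> W = carrier_vec d"
    using irr subspaceI_vec [OF assms(1-4)] unfolding irreducible_rep_def by blast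
  then show ?thesis using assms(6,7) by blast
qed

text \<open>An eigenspace of \<open>T\<close> is an invariant subspace, hence the whole
  space.\<close>

lemma schur:
  assumes T: "T \<in> carrier_mat d d" and comm: "\<And>g. g \<in> G \<Longrightarrow> R g * T = T * R g"
  obtains c where "T = c \<cdot>\<^sub>m 1\<^sub>m d"
proof -
  obtain c where "eigenvalue T c"
    using spectrum_non_empty [OF T d_pos] by (auto simp: spectrum_def)
  then obtain v where v: "v \<in> carrier_vec d" "v \<noteq> 0\<^sub>v d" "T *\<^sub>v v = c \<cdot>\<^sub>v v"
    using T by (auto simp: eigenvalue_def eigenvector_def)
  define W where "W = {w \<in> carrier_vec d. T *\<^sub>v w = c \<cdot>\<^sub>v w}"
  have "W = carrier_vec d"
  proof (rule irreducible [of _ v])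
    show "0\<^sub>v d \<in> W" using T by (auto simp: W_def)
    show "x + y \<in> W" if "x \<in> W" "y \<in> W" for x y
      using that T by (auto simp: W_def mult_add_distrib_mat_vec [OF T] smult_add_distrib_vec)
    show "k \<cdot>\<^sub>v x \<in> W" if "x \<in> W" for k x
      using that T by (auto simp: W_def mult_mat_vec smult_smult_assoc mult.commute)
    show "R g *\<^sub>v x \<in> W" if g: "g \<in> G" and x: "x \<in> W" for g x
    proof -
      have xc: "x \<in> carrier_vec d" "T *\<^sub>v x = c \<cdot>\<^sub>v x" using x by (auto simp: W_def)
      have "T *\<^sub>v (R g *\<^sub>v x) = (T * R g) *\<^sub>v x"
        by (rule assoc_mult_mat_vec [OF T R_carrier [OF g] xc(1), symmetric])
      also have "\<dots> = R g *\<^sub>v (T *\<^sub>v x)"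
        unfolding comm [OF g, symmetric] by (rule assoc_mult_mat_vec [OF R_carrier [OF g] T xc(1)])
      also have "\<dots> = c \<cdot>\<^sub>v (R g *\<^sub>v x)" unfolding xc(2) by (rule mult_mat_vec [OF R_carrier [OF g] xc(1)])
      finally show ?thesis using xc R_carrier [OF g] by (auto simp: W_def)
    qed
    show "W \<subseteq> carrier_vec d" "v \<in> W" "v \<noteq> 0\<^sub>v d" using v by (auto simp: W_def)
  qed
  then have all: "T *\<^sub>v w = c \<cdot>\<^sub>v w" if "w \<in> carrier_vec d" for w using that by (auto simp: W_def)
  have "T = c \<cdot>\<^sub>m 1\<^sub>m d"
  proof (rule mat_eq_on_vecs [OF T])
    fix w :: "complex vec" assume w: "w \<in> carrier_vec d"
    have "(c \<cdot>\<^sub>m 1\<^sub>m d) *\<^sub>v w = c \<cdot>\<^sub>v w"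
      by (rule eq_vecI) (use w in \<open>auto simp: scalar_prod_def if_distrib if_distribR sum.delta cong: if_cong\<close>)
    then show "T *\<^sub>v w = (c \<cdot>\<^sub>m 1\<^sub>m d) *\<^sub>v w" using all [OF w] by simp
  qed simp
  then show thesis by (rule that)
qed

end

subsection \<open>Normalized characters of irreducible representations\<close>

lemma Sym_bij_carrier: "bij_betw (\<langle>$\<rangle>) (Sym {1..n}) (carrier (sym_group n))"
proof (rule bij_betwI')
  show "((\<langle>$\<rangle>) x = (\<langle>$\<rangle>) y) = (x = y)" for x y :: "nat perm" by (simp add: Perm.apply_inject)
  show "(\<langle>$\<rangle>) x \<in> carrier (sym_group n)" if "x \<in> Sym {1..n}" for x
    using Sym_permutes [OF that] by (simp add: sym_group_def)
  fix p assume "p \<in> carrier (sym_group n)"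
  then have pm: "p permutes {1..n}" by (simp add: sym_group_def)
  obtain g where g: "g \<in> Sym {1..n}" "\<And>x. x \<in> {1..n} \<Longrightarrow> g \<langle>$\<rangle> x = p x"
    using Sym_obtain [of "{1..n}" p] permutes_imp_bij [OF pm] by auto
  have "p = (\<langle>$\<rangle>) g"
  proof
    fix x show "p x = g \<langle>$\<rangle> x"
      using g Sym_out [OF g(1), of x] permutes_not_in [OF pm, of x] by (cases "x \<in> {1..n}") auto
  qed
  then show "\<exists>x\<in>Sym {1..n}. p = (\<langle>$\<rangle>) x" using g(1) by blast
qed

lemma sum_carrier: "(\<Sum>\<sigma>\<in>carrier (sym_group n). F \<sigma>) = (\<Sum>g\<in>Sym {1..n}. F ((\<langle>$\<rangle>) g))"
  by (rule sum.reindex_bij_betw [OF Sym_bij_carrier, symmetric])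

lemma normal_conj:
  assumes "normal_elem n \<alpha>" "g \<in> Sym {1..n}" "t \<in> Sym {1..n}"
  shows "\<alpha> ((\<langle>$\<rangle>) (t + g - t)) = \<alpha> ((\<langle>$\<rangle>) g)"
proof -
  have c: "(\<langle>$\<rangle>) t \<in> carrier (sym_group n)" "(\<langle>$\<rangle>) g \<in> carrier (sym_group n)"
    using Sym_permutes assms by (auto simp: sym_group_def)
  have m: "Group.monoid.mult (sym_group n) = (\<circ>)" by (simp add: sym_group_def)
  have i: "m_inv (sym_group n) ((\<langle>$\<rangle>) t) = (\<langle>$\<rangle>) (- t)"
  proof (rule group.inv_equality [OF sym_group_is_group])
    show "Group.monoid.mult (sym_group n) ((\<langle>$\<rangle>) (- t)) ((\<langle>$\<rangle>) t) = one (sym_group n)"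
      by (simp add: sym_group_def fun_eq_iff)
    show "(\<langle>$\<rangle>) (- t) \<in> carrier (sym_group n)"
      using Sym_permutes [OF Sym_closed(3) [OF assms(3)]] by (simp add: sym_group_def)
  qed (use c in simp)
  have "\<alpha> ((\<langle>$\<rangle>) t \<circ> (\<langle>$\<rangle>) g \<circ> (\<langle>$\<rangle>) (- t)) = \<alpha> ((\<langle>$\<rangle>) g)"
    using assms(1) c unfolding normal_elem_def m [symmetric] i [symmetric] by blast
  moreover have "(\<langle>$\<rangle>) t \<circ> (\<langle>$\<rangle>) g \<circ> (\<langle>$\<rangle>) (- t) = (\<langle>$\<rangle>) (t + g - t)"
    by (simp add: fun_eq_iff)
  ultimately show ?thesis by simp
qed

context irrep
begin

lemma subG: "subgrp G" by simp

lemma cardG: "card G > 0" by (rule subgrp_card [OF subG])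

text \<open>The action of the unnormalized class sum of \<open>h\<close>. It commutes with the
  representation and is therefore a scalar.\<close>

definition T :: "nat perm \<Rightarrow> complex mat" where
  "T h = msum d G (\<lambda>t. R (t + h - t))"

lemma bij_conj: "g \<in> G \<Longrightarrow> bij_betw (\<lambda>t. g + t) G G"
proof (rule bij_betw_byWitness [where f' = "\<lambda>t. - g + t"])
qed (auto simp flip: add.assoc)

lemma T_comm:
  assumes h: "h \<in> G" and g: "g \<in> G"
  shows "R g * T h = T h * R g"
proof -
  have "R g * T h = msum d G (\<lambda>t. R g * R (t + h - t))"
    unfolding T_def using h g by (intro msum_left) simp_all
  also have "\<dots> = msum d G (\<lambda>t. R ((g + t) + h - (g + t)) * R g)"
  proof (rule msum_cong)
    fix t assume t: "t \<in> G"
    have "R g * R (t + h - t) = R (g + (t + h - t))" using t h g by (intro R_add [symmetric]) simp_all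
    also have "g + (t + h - t) = ((g + t) + h - (g + t)) + g" by (simp only: conj_conj diff_add_cancel)
    also have "R \<dots> = R ((g + t) + h - (g + t)) * R g"
      using t h g by (intro R_add Sym_closed)
    finally show "R g * R (t + h - t) = R ((g + t) + h - (g + t)) * R g" .
  qed
  also have "\<dots> = msum d G (\<lambda>t. R (t + h - t) * R g)"
    by (rule msum_reindex [OF bij_conj [OF g], of d "\<lambda>t. R (t + h - t) * R g"])
  also have "\<dots> = T h * R g"
    unfolding T_def by (rule msum_right [symmetric]) (use h g in simp_all)
  finally show ?thesis .
qed

definition c :: "nat perm \<Rightarrow> complex" where
  "c h = T h $$ (0, 0)"

lemma T_scalar: "h \<in> G \<Longrightarrow> T h = c h \<cdot>\<^sub>m 1\<^sub>m d"
proof -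
  assume h: "h \<in> G"
  have "T h \<in> carrier_mat d d" by (simp add: T_def)
  then obtain k where k: "T h = k \<cdot>\<^sub>m 1\<^sub>m d" using schur T_comm [OF h] by blast
  then have "c h = k" using d_pos by (simp add: c_def)
  then show ?thesis using k by simp
qed

text \<open>Trace divided by degree, read off as the scalar by which the class average of
  \<open>h\<close> acts.\<close>

definition \<chi> :: "nat perm \<Rightarrow> complex" where
  "\<chi> h = c h / of_nat (card G)"

lemma sph_chi: "sph G \<chi>"
  unfolding sph_def
proof (intro conjI ballI)
  have "T 0 = msum d G (\<lambda>t. 1 \<cdot>\<^sub>m 1\<^sub>m d)"
    unfolding T_def by (rule msum_cong) (simp add: R_0, rule eq_matI, auto)
  then have "c 0 \<cdot>\<^sub>m 1\<^sub>m d = of_nat (card G) \<cdot>\<^sub>m 1\<^sub>m d"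
    using T_scalar [of 0] by (simp add: msum_scalar)
  then have "c 0 = of_nat (card G)" using d_pos by (simp only: scalar_mat_eq)
  then show "\<chi> 0 = 1" using cardG by (simp add: \<chi>_def)
  fix g h assume g: "g \<in> G" and h: "h \<in> G"
  have in1: "g + (t + h - t) \<in> G" if "t \<in> G" for t using that g h by simp
  have "(\<Sum>t\<in>G. c (g + (t + h - t))) \<cdot>\<^sub>m 1\<^sub>m d = msum d G (\<lambda>t. c (g + (t + h - t)) \<cdot>\<^sub>m 1\<^sub>m d)"
    by (rule msum_scalar [symmetric])
  also have "\<dots> = msum d G (\<lambda>t. T (g + (t + h - t)))"
    by (rule msum_cong) (rule T_scalar [OF in1, symmetric])
  \<comment> \<open>After the exchange the inner sum is \<open>R (s + g) * T h * R (- s)\<close>,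
    from which the scalar \<open>T h\<close> can be pulled out.\<close>
  also have "\<dots> = msum d G (\<lambda>s. msum d G (\<lambda>t. R (s + (g + (t + h - t)) - s)))"
    unfolding T_def by (rule msum_swap)
  also have "\<dots> = msum d G (\<lambda>s. c h \<cdot>\<^sub>m R (s + g - s))"
  proof (rule msum_cong)
    fix s assume s: "s \<in> G"
    have "msum d G (\<lambda>t. R (s + (g + (t + h - t)) - s)) = msum d G (\<lambda>t. R (s + g) * (R (t + h - t) * R (- s)))"
    proof (rule msum_cong)
      fix t assume t: "t \<in> G"
      have "s + (g + (t + h - t)) - s = (s + g) + ((t + h - t) + - s)"
        by (simp only: diff_conv_add_uminus add.assoc)
      then show "R (s + (g + (t + h - t)) - s) = R (s + g) * (R (t + h - t) * R (- s))"
        using s t g h by (simp add: R_add del: add_uminus_conv_diff)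
    qed
    also have "\<dots> = R (s + g) * msum d G (\<lambda>t. R (t + h - t) * R (- s))"
      by (rule msum_left [symmetric]) (use s g h in \<open>(intro R_carrier Sym_closed mult_carrier_mat [of _ d d _ d]; simp)+\<close>)
    also have "msum d G (\<lambda>t. R (t + h - t) * R (- s)) = T h * R (- s)"
      unfolding T_def by (rule msum_right [symmetric]) (use s g h in \<open>(intro R_carrier Sym_closed; simp)+\<close>)
    also have "T h * R (- s) = c h \<cdot>\<^sub>m R (- s)"
      using T_scalar [OF h] s by (simp add: mult_smult_assoc_mat [of _ d d _ d] left_mult_one_mat [OF R_carrier])
    also have "R (s + g) * (c h \<cdot>\<^sub>m R (- s)) = c h \<cdot>\<^sub>m (R (s + g) * R (- s))"
      using s g by (intro mult_smult_distrib [of _ d d _ d]) auto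
    also have "R (s + g) * R (- s) = R (s + g - s)"
      using R_add [of "s + g" "- s"] s g by simp
    finally show "msum d G (\<lambda>t. R (s + (g + (t + h - t)) - s)) = c h \<cdot>\<^sub>m R (s + g - s)" .
  qed
  also have "\<dots> = c h \<cdot>\<^sub>m T g" unfolding T_def by (rule msum_smult) (use g in auto)
  also have "\<dots> = (c g * c h) \<cdot>\<^sub>m 1\<^sub>m d"
    unfolding T_scalar [OF g] by (rule eq_matI) auto
  finally have "(\<Sum>t\<in>G. c (g + (t + h - t))) = c g * c h" using d_pos by (simp only: scalar_mat_eq)
  then show "avg G (\<lambda>t. \<chi> (g + (t + h - t))) = \<chi> g * \<chi> h"
    by (simp add: avg_def \<chi>_def scaleR_conv_of_real flip: sum_divide_distrib)
qed

text \<open>As \<alpha> is constant on classes, each \<open>R g\<close> may be replaced by its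
  average over conjugates, which is the scalar \<open>\<chi> g\<close>.\<close>

lemma rep_elem_scalar:
  assumes nrm: "normal_elem n \<alpha>"
  shows "rep_elem n d \<rho> \<alpha> = (\<Sum>g\<in>G. of_real (\<alpha> ((\<langle>$\<rangle>) g)) * \<chi> g) \<cdot>\<^sub>m 1\<^sub>m d"
proof (rule eq_matI)
  fix i j assume "i < dim_row ((\<Sum>g\<in>G. of_real (\<alpha> ((\<langle>$\<rangle>) g)) * \<chi> g) \<cdot>\<^sub>m 1\<^sub>m d)"
    "j < dim_col ((\<Sum>g\<in>G. of_real (\<alpha> ((\<langle>$\<rangle>) g)) * \<chi> g) \<cdot>\<^sub>m 1\<^sub>m d)"
  then have ij: "i < d" "j < d" by simp_all
  define a where "a g = complex_of_real (\<alpha> ((\<langle>$\<rangle>) g))" for g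
  define E where "E = rep_elem n d \<rho> \<alpha> $$ (i, j)"
  have E: "E = (\<Sum>g\<in>G. a g * R g $$ (i, j))"
    using ij by (simp add: E_def rep_elem_def sum_carrier a_def R_def scaleR_conv_of_real)
  have conj: "E = (\<Sum>g\<in>G. a g * R (t + g - t) $$ (i, j))" if t: "t \<in> G" for t
  proof -
    have b: "bij_betw (\<lambda>g. t + g - t) G G"
      by (rule bij_betw_byWitness [where f' = "\<lambda>g. - t + g + t"])
         (use t in \<open>auto simp: add.assoc simp flip: diff_conv_add_uminus\<close>)
    have "E = (\<Sum>g\<in>G. a (t + g - t) * R (t + g - t) $$ (i, j))"
      unfolding E by (rule sum.reindex_bij_betw [OF b, symmetric])
    also have "\<dots> = (\<Sum>g\<in>G. a g * R (t + g - t) $$ (i, j))"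
      by (rule sum.cong [OF refl]) (use normal_conj [OF nrm _ t] in \<open>simp add: a_def\<close>)
    finally show ?thesis .
  qed
  have "of_nat (card G) * E = (\<Sum>t\<in>G. E)" by simp
  also have "\<dots> = (\<Sum>t\<in>G. \<Sum>g\<in>G. a g * R (t + g - t) $$ (i, j))"
    by (rule sum.cong [OF refl]) (rule conj)
  also have "\<dots> = (\<Sum>g\<in>G. \<Sum>t\<in>G. a g * R (t + g - t) $$ (i, j))" by (rule sum.swap)
  also have "\<dots> = (\<Sum>g\<in>G. a g * T g $$ (i, j))"
    unfolding T_def using ij by (simp add: sum_distrib_left)
  also have "\<dots> = (\<Sum>g\<in>G. a g * (of_nat (card G) * \<chi> g) * (1\<^sub>m d $$ (i, j)))"
    by (rule sum.cong [OF refl]) (use ij cardG in \<open>simp add: T_scalar \<chi>_def\<close>)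
  also have "\<dots> = of_nat (card G) * ((\<Sum>g\<in>G. a g * \<chi> g) * (1\<^sub>m d $$ (i, j)))"
    unfolding sum_distrib_left sum_distrib_right by (rule sum.cong) (auto simp: algebra_simps)
  finally have "E = (\<Sum>g\<in>G. a g * \<chi> g) * (1\<^sub>m d $$ (i, j))" using cardG by simp
  then show "rep_elem n d \<rho> \<alpha> $$ (i, j) = ((\<Sum>g\<in>G. of_real (\<alpha> ((\<langle>$\<rangle>) g)) * \<chi> g) \<cdot>\<^sub>m 1\<^sub>m d) $$ (i, j)"
    using ij by (simp add: E_def a_def)
qed (simp_all add: rep_elem_def)

text \<open>\<open>E\<close> is \<open>card G\<close> times the projection onto the \<xi>-isotypic
  part. Averaging over conjugates shows that it is \<open>card G\<close> times the identity, while
  \<open>R g\<close> multiplies it by \<open>\<xi> g\<close>.\<close>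

lemma linear_char_rep:
  assumes l: "lchar G \<xi>" and chi: "\<And>g. g \<in> G \<Longrightarrow> \<chi> g = of_real (\<xi> g)"
  shows "g \<in> G \<Longrightarrow> R g = of_real (\<xi> g) \<cdot>\<^sub>m 1\<^sub>m d"
proof -
  note lD = lcharD [OF l subG]
  define E where "E = msum d G (\<lambda>h. of_real (\<xi> h) \<cdot>\<^sub>m R h)"
  have conj: "E = msum d G (\<lambda>h. of_real (\<xi> h) \<cdot>\<^sub>m R (t + h - t))" if t: "t \<in> G" for t
  proof -
    have b: "bij_betw (\<lambda>g. t + g - t) G G"
      by (rule bij_betw_byWitness [where f' = "\<lambda>g. - t + g + t"])
         (use t in \<open>auto simp: add.assoc simp flip: diff_conv_add_uminus\<close>)
    have lc: "\<xi> (t + h - t) = \<xi> h" if h: "h \<in> G" for h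
    proof -
      have "\<xi> (t + h - t) = \<xi> (t + h) * \<xi> (- t)" using lD(1) [of "t + h" "- t"] h t by simp
      also have "\<dots> = \<xi> h * (\<xi> t * \<xi> t)" using lD h t by simp
      finally show ?thesis using lD(2) [OF t] by simp
    qed
    have "E = msum d G (\<lambda>h. of_real (\<xi> (t + h - t)) \<cdot>\<^sub>m R (t + h - t))"
      unfolding E_def by (rule msum_reindex [OF b, symmetric])
    also have "\<dots> = msum d G (\<lambda>h. of_real (\<xi> h) \<cdot>\<^sub>m R (t + h - t))"
      by (rule msum_cong) (simp add: lc)
    finally show ?thesis .
  qed
  have "of_nat (card G) \<cdot>\<^sub>m E = msum d G (\<lambda>t. E)"
    by (rule eq_matI) (auto simp: E_def)
  also have "\<dots> = msum d G (\<lambda>t. msum d G (\<lambda>h. of_real (\<xi> h) \<cdot>\<^sub>m R (t + h - t)))"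
    by (rule msum_cong) (rule conj)
  also have "\<dots> = msum d G (\<lambda>h. msum d G (\<lambda>t. of_real (\<xi> h) \<cdot>\<^sub>m R (t + h - t)))"
    by (rule msum_swap)
  also have "\<dots> = msum d G (\<lambda>h. of_nat (card G) \<cdot>\<^sub>m 1\<^sub>m d)"
  proof (rule msum_cong)
    fix h assume h: "h \<in> G"
    have "msum d G (\<lambda>t. of_real (\<xi> h) \<cdot>\<^sub>m R (t + h - t)) = of_real (\<xi> h) \<cdot>\<^sub>m T h"
      unfolding T_def by (rule msum_smult) (use h in simp)
    also have "T h = (of_real (\<xi> h) * of_nat (card G)) \<cdot>\<^sub>m 1\<^sub>m d"
      using T_scalar [OF h] chi [OF h] cardG by (simp add: \<chi>_def field_simps)
    also have "of_real (\<xi> h) \<cdot>\<^sub>m ((of_real (\<xi> h) * of_nat (card G)) \<cdot>\<^sub>m 1\<^sub>m d) =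
        (of_real (\<xi> h * \<xi> h) * of_nat (card G)) \<cdot>\<^sub>m (1\<^sub>m d :: complex mat)"
      by (rule eq_matI) auto
    finally show "msum d G (\<lambda>t. of_real (\<xi> h) \<cdot>\<^sub>m R (t + h - t)) = of_nat (card G) \<cdot>\<^sub>m 1\<^sub>m d"
      by (simp only: lD(2) [OF h] of_real_1 mult_1)
  qed
  also have "\<dots> = (of_nat (card G) * of_nat (card G)) \<cdot>\<^sub>m 1\<^sub>m d" unfolding msum_scalar by simp
  finally have EE: "of_nat (card G) \<cdot>\<^sub>m E = (of_nat (card G) * of_nat (card G)) \<cdot>\<^sub>m 1\<^sub>m d" .
  have E: "E = of_nat (card G) \<cdot>\<^sub>m 1\<^sub>m d"
  proof (rule eq_matI)
    fix i j assume "i < dim_row (of_nat (card G) \<cdot>\<^sub>m (1\<^sub>m d :: complex mat))" "j < dim_col (of_nat (card G) \<cdot>\<^sub>m (1\<^sub>m d :: complex mat))"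
    then have ij: "i < d" "j < d" by simp_all
    have "(of_nat (card G) \<cdot>\<^sub>m E) $$ (i, j) = ((of_nat (card G) * of_nat (card G)) \<cdot>\<^sub>m 1\<^sub>m d) $$ (i, j)"
      by (simp only: EE)
    moreover have "dim_row E = d" "dim_col E = d" by (simp_all add: E_def)
    ultimately show "E $$ (i, j) = (of_nat (card G) \<cdot>\<^sub>m 1\<^sub>m d) $$ (i, j)" using ij cardG by simp
  qed (simp_all add: E_def)
  assume g: "g \<in> G"
  have "R g * E = msum d G (\<lambda>h. R g * (of_real (\<xi> h) \<cdot>\<^sub>m R h))"
    unfolding E_def by (rule msum_left) (use g in auto)
  also have "\<dots> = msum d G (\<lambda>h. of_real (\<xi> g) \<cdot>\<^sub>m (of_real (\<xi> (g + h)) \<cdot>\<^sub>m R (g + h)))"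
  proof (rule msum_cong)
    fix h assume h: "h \<in> G"
    have "R g * (of_real (\<xi> h) \<cdot>\<^sub>m R h) = of_real (\<xi> h) \<cdot>\<^sub>m R (g + h)"
      using mult_smult_distrib [OF R_carrier [OF g] R_carrier [OF h]] R_add [OF g h] by simp
    moreover have "\<xi> h = \<xi> g * \<xi> (g + h)"
      using lD(1) [OF g h] lD(2) [OF g] by (simp flip: mult.assoc)
    ultimately have "R g * (of_real (\<xi> h) \<cdot>\<^sub>m R h) = (of_real (\<xi> g) * of_real (\<xi> (g + h))) \<cdot>\<^sub>m R (g + h)"
      by (metis of_real_mult)
    also have "\<dots> = of_real (\<xi> g) \<cdot>\<^sub>m (of_real (\<xi> (g + h)) \<cdot>\<^sub>m R (g + h))"
      by (rule eq_matI) auto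
    finally show "R g * (of_real (\<xi> h) \<cdot>\<^sub>m R h) = of_real (\<xi> g) \<cdot>\<^sub>m (of_real (\<xi> (g + h)) \<cdot>\<^sub>m R (g + h))" .
  qed
  also have "\<dots> = msum d G (\<lambda>h. of_real (\<xi> g) \<cdot>\<^sub>m (of_real (\<xi> h) \<cdot>\<^sub>m R h))"
    by (rule msum_reindex [OF bij_conj [OF g], of d "\<lambda>h. of_real (\<xi> g) \<cdot>\<^sub>m (of_real (\<xi> h) \<cdot>\<^sub>m R h)"])
  also have "\<dots> = of_real (\<xi> g) \<cdot>\<^sub>m E" unfolding E_def by (rule msum_smult) simp
  finally have "R g * E = of_real (\<xi> g) \<cdot>\<^sub>m E" .
  then have eq: "of_nat (card G) \<cdot>\<^sub>m R g = of_real (\<xi> g) \<cdot>\<^sub>m (of_nat (card G) \<cdot>\<^sub>m 1\<^sub>m d)"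
    unfolding E using mult_smult_distrib [OF R_carrier [OF g] one_carrier_mat] R_carrier [OF g] by simp
  show "R g = of_real (\<xi> g) \<cdot>\<^sub>m 1\<^sub>m d"
  proof (rule eq_matI)
    fix i j assume "i < dim_row (of_real (\<xi> g) \<cdot>\<^sub>m (1\<^sub>m d :: complex mat))" "j < dim_col (of_real (\<xi> g) \<cdot>\<^sub>m (1\<^sub>m d :: complex mat))"
    then have ij: "i < d" "j < d" by simp_all
    have "(of_nat (card G) \<cdot>\<^sub>m R g) $$ (i, j) = (of_real (\<xi> g) \<cdot>\<^sub>m (of_nat (card G) \<cdot>\<^sub>m 1\<^sub>m d)) $$ (i, j)"
      by (simp only: eq)
    moreover have "dim_row (R g) = d" "dim_col (R g) = d" using R_carrier [OF g] by auto
    ultimately show "R g $$ (i, j) = (of_real (\<xi> g) \<cdot>\<^sub>m 1\<^sub>m d) $$ (i, j)"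
      using ij cardG by (auto split: if_splits)
  qed (use R_carrier [OF g] in auto)
qed

lemma scalar_rep_dim:
  assumes "\<And>g. g \<in> G \<Longrightarrow> R g = l g \<cdot>\<^sub>m 1\<^sub>m d"
  shows "d = 1"
proof (rule ccontr)
  assume "d \<noteq> 1"
  then have d: "0 < d" "1 < d" using d_pos by auto
  define W where "W = range (\<lambda>k. k \<cdot>\<^sub>v unit_vec d 0 :: complex vec)"
  have "W = carrier_vec d"
  proof (rule irreducible [of _ "unit_vec d 0"])
    show "0\<^sub>v d \<in> W" unfolding W_def by (rule range_eqI [of _ _ 0]) (rule eq_vecI, auto)
    show "v + w \<in> W" if "v \<in> W" "w \<in> W" for v w
      using that by (auto simp: W_def simp flip: add_smult_distrib_vec)
    show "k \<cdot>\<^sub>v v \<in> W" if "v \<in> W" for k v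
      using that by (auto simp: W_def smult_smult_assoc)
    show "R g *\<^sub>v v \<in> W" if g: "g \<in> G" and v: "v \<in> W" for g v
    proof -
      have vc: "v \<in> carrier_vec d" using v by (auto simp: W_def)
      have "R g *\<^sub>v v = l g \<cdot>\<^sub>v v"
        unfolding assms [OF g]
        by (rule eq_vecI) (use vc in \<open>auto simp: scalar_prod_def if_distrib if_distribR sum.delta cong: if_cong\<close>)
      then show ?thesis using v by (auto simp: W_def smult_smult_assoc)
    qed
    show "unit_vec d 0 \<in> W" unfolding W_def by (rule range_eqI [of _ _ 1]) simp
    show "unit_vec d 0 \<noteq> (0\<^sub>v d :: complex vec)" using d by (metis index_unit_vec(1) index_zero_vec(1) zero_neq_one)
  qed (auto simp: W_def)
  moreover have "unit_vec d 1 \<in> carrier_vec d" by simp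
  ultimately obtain k where "unit_vec d 1 = k \<cdot>\<^sub>v (unit_vec d 0 :: complex vec)" unfolding W_def by blast
  then have "unit_vec d 1 $ 1 = (k \<cdot>\<^sub>v (unit_vec d 0 :: complex vec)) $ 1" by simp
  then show False using d by simp
qed

lemma carrier_obtain:
  assumes "\<sigma> \<in> carrier (sym_group n)"
  obtains g where "g \<in> G" "\<sigma> = (\<langle>$\<rangle>) g"
  using Sym_bij_carrier [of n] assms by (auto simp: bij_betw_def)

text \<open>The normalized character is real by \<open>spherical_finite\<close>. Were it trivial or
  the sign, the representation would act by scalars, hence have degree 1 and be isomorphic to an
  excluded one.\<close>

lemma proper_character:
  assumes "\<not> isomorphic_reps n \<rho> triv_rep" "\<not> isomorphic_reps n \<rho> sgn_rep"
  obtains r where "proper_sph {1..n} r" "\<And>g. g \<in> G \<Longrightarrow> \<chi> g = of_real (r g)"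
proof -
  interpret A: ambivalent_group G by (rule ambivalent_Sym) simp
  obtain r where r: "sph G r" "\<And>g. g \<in> G \<Longrightarrow> \<chi> g = of_real (r g)"
    using A.spherical_finite sph_chi by blast
  have iso: "isomorphic_reps n \<rho> \<rho>'"
    if l: "lchar G \<xi>" "\<And>g. g \<in> G \<Longrightarrow> r g = \<xi> g" and r': "\<And>g. g \<in> G \<Longrightarrow> \<rho>' ((\<langle>$\<rangle>) g) = of_real (\<xi> g) \<cdot>\<^sub>m 1\<^sub>m 1" for \<xi> \<rho>'
  proof -
    have R: "R g = of_real (\<xi> g) \<cdot>\<^sub>m 1\<^sub>m d" if "g \<in> G" for g
      by (rule linear_char_rep [OF l(1) _ that]) (simp add: r(2) l(2))
    then have d1: "d = 1" by (rule scalar_rep_dim)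
    have "similar_mat_wit (\<rho> \<sigma>) (\<rho>' \<sigma>) (1\<^sub>m 1) (1\<^sub>m 1)" if s: "\<sigma> \<in> carrier (sym_group n)" for \<sigma>
    proof -
      obtain g where g: "g \<in> G" "\<sigma> = (\<langle>$\<rangle>) g" using carrier_obtain [OF s] .
      have "\<rho> \<sigma> = of_real (\<xi> g) \<cdot>\<^sub>m 1\<^sub>m 1" using R [OF g(1)] g(2) d1 by (simp add: R_def)
      then show ?thesis using r' [OF g(1)] g(2) by (simp add: similar_mat_wit_def Let_def)
    qed
    then show ?thesis unfolding isomorphic_reps_def by blast
  qed
  have one: "1\<^sub>m 1 = 1 \<cdot>\<^sub>m (1\<^sub>m 1 :: complex mat)" by (rule eq_matI) auto
  have "\<exists>g\<in>G. r g \<noteq> 1"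
  proof (rule ccontr)
    assume "\<not> (\<exists>g\<in>G. r g \<noteq> 1)"
    then have "isomorphic_reps n \<rho> triv_rep"
      by (intro iso [of "\<lambda>_. 1"] lchar_one) (auto simp: triv_rep_def one [symmetric])
    then show False using assms by blast
  qed
  moreover have "\<exists>g\<in>G. r g \<noteq> sg g"
  proof (rule ccontr)
    assume "\<not> (\<exists>g\<in>G. r g \<noteq> sg g)"
    then have "isomorphic_reps n \<rho> sgn_rep"
      by (intro iso [of sg] lchar_sg) (auto simp: sgn_rep_def sg_def)
    then show False using assms by blast
  qed
  ultimately show thesis using that r by (auto simp: proper_sph_def)
qed

lemma largest_eigenvalue_rep_elem:
  assumes nrm: "normal_elem n \<alpha>" and chi: "\<And>g. g \<in> G \<Longrightarrow> \<chi> g = of_real (r g)"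
  shows "largest_eigenvalue (rep_elem n d \<rho> \<alpha>) = (\<Sum>g\<in>G. \<alpha> ((\<langle>$\<rangle>) g) * r g)"
proof -
  define x where "x = (\<Sum>g\<in>G. \<alpha> ((\<langle>$\<rangle>) g) * r g)"
  have A: "rep_elem n d \<rho> \<alpha> = of_real x \<cdot>\<^sub>m 1\<^sub>m d"
    unfolding rep_elem_scalar [OF nrm] x_def by (simp add: chi cong: sum.cong)
  have mv: "(of_real x \<cdot>\<^sub>m 1\<^sub>m d) *\<^sub>v v = of_real x \<cdot>\<^sub>v v" if "v \<in> carrier_vec d" for v :: "complex vec"
    by (rule eq_vecI) (use that in \<open>auto simp: scalar_prod_def if_distrib if_distribR sum.delta cong: if_cong\<close>)
  have "eigenvalue (rep_elem n d \<rho> \<alpha>) (of_real y) \<longleftrightarrow> y = x" for y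
  proof
    assume "eigenvalue (rep_elem n d \<rho> \<alpha>) (of_real y)"
    then obtain v where v: "v \<in> carrier_vec d" "v \<noteq> 0\<^sub>v d" "of_real x \<cdot>\<^sub>v v = of_real y \<cdot>\<^sub>v (v :: complex vec)"
      unfolding eigenvalue_def eigenvector_def A by (auto simp: mv)
    obtain i where i: "i < d" "v $ i \<noteq> 0"
    proof -
      have "\<exists>i<d. v $ i \<noteq> 0"
      proof (rule ccontr)
        assume "\<not> (\<exists>i<d. v $ i \<noteq> 0)"
        then have "v = 0\<^sub>v d" using v(1) by (intro eq_vecI) auto
        then show False using v(2) by blast
      qed
      then show thesis using that by blast
    qed
    have "(of_real x \<cdot>\<^sub>v v) $ i = (of_real y \<cdot>\<^sub>v v) $ i" by (simp only: v(3))
    then show "y = x" using i v(1) by simp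
  next
    assume "y = x"
    have "unit_vec d 0 \<noteq> (0\<^sub>v d :: complex vec)"
      using d_pos by (metis index_unit_vec(1) index_zero_vec(1) zero_neq_one)
    then have "eigenvector (of_real x \<cdot>\<^sub>m 1\<^sub>m d) (unit_vec d 0) (of_real x :: complex)"
      unfolding eigenvector_def by (simp add: mv)
    then show "eigenvalue (rep_elem n d \<rho> \<alpha>) (of_real y)" unfolding A \<open>y = x\<close> eigenvalue_def by blast
  qed
  then have "{y. eigenvalue (rep_elem n d \<rho> \<alpha>) (complex_of_real y)} = {x}" by auto
  then show ?thesis by (simp add: largest_eigenvalue_def x_def)
qed

end

subsection \<open>The Schreier graph\<close>

text \<open>The matrix commutes with a doubly transitive action, so it is constant on the diagonal
  and off it: \<open>w\<close> times the identity plus \<open>b\<close> times the all-ones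
  matrix.\<close>

lemma permutation_matrix_entries:
  fixes \<alpha> :: "(nat \<Rightarrow> nat) \<Rightarrow> real"
  assumes n: "2 \<le> n" and nrm: "normal_elem n \<alpha>"
  defines "w \<equiv> \<Sum>g\<in>Sym {1..n}. \<alpha> ((\<langle>$\<rangle>) g) * (real (card {x\<in>{1..n}. g \<langle>$\<rangle> x = x}) - 1) / (real n - 1)"
  obtains b where "\<And>i j. i < n \<Longrightarrow> j < n \<Longrightarrow>
    rep_elem n n (perm_mat n) \<alpha> $$ (i, j) = (if i = j then w else 0) + b"
proof -
  let ?G = "Sym {1..n}"
  define a where "a g = \<alpha> ((\<langle>$\<rangle>) g)" for g
  define m where "m x y = (\<Sum>g\<in>?G. if g \<langle>$\<rangle> y = x then a g else 0)" for x y :: nat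
  have entry: "rep_elem n n (perm_mat n) \<alpha> $$ (i, j) = m (Suc i) (Suc j)" if "i < n" "j < n" for i j
    using that by (simp add: rep_elem_def perm_mat_def sum_carrier m_def a_def if_distrib cong: if_cong)
  have inv: "m (t \<langle>$\<rangle> x) (t \<langle>$\<rangle> y) = m x y" if t: "t \<in> ?G" for t x y
  proof -
    have b: "bij_betw (\<lambda>g. t + g - t) ?G ?G"
      by (rule bij_betw_byWitness [where f' = "\<lambda>g. - t + g + t"])
         (use t in \<open>auto simp: add.assoc simp flip: diff_conv_add_uminus\<close>)
    have "m (t \<langle>$\<rangle> x) (t \<langle>$\<rangle> y) = (\<Sum>g\<in>?G. if (t + g - t) \<langle>$\<rangle> (t \<langle>$\<rangle> y) = t \<langle>$\<rangle> x then a (t + g - t) else 0)"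
      unfolding m_def by (rule sum.reindex_bij_betw [OF b, symmetric])
    also have "\<dots> = m x y"
      unfolding m_def
    proof (rule sum.cong [OF refl])
      fix g assume g: "g \<in> ?G"
      have "(t + g - t) \<langle>$\<rangle> (t \<langle>$\<rangle> y) = t \<langle>$\<rangle> (g \<langle>$\<rangle> y)" by simp
      moreover have "a (t + g - t) = a g" unfolding a_def by (rule normal_conj [OF nrm g t])
      ultimately show "(if (t + g - t) \<langle>$\<rangle> (t \<langle>$\<rangle> y) = t \<langle>$\<rangle> x then a (t + g - t) else 0) =
          (if g \<langle>$\<rangle> y = x then a g else 0)" by (simp add: ap_inj)
    qed
    finally show ?thesis .
  qed
  have tG: "tr x y \<in> ?G" if "x \<in> {1..n}" "y \<in> {1..n}" for x y
    using that by (intro tr_Sym) auto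
  have dia: "m x x = m 1 1" if "x \<in> {1..n}" for x
    using inv [OF tG [OF that], of 1 1 1] n by (simp add: ap_tr)
  have off: "m x y = m 1 2" if xy: "x \<in> {1..n}" "y \<in> {1..n}" "x \<noteq> y" for x y
  proof -
    define y' where "y' = tr x 1 \<langle>$\<rangle> y"
    have y': "y' \<in> {1..n}" "y' \<noteq> 1" using xy n by (auto simp: y'_def ap_tr)
    have "m x y = m 1 y'" using inv [OF tG [OF xy(1), of 1], of x y] n by (simp add: y'_def ap_tr)
    also have "\<dots> = m 1 2" using inv [OF tG [OF y'(1), of 2], of 1 y'] n y' by (simp add: ap_tr)
    finally show ?thesis .
  qed
  \<comment> \<open>The trace counts fixed points and a column adds up to the total weight; these
    two equations determine the difference.\<close>
  have w: "w = m 1 1 - m 1 2"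
  proof -
    have "(\<Sum>x\<in>{1..n}. m x x) = (\<Sum>g\<in>?G. \<Sum>x\<in>{1..n}. if g \<langle>$\<rangle> x = x then a g else 0)"
      unfolding m_def by (rule sum.swap)
    also have "\<dots> = (\<Sum>g\<in>?G. a g * real (card {x\<in>{1..n}. g \<langle>$\<rangle> x = x}))"
    proof (rule sum.cong [OF refl])
      fix g
      have "(\<Sum>x\<in>{1..n}. if g \<langle>$\<rangle> x = x then a g else 0) = (\<Sum>x\<in>{x\<in>{1..n}. g \<langle>$\<rangle> x = x}. a g)"
        by (rule sum.inter_filter [symmetric]) (rule finite_atLeastAtMost)
      then show "(\<Sum>x\<in>{1..n}. if g \<langle>$\<rangle> x = x then a g else 0) = a g * real (card {x\<in>{1..n}. g \<langle>$\<rangle> x = x})"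
        by (simp only: sum_constant mult.commute)
    qed
    finally have "(\<Sum>g\<in>?G. a g * real (card {x\<in>{1..n}. g \<langle>$\<rangle> x = x})) = (\<Sum>x\<in>{1..n}. m x x)" ..
    also have "\<dots> = (\<Sum>x\<in>{1..n}. m 1 1)" by (rule sum.cong [OF refl dia])
    also have "\<dots> = real n * m 1 1" by simp
    finally have f: "(\<Sum>g\<in>?G. a g * real (card {x\<in>{1..n}. g \<langle>$\<rangle> x = x})) = real n * m 1 1" .
    have "(\<Sum>x\<in>{1..n}. m x 1) = (\<Sum>g\<in>?G. \<Sum>x\<in>{1..n}. if g \<langle>$\<rangle> 1 = x then a g else 0)"
      unfolding m_def by (rule sum.swap)
    also have "\<dots> = (\<Sum>g\<in>?G. a g)"
    proof (rule sum.cong [OF refl])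
      fix g assume "g \<in> ?G"
      then have "g \<langle>$\<rangle> 1 \<in> {1..n}" using n Sym_in [of g "{1..n}" 1] by simp
      then show "(\<Sum>x\<in>{1..n}. if g \<langle>$\<rangle> 1 = x then a g else 0) = a g" by simp
    qed
    also have "(\<Sum>x\<in>{1..n}. m x 1) = m 1 1 + (\<Sum>x\<in>{1..n} - {1}. m x 1)"
      using n by (intro sum.remove) auto
    also have "(\<Sum>x\<in>{1..n} - {1}. m x 1) = (\<Sum>x\<in>{1..n} - {1}. m 1 2)"
      by (rule sum.cong [OF refl], rule off) (use n in auto)
    also have "\<dots> = (real n - 1) * m 1 2" using n by (simp add: of_nat_diff)
    finally have s: "(\<Sum>g\<in>?G. a g) = m 1 1 + (real n - 1) * m 1 2" by simp
    have "w = ((\<Sum>g\<in>?G. a g * real (card {x\<in>{1..n}. g \<langle>$\<rangle> x = x})) - (\<Sum>g\<in>?G. a g)) / (real n - 1)"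
      unfolding w_def a_def
      by (simp add: sum_subtractf right_diff_distrib diff_divide_distrib sum_divide_distrib)
    also have "\<dots> = (real n - 1) * (m 1 1 - m 1 2) / (real n - 1)" unfolding f s by (simp add: algebra_simps)
    finally show ?thesis using n by simp
  qed
  show thesis
  proof (rule that [of "m 1 2"])
    fix i j assume ij: "i < n" "j < n"
    show "rep_elem n n (perm_mat n) \<alpha> $$ (i, j) = (if i = j then w else 0) + m 1 2"
      unfolding entry [OF ij] w using dia [of "Suc i"] off [of "Suc i" "Suc j"] ij
      by (cases "i = j") auto
  qed
qed

text \<open>The all-ones part annihilates vectors of coordinate sum 0, so the maximum is over a
  single eigenvalue.\<close>

lemma lambda_schreier_eq:
  fixes \<alpha> :: "(nat \<Rightarrow> nat) \<Rightarrow> real"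
  assumes n: "2 \<le> n" and nrm: "normal_elem n \<alpha>"
  shows "lambda_schreier n \<alpha> =
    (\<Sum>g\<in>Sym {1..n}. \<alpha> ((\<langle>$\<rangle>) g) * (real (card {x\<in>{1..n}. g \<langle>$\<rangle> x = x}) - 1) / (real n - 1))"
    
proof -
  define w where "w = (\<Sum>g\<in>Sym {1..n}. \<alpha> ((\<langle>$\<rangle>) g) * (real (card {x\<in>{1..n}. g \<langle>$\<rangle> x = x}) - 1) / (real n - 1))"
  define A where "A = rep_elem n n (perm_mat n) \<alpha>"
  have A: "A \<in> carrier_mat n n" by (simp add: A_def rep_elem_def)
  obtain b where b: "\<And>i j. i < n \<Longrightarrow> j < n \<Longrightarrow> A $$ (i, j) = (if i = j then w else 0) + b"
    using permutation_matrix_entries [OF n nrm] unfolding A_def w_def by blast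
  have mv: "A *\<^sub>v v = w \<cdot>\<^sub>v v" if v: "v \<in> carrier_vec n" "\<And>c. v \<bullet> vec n (\<lambda>_. c) = 0" for v
  proof (rule eq_vecI)
    have v0: "(\<Sum>j<n. v $ j) = 0"
      using v(1) v(2) [of 1] by (simp add: scalar_prod_def atLeast0LessThan)
    fix i assume "i < dim_vec (w \<cdot>\<^sub>v v)"
    then have i: "i < n" using v by simp
    have "(A *\<^sub>v v) $ i = (\<Sum>j<n. A $$ (i, j) * v $ j)"
      using i v(1) A by (simp add: scalar_prod_def atLeast0LessThan)
    also have "\<dots> = (\<Sum>j<n. (if i = j then w * v $ j else 0) + b * v $ j)"
      by (rule sum.cong [OF refl]) (use b i in \<open>simp add: distrib_right\<close>)
    also have "\<dots> = w * v $ i + b * (\<Sum>j<n. v $ j)"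
      using i by (simp add: sum.distrib sum_distrib_left)
    finally show "(A *\<^sub>v v) $ i = (w \<cdot>\<^sub>v v) $ i" using i v by (simp add: v0)
  qed (use A v in auto)
  have "{x. \<exists>v. eigenvector A v x \<and> (\<forall>c. v \<bullet> vec n (\<lambda>_. c) = 0)} = {w}"
  proof (rule Set.set_eqI, rule iffI)
    fix x assume "x \<in> {x. \<exists>v. eigenvector A v x \<and> (\<forall>c. v \<bullet> vec n (\<lambda>_. c) = 0)}"
    then obtain v where v: "eigenvector A v x" "\<And>c. v \<bullet> vec n (\<lambda>_. c) = 0" by blast
    have vc: "v \<in> carrier_vec n" "v \<noteq> 0\<^sub>v n" "A *\<^sub>v v = x \<cdot>\<^sub>v v"
      using v(1) A by (auto simp: eigenvector_def)
    have "\<exists>i<n. v $ i \<noteq> 0"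
    proof (rule ccontr)
      assume "\<not> (\<exists>i<n. v $ i \<noteq> 0)"
      then have "v = 0\<^sub>v n" using vc(1) by (intro eq_vecI) auto
      then show False using vc(2) by blast
    qed
    then obtain i where i: "i < n" "v $ i \<noteq> 0" by blast
    have "(x \<cdot>\<^sub>v v) $ i = (w \<cdot>\<^sub>v v) $ i" using mv [OF vc(1) v(2)] vc(3) by simp
    then show "x \<in> {w}" using i vc(1) by simp
  next
    fix x assume "x \<in> {w}"
    then have x: "x = w" by simp
    define v :: "real vec" where "v = unit_vec n 0 - unit_vec n 1"
    have vc: "v \<in> carrier_vec n" by (simp add: v_def)
    have v1: "v $ 0 \<noteq> 0" using n by (simp add: v_def)
    have "v \<noteq> 0\<^sub>v n"
    proof
      assume "v = 0\<^sub>v n"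
      then have "v $ 0 = 0" using n by simp
      then show False using v1 by blast
    qed
    moreover have orth: "v \<bullet> vec n (\<lambda>_. c) = 0" for c
      using n by (simp add: v_def minus_scalar_prod_distrib [of _ n])
    ultimately show "x \<in> {x. \<exists>v. eigenvector A v x \<and> (\<forall>c. v \<bullet> vec n (\<lambda>_. c) = 0)}"
      using vc A mv [OF vc orth] unfolding x eigenvector_def by blast
  qed
  then have "lambda_schreier n \<alpha> = w"
    unfolding lambda_schreier_def A_def [symmetric] by simp
  then show ?thesis unfolding w_def .
qed

subsection \<open>The standard representation\<close>

definition ext_vec :: "nat \<Rightarrow> complex vec \<Rightarrow> nat \<Rightarrow> complex" where
  "ext_vec n v k = (if k = n then - (\<Sum>j<n - 1. v $ j) else v $ (k - 1))"

text \<open>The matrix of \<open>\<sigma>\<close> on the vectors with coordinate sum 0, in the basis of the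
  \<open>e\<^sub>j - e\<^sub>n\<close> for \<open>j < n\<close>; the function \<open>ext_vec n v\<close> lists the \<open>n\<close> coordinates of the vector
  represented by \<open>v\<close>.\<close>

definition std_rep :: "nat \<Rightarrow> (nat \<Rightarrow> nat) \<Rightarrow> complex mat" where
  "std_rep n \<sigma> = mat (n - 1) (n - 1)
     (\<lambda>(i, j). of_bool (\<sigma> (Suc j) = Suc i) - of_bool (\<sigma> n = Suc i))"

text \<open>The coordinates of e_a - e_b. As \<open>Suc i\<close> stays below \<open>n\<close>, the
  index \<open>n\<close> contributes nothing, in accordance with e_n - e_n = 0.\<close>

definition root_vec :: "nat \<Rightarrow> nat \<Rightarrow> nat \<Rightarrow> complex vec" where
  "root_vec n a b = vec (n - 1) (\<lambda>i. of_bool (Suc i = a) - of_bool (Suc i = b))"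

lemma sum_shift_delta: "(\<Sum>j<(m::nat). of_bool (P = Suc j) * F (Suc j)) = (if P \<in> {1..m} then F P else (0::complex))"
proof -
  have "(\<Sum>j<m. of_bool (P = Suc j) * F (Suc j)) = (\<Sum>j\<in>{1..m}. of_bool (P = j) * F j)"
    by (rule sum.reindex_bij_witness [of _ "\<lambda>j. j - 1" Suc]) auto
  also have "\<dots> = (if P \<in> {1..m} then F P else 0)" by (simp add: of_bool_def if_distrib [of "\<lambda>z. z * _"] cong: if_cong)
  finally show ?thesis .
qed

lemma std_rep_carrier [simp]: "std_rep n \<sigma> \<in> carrier_mat (n - 1) (n - 1)"
  by (simp add: std_rep_def)

lemma std_rep_mult:
  assumes n: "2 \<le> n" and p: "p permutes {1..n}" and q: "q permutes {1..n}"
  shows "std_rep n (p \<circ> q) = std_rep n p * std_rep n q"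
proof (rule eq_matI)
  fix i k assume "i < dim_row (std_rep n p * std_rep n q)" "k < dim_col (std_rep n p * std_rep n q)"
  then have ik: "i < n - 1" "k < n - 1" by (simp_all add: std_rep_def)
  define F :: "nat \<Rightarrow> complex" where "F j = of_bool (p j = Suc i) - of_bool (p n = Suc i)" for j
  have F: "(if x \<in> {1..n - 1} then F x else 0) = F x" if "x \<in> {1..n}" for x
  proof (cases "x = n")
    case False
    then have "x \<in> {1..n - 1}" using that by auto
    then show ?thesis by simp
  qed (simp add: F_def)
  have qi: "q x \<in> {1..n}" if "x \<in> {1..n}" for x using that permutes_in_image [OF q] by blast
  have "(std_rep n p * std_rep n q) $$ (i, k) =
      (\<Sum>j<n - 1. F (Suc j) * (of_bool (q (Suc k) = Suc j) - of_bool (q n = Suc j)))"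
    using ik by (simp add: std_rep_def scalar_prod_def atLeast0LessThan F_def)
  also have "\<dots> = (\<Sum>j<n - 1. of_bool (q (Suc k) = Suc j) * F (Suc j)) - (\<Sum>j<n - 1. of_bool (q n = Suc j) * F (Suc j))"
    by (simp add: algebra_simps sum_subtractf)
  also have "\<dots> = F (q (Suc k)) - F (q n)"
    unfolding sum_shift_delta using F [OF qi, of "Suc k"] F [OF qi, of n] ik n by simp
  finally show "std_rep n (p \<circ> q) $$ (i, k) = (std_rep n p * std_rep n q) $$ (i, k)"
    using ik by (simp add: std_rep_def F_def)
qed (simp_all add: std_rep_def)

lemma std_rep_id: "2 \<le> n \<Longrightarrow> std_rep n id = 1\<^sub>m (n - 1)"
  by (rule eq_matI) (auto simp: std_rep_def)

lemma std_rep_is_rep: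
  assumes "2 \<le> n"
  shows "is_rep n (n - 1) (std_rep n)"
proof -
  have "\<exists>B\<in>carrier_mat (n - 1) (n - 1). B * std_rep n p = 1\<^sub>m (n - 1) \<and> std_rep n p * B = 1\<^sub>m (n - 1)"
    if p: "p permutes {1..n}" for p
  proof (rule bexI, rule conjI)
    note i = permutes_inv [OF p]
    show "std_rep n (Hilbert_Choice.inv p) * std_rep n p = 1\<^sub>m (n - 1)"
      using std_rep_mult [OF assms i p] permutes_inv_o(2) [OF p] std_rep_id [OF assms] by simp
    show "std_rep n p * std_rep n (Hilbert_Choice.inv p) = 1\<^sub>m (n - 1)"
      using std_rep_mult [OF assms p i] permutes_inv_o(1) [OF p] std_rep_id [OF assms] by simp
  qed (rule std_rep_carrier)
  then show ?thesis
    using std_rep_mult [OF assms] std_rep_carrier [of n]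
    by (auto simp: is_rep_def hom_def units_of_def Units_def ring_mat_def sym_group_def simp del: One_nat_def)
qed

lemma std_rep_vec:
  assumes n: "2 \<le> n" and p: "p permutes {1..n}" and v: "v \<in> carrier_vec (n - 1)" and i: "i < n - 1"
  shows "(std_rep n p *\<^sub>v v) $ i = ext_vec n v (Hilbert_Choice.inv p (Suc i))"
proof -
  define k where "k = Hilbert_Choice.inv p (Suc i)"
  have eq: "p x = Suc i \<longleftrightarrow> k = x" for x
    unfolding k_def using permutes_inv_eq [OF p, of "Suc i" x] by auto
  have k: "k \<in> {1..n}" unfolding k_def using permutes_in_image [OF permutes_inv [OF p], of "Suc i"] i by auto
  have "(std_rep n p *\<^sub>v v) $ i = (\<Sum>j<n - 1. (of_bool (k = Suc j) - of_bool (k = n)) * v $ j)"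
    using i v by (simp add: std_rep_def scalar_prod_def atLeast0LessThan eq)
  also have "\<dots> = (\<Sum>j<n - 1. of_bool (k = Suc j) * v $ (Suc j - 1)) - of_bool (k = n) * (\<Sum>j<n - 1. v $ j)"
    by (simp add: left_diff_distrib sum_subtractf sum_distrib_left)
  also have "\<dots> = ext_vec n v k"
    unfolding sum_shift_delta [of k "\<lambda>x. v $ (x - 1)"] ext_vec_def using k by auto
  finally show ?thesis unfolding k_def .
qed

lemma ext_root_vec:
  assumes "a \<in> {1..n}" "b \<in> {1..n}" "k \<in> {1..n}"
  shows "ext_vec n (root_vec n a b) k = of_bool (k = a) - of_bool (k = b)"
proof -
  have s: "(\<Sum>j<n - 1. of_bool (Suc j = x)) = (of_bool (x \<noteq> n) :: complex)" if "x \<in> {1..n}" for x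
  proof -
    have "(\<Sum>j<n - 1. of_bool (Suc j = x)) = (\<Sum>j<n - 1. of_bool (x = Suc j) * (1 :: complex))"
      by (rule sum.cong [OF refl]) auto
    also have "\<dots> = (if x \<in> {1..n - 1} then 1 else 0)" by (rule sum_shift_delta)
    also have "\<dots> = of_bool (x \<noteq> n)" using that by auto
    finally show ?thesis .
  qed
  have "(\<Sum>j<n - 1. root_vec n a b $ j) = of_bool (a \<noteq> n) - of_bool (b \<noteq> n)"
    using s assms by (simp add: root_vec_def sum_subtractf)
  then show ?thesis using assms by (auto simp: ext_vec_def root_vec_def of_bool_def)
qed

lemma std_rep_root_vec:
  assumes n: "2 \<le> n" and p: "p permutes {1..n}" and ab: "a \<in> {1..n}" "b \<in> {1..n}"
  shows "std_rep n p *\<^sub>v root_vec n a b = root_vec n (p a) (p b)"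
proof (rule eq_vecI)
  fix i assume "i < dim_vec (root_vec n (p a) (p b))"
  then have i: "i < n - 1" by (simp add: root_vec_def)
  have eq: "Hilbert_Choice.inv p (Suc i) = x \<longleftrightarrow> Suc i = p x" for x
    using permutes_inv_eq [OF p, of "Suc i" x] by auto
  have k: "Hilbert_Choice.inv p (Suc i) \<in> {1..n}" using permutes_in_image [OF permutes_inv [OF p], of "Suc i"] i by auto
  have "(std_rep n p *\<^sub>v root_vec n a b) $ i = ext_vec n (root_vec n a b) (Hilbert_Choice.inv p (Suc i))"
    by (rule std_rep_vec [OF n p _ i]) (simp add: root_vec_def)
  also have "\<dots> = of_bool (Suc i = p a) - of_bool (Suc i = p b)"
    unfolding ext_root_vec [OF ab k] eq ..
  finally show "(std_rep n p *\<^sub>v root_vec n a b) $ i = root_vec n (p a) (p b) $ i"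
    using i by (simp add: root_vec_def)
qed (simp add: root_vec_def std_rep_def)

lemma subspaceD_vec:
  assumes "VectorSpace.subspace class_ring W (module_vec TYPE(complex) d)"
  shows "W \<subseteq> carrier_vec d" "0\<^sub>v d \<in> W" "\<And>v w. v \<in> W \<Longrightarrow> w \<in> W \<Longrightarrow> v + w \<in> W"
    "\<And>c v. v \<in> W \<Longrightarrow> c \<cdot>\<^sub>v v \<in> W"
proof -
  interpret vectorspace "class_ring :: complex ring" "module_vec TYPE(complex) d" by (rule vec_vs)
  have "LinearCombinations.submodule class_ring W (module_vec TYPE(complex) d)"
    using assms by (simp add: subspace_def)
  then show "W \<subseteq> carrier_vec d" "0\<^sub>v d \<in> W" "\<And>v w. v \<in> W \<Longrightarrow> w \<in> W \<Longrightarrow> v + w \<in> W"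
    "\<And>c v. v \<in> W \<Longrightarrow> c \<cdot>\<^sub>v v \<in> W"
    unfolding submodule_def submodule_axioms_def by (auto simp: module_vec_simps)
qed

text \<open>Needed so that the maximum in \<open>lambda_Sn\<close> is over a nonempty set. A nonzero
  vector of coordinate sum 0 has two different coordinates a and b; subtracting its image under
  their transposition leaves a multiple of e_a - e_b, whose images contain the basis.\<close>

lemma std_rep_irreducible:
  assumes n: "2 \<le> n"
  shows "irreducible_rep n (n - 1) (std_rep n)"
  unfolding irreducible_rep_def
proof (intro conjI allI impI)
  show "is_rep n (n - 1) (std_rep n)" by (rule std_rep_is_rep [OF n])
  show "0 < n - 1" using n by simp
  fix W assume W: "VectorSpace.subspace class_ring W (module_vec TYPE(complex) (n - 1)) \<and>
    (\<forall>\<sigma>\<in>carrier (sym_group n). \<forall>w\<in>W. std_rep n \<sigma> *\<^sub>v w \<in> W)"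
  note sub = subspaceD_vec [OF conjunct1 [OF W]]
  have inv: "std_rep n p *\<^sub>v w \<in> W" if "p permutes {1..n}" "w \<in> W" for p w
    using W that by (simp add: sym_group_def)
  show "W = {0\<^sub>v (n - 1)} \<or> W = carrier_vec (n - 1)"
  proof (cases "W = {0\<^sub>v (n - 1)}")
    case False
    then obtain w where w: "w \<in> W" "w \<noteq> 0\<^sub>v (n - 1)" using sub(2) by blast
    then have wc: "w \<in> carrier_vec (n - 1)" using sub(1) by blast
    have "\<exists>a\<in>{1..n}. \<exists>b\<in>{1..n}. ext_vec n w a \<noteq> ext_vec n w b"
    proof (rule ccontr)
      assume c: "\<not> (\<exists>a\<in>{1..n}. \<exists>b\<in>{1..n}. ext_vec n w a \<noteq> ext_vec n w b)"
      have "n \<in> {1..n}" using n by simp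
      then have e: "ext_vec n w a = ext_vec n w n" if "a \<in> {1..n}" for a using that c by blast
      have wi: "w $ j = ext_vec n w n" if "j < n - 1" for j
      proof -
        have "ext_vec n w (Suc j) = w $ j" using that by (simp add: ext_vec_def)
        then show ?thesis using e [of "Suc j"] that by simp
      qed
      have "ext_vec n w n = - (\<Sum>j<n - 1. w $ j)" by (simp add: ext_vec_def)
      also have "(\<Sum>j<n - 1. w $ j) = (\<Sum>j<n - 1. ext_vec n w n)"
        by (rule sum.cong [OF refl]) (simp add: wi)
      finally have "of_nat n * ext_vec n w n = 0" using n by (simp add: of_nat_diff algebra_simps)
      then have "ext_vec n w n = 0" using n by simp
      then have "w = 0\<^sub>v (n - 1)" using wi wc by (intro eq_vecI) auto
      then show False using w(2) by blast
    qed
    then obtain a b where ab: "a \<in> {1..n}" "b \<in> {1..n}" "ext_vec n w a \<noteq> ext_vec n w b" by blast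
    define k where "k = ext_vec n w a - ext_vec n w b"
    define s where "s = Transposition.transpose a b"
    have s: "s permutes {1..n}" unfolding s_def by (rule permutes_swap_id [OF ab(1,2)])
    have inv_s: "Hilbert_Choice.inv s = s" by (simp add: s_def)
    have k0: "k \<noteq> 0" "a \<noteq> b" using ab by (auto simp: k_def)
    have "root_vec n a b = (1 / k) \<cdot>\<^sub>v (w + (-1) \<cdot>\<^sub>v (std_rep n s *\<^sub>v w))"
    proof (rule eq_vecI)
      fix i assume "i < dim_vec ((1 / k) \<cdot>\<^sub>v (w + (-1) \<cdot>\<^sub>v (std_rep n s *\<^sub>v w)))"
      then have i: "i < n - 1" by (simp add: std_rep_def)
      have "(std_rep n s *\<^sub>v w) $ i = ext_vec n w (s (Suc i))"
        using std_rep_vec [OF n s wc i] unfolding inv_s .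
      moreover have "w $ i = ext_vec n w (Suc i)" using i by (simp add: ext_vec_def)
      ultimately have "((1 / k) \<cdot>\<^sub>v (w + (-1) \<cdot>\<^sub>v (std_rep n s *\<^sub>v w))) $ i =
          (ext_vec n w (Suc i) - ext_vec n w (s (Suc i))) / k"
        using i wc by (simp add: std_rep_def)
      also have "\<dots> = of_bool (Suc i = a) - of_bool (Suc i = b)"
      proof -
        consider "Suc i = a" | "Suc i = b" | "Suc i \<noteq> a" "Suc i \<noteq> b" by blast
        then show ?thesis
        proof cases
          case 1
          then have "s (Suc i) = b" by (simp add: s_def)
          then show ?thesis using 1 k0 by (simp add: k_def)
        next
          case 2
          then have "s (Suc i) = a" by (simp add: s_def)
          moreover have "ext_vec n w b - ext_vec n w a = - k" by (simp add: k_def)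
          ultimately show ?thesis using 2 k0 by simp
        qed (simp add: s_def)
      qed
      finally show "root_vec n a b $ i = ((1 / k) \<cdot>\<^sub>v (w + (-1) \<cdot>\<^sub>v (std_rep n s *\<^sub>v w))) $ i"
        using i by (simp add: root_vec_def)
    qed (simp add: root_vec_def std_rep_def)
    then have rW: "root_vec n a b \<in> W" using sub(3,4) inv [OF s w(1)] w(1) by simp
    have unit: "unit_vec (n - 1) i \<in> W" if i: "i < n - 1" for i
    proof -
      \<comment> \<open>Where \<open>b\<close> lands once \<open>a\<close> has been moved to
        \<open>Suc i\<close>; a second transposition takes it on to \<open>n\<close>, which turns
        the root vector into a unit vector.\<close>
      define b' where "b' = Transposition.transpose a (Suc i) b"
      have b': "b' \<in> {1..n}" "b' \<noteq> Suc i" using ab k0(2) i by (auto simp: b'_def Transposition.transpose_def)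
      define p where "p = Transposition.transpose b' n \<circ> Transposition.transpose a (Suc i)"
      have p: "p permutes {1..n}"
        unfolding p_def by (intro permutes_compose permutes_swap_id) (use ab b' i n in auto)
      have pa: "p a = Suc i" using b' i by (simp add: p_def)
      have pb: "p b = n" by (simp add: p_def b'_def [symmetric])
      have "std_rep n p *\<^sub>v root_vec n a b = root_vec n (Suc i) n"
        using std_rep_root_vec [OF n p ab(1,2)] unfolding pa pb .
      also have "\<dots> = unit_vec (n - 1) i"
        by (rule eq_vecI) (use i in \<open>auto simp: root_vec_def\<close>)
      finally show ?thesis using inv [OF p rW] by simp
    qed
    have "v \<in> W" if v: "v \<in> carrier_vec (n - 1)" for v
    proof -
      have "vec (n - 1) (\<lambda>i. if i < m then v $ i else 0) \<in> W" if "m \<le> n - 1" for m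
        using that
      proof (induction m)
        case 0
        have "vec (n - 1) (\<lambda>i. if i < 0 then v $ i else 0) = 0\<^sub>v (n - 1)" by (rule eq_vecI) auto
        then show ?case using sub(2) by simp
      next
        case (Suc m)
        have "vec (n - 1) (\<lambda>i. if i < Suc m then v $ i else 0) =
            vec (n - 1) (\<lambda>i. if i < m then v $ i else 0) + v $ m \<cdot>\<^sub>v unit_vec (n - 1) m"
          by (rule eq_vecI) (use Suc.prems in \<open>auto simp: less_Suc_eq\<close>)
        then show ?case using Suc sub(3,4) unit [of m] by simp
      qed
      from this [of "n - 1"] have "vec (n - 1) (\<lambda>i. if i < n - 1 then v $ i else 0) \<in> W" by simp
      moreover have "vec (n - 1) (\<lambda>i. if i < n - 1 then v $ i else 0) = v"
        by (rule eq_vecI) (use v in auto)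
      ultimately show ?thesis by simp
    qed
    then have "carrier_vec (n - 1) \<subseteq> W" by (rule subsetI)
    then have "W = carrier_vec (n - 1)" by (rule subset_antisym [OF sub(1)])
    then show ?thesis by (rule disjI2)
  qed simp
qed

text \<open>The degrees differ once \<open>n \<ge> 3\<close>; for \<open>n = 2\<close> the standard
  representation is the sign.\<close>

lemma std_rep_not_isomorphic:
  assumes n: "3 \<le> n" and d: "\<And>\<sigma>. \<rho>' \<sigma> \<in> carrier_mat 1 1"
  shows "\<not> isomorphic_reps n (std_rep n) \<rho>'"
proof
  assume "isomorphic_reps n (std_rep n) \<rho>'"
  moreover have "id \<in> carrier (sym_group n)" by (simp add: sym_group_def permutes_id)
  ultimately obtain P Q where "similar_mat_wit (std_rep n id) (\<rho>' id) P Q"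
    unfolding isomorphic_reps_def by blast
  then have "\<rho>' id \<in> carrier_mat (n - 1) (n - 1)"
    by (rule similar_mat_witD2(5) [OF std_rep_carrier])
  then have "dim_row (\<rho>' id) = n - 1" by (rule carrier_matD(1))
  moreover have "dim_row (\<rho>' id) = 1" using d by (rule carrier_matD(1))
  ultimately show False using n by simp
qed

subsection \<open>The spectral gap\<close>

definition loss_bound :: "nat \<Rightarrow> real \<Rightarrow> bool" where
  "loss_bound n \<eta> \<longleftrightarrow> (\<forall>r s. proper_sph {1..n} r \<longrightarrow> s \<in> Sym {1..n} \<longrightarrow>
     r s \<le> 1 - (1 - \<eta>) * (card (affected s) / (real n - 1)))"

text \<open>The least admissible error for each \<open>n\<close>, which turns a threshold for every
  \<eta> into one sequence. The error 1 is always admissible, so the infimum is over a nonempty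
  set.\<close>

definition loss :: "nat \<Rightarrow> real" where
  "loss n = Inf {\<eta>. 0 \<le> \<eta> \<and> loss_bound n \<eta>}"

lemma proper_sph_le_one:
  assumes "proper_sph {1..n::nat} r" "s \<in> Sym {1..n}"
  shows "r s \<le> 1"
proof -
  have "sph (Sym {1..n}) r" using assms(1) by (simp add: proper_sph_def)
  then have "\<bar>r s\<bar> \<le> 1" using assms(2) by (intro sph_Sym_facts(6) [of "{1..n}"]) simp_all
  then show ?thesis by simp
qed

text \<open>The infimum is attained: a pair \<open>r\<close>, \<open>s\<close> with
  \<open>q > 0\<close> imposes a lower bound on \<eta>, and for \<open>q = 0\<close> the condition
  does not involve \<eta>.\<close>

lemma loss_bound_loss:
  assumes n: "2 \<le> n"
  shows "loss_bound n (loss n)"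
  unfolding loss_bound_def
proof (intro allI impI)
  fix r s assume rs: "proper_sph {1..n} r" "s \<in> Sym {1..n}"
  define q where "q = card (affected s) / (real n - 1)"
  define E where "E = {\<eta>. 0 \<le> \<eta> \<and> loss_bound n \<eta>}"
  have 1: "1 \<in> E" using proper_sph_le_one by (simp add: E_def loss_bound_def)
  have q: "0 \<le> q" using n by (simp add: q_def)
  have e: "r s \<le> 1 - (1 - \<eta>) * q" if "\<eta> \<in> E" for \<eta>
    using that rs by (simp add: E_def loss_bound_def q_def)
  show "r s \<le> 1 - (1 - loss n) * (card (affected s) / (real n - 1))"
  proof (cases "q = 0")
    case True
    show ?thesis unfolding q_def [symmetric] True using proper_sph_le_one [OF rs] by simp
  next
    case False
    then have q: "0 < q" using q by simp
    have "(r s - 1 + q) / q \<le> Inf E"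
    proof (rule cInf_greatest)
      show "E \<noteq> {}" using 1 by blast
      fix \<eta> assume "\<eta> \<in> E"
      then have "r s - 1 + q \<le> \<eta> * q" using e [of \<eta>] by (simp add: algebra_simps)
      then show "(r s - 1 + q) / q \<le> \<eta>" using q by (simp add: divide_le_eq)
    qed
    then have "r s - 1 + q \<le> loss n * q" using q by (simp add: divide_le_eq loss_def E_def)
    then show ?thesis unfolding q_def [symmetric] by (simp add: algebra_simps)
  qed
qed

lemma loss_tendsto: "loss \<longlonglongrightarrow> 0"
proof (rule LIMSEQ_I)
  fix e :: real assume e: "0 < e"
  then have "0 < e / 2" by simp
  then obtain N where N: "\<And>(S::nat set) r s. finite S \<Longrightarrow> N \<le> card S \<Longrightarrow> proper_sph S r \<Longrightarrow> s \<in> Sym S \<Longrightarrow>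
    r s \<le> 1 - (1 - e / 2) * (card (affected s) / (real (card S) - 1))"
    by (rule uniform_character_bound [where 'a = nat]) blast
  have "norm (loss n - 0) < e" if n: "N \<le> n" for n
  proof -
    have m: "e / 2 \<in> {\<eta>. 0 \<le> \<eta> \<and> loss_bound n \<eta>}"
      using N [of "{1..n}"] n e by (simp add: loss_bound_def)
    have "0 \<le> loss n"
      unfolding loss_def by (rule cInf_greatest) (use m in blast, simp)
    moreover have "loss n \<le> e / 2" unfolding loss_def
      by (rule cInf_lower [OF m]) (rule bdd_belowI [of _ 0], simp)
    ultimately show ?thesis using e by simp
  qed
  then show "\<exists>no. \<forall>n\<ge>no. norm (loss n - 0) < e" by blast
qed

text \<open>\<open>Max\<close> is meaningful because the values come from finitely many spherical
  functions and the standard representation contributes one.\<close>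

lemma lambda_Sn_attained:
  assumes n: "3 \<le> n" and nrm: "normal_elem n \<alpha>"
  obtains r where "proper_sph {1..n} r" "lambda_Sn n \<alpha> = (\<Sum>g\<in>Sym {1..n}. \<alpha> ((\<langle>$\<rangle>) g) * r g)"
proof -
  define E where "E = {largest_eigenvalue (rep_elem n d \<rho> \<alpha>) | d \<rho>. irreducible_rep n d \<rho> \<and>
    \<not> isomorphic_reps n \<rho> triv_rep \<and> \<not> isomorphic_reps n \<rho> sgn_rep}"
  define val where "val r = (\<Sum>g\<in>Sym {1..n}. \<alpha> ((\<langle>$\<rangle>) g) * r g)" for r
  have val: "\<exists>r. proper_sph {1..n} r \<and> x = val r" if x: "x \<in> E" for x
  proof -
    obtain d \<rho> where \<rho>: "x = largest_eigenvalue (rep_elem n d \<rho> \<alpha>)" "irreducible_rep n d \<rho>"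
      "\<not> isomorphic_reps n \<rho> triv_rep" "\<not> isomorphic_reps n \<rho> sgn_rep"
      using x unfolding E_def by blast
    interpret irrep n d \<rho> using \<rho>(2) by unfold_locales
    obtain r where r: "proper_sph {1..n} r" "\<And>g. g \<in> Sym {1..n} \<Longrightarrow> \<chi> g = of_real (r g)"
      using proper_character [OF \<rho>(3,4)] by blast
    have "x = val r" unfolding \<rho>(1) val_def by (rule largest_eigenvalue_rep_elem [OF nrm r(2)])
    then show ?thesis using r(1) by blast
  qed
  interpret A: ambivalent_group "Sym {1..n}" by (rule ambivalent_Sym) simp
  obtain m :: nat and R where R: "\<And>s :: nat perm \<Rightarrow> real. sph (Sym {1..n}) s \<Longrightarrow>
      \<exists>i<m. \<forall>h\<in>Sym {1..n}. s h = of_real (R i h)"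
    using A.spherical_finite [where 'a = real] by blast
  have "E \<subseteq> (\<lambda>i. val (R i)) ` {..<m}"
  proof
    fix x assume "x \<in> E"
    then obtain r where r: "proper_sph {1..n} r" "x = val r" using val by blast
    then obtain i where i: "i < m" "\<forall>h\<in>Sym {1..n}. r h = of_real (R i h)"
      using R [of r] by (auto simp: proper_sph_def)
    have "val r = val (R i)" unfolding val_def by (rule sum.cong [OF refl]) (simp add: i(2))
    then show "x \<in> (\<lambda>i. val (R i)) ` {..<m}" using i(1) r(2) by blast
  qed
  then have fin: "finite E" by (rule finite_subset) simp
  have "\<not> isomorphic_reps n (std_rep n) triv_rep"
    by (rule std_rep_not_isomorphic [OF n]) (simp add: triv_rep_def)
  moreover have "\<not> isomorphic_reps n (std_rep n) sgn_rep"
    by (rule std_rep_not_isomorphic [OF n]) (simp add: sgn_rep_def)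
  moreover have "irreducible_rep n (n - 1) (std_rep n)"
    by (rule std_rep_irreducible) (use n in simp)
  ultimately have "largest_eigenvalue (rep_elem n (n - 1) (std_rep n) \<alpha>) \<in> E"
    unfolding E_def by blast
  then have "E \<noteq> {}" by blast
  then have "Max E \<in> E" by (rule Max_in [OF fin])
  then obtain r where "proper_sph {1..n} r" "Max E = val r" using val by blast
  then show thesis using that unfolding lambda_Sn_def E_def [symmetric] val_def by blast
qed

theorem theorem1p10:
  shows "\<exists>\<delta> :: nat \<Rightarrow> real. \<delta> \<longlonglongrightarrow> 0 \<and>
    (\<forall>n\<ge>3. \<forall>\<alpha> :: (nat \<Rightarrow> nat) \<Rightarrow> real.
       nonneg_elem n \<alpha> \<longrightarrow> normal_elem n \<alpha> \<longrightarrow>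
       total_weight n \<alpha> - lambda_Sn n \<alpha> \<ge>
         (total_weight n \<alpha> - lambda_schreier n \<alpha>) * (1 - \<delta> n))"
proof (rule exI [of _ loss], intro conjI allI impI)
  show "loss \<longlonglongrightarrow> 0" by (rule loss_tendsto)
  fix n :: nat and \<alpha> :: "(nat \<Rightarrow> nat) \<Rightarrow> real"
  assume n: "3 \<le> n" and nn: "nonneg_elem n \<alpha>" and nrm: "normal_elem n \<alpha>"
  define a where "a g = \<alpha> ((\<langle>$\<rangle>) g)" for g
  define q where "q s = card (affected s) / (real n - 1)" for s :: "nat perm"
  let ?G = "Sym {1..n}"
  obtain r where r: "proper_sph {1..n} r" "lambda_Sn n \<alpha> = (\<Sum>g\<in>?G. a g * r g)"
    using lambda_Sn_attained [OF n nrm] unfolding a_def by blast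
  have tw: "total_weight n \<alpha> = (\<Sum>g\<in>?G. a g)" unfolding total_weight_def a_def by (rule sum_carrier)
  have a0: "0 \<le> a g" if "g \<in> ?G" for g
    using nn that Sym_permutes [OF that] by (simp add: nonneg_elem_def a_def sym_group_def)
  have "lambda_schreier n \<alpha> = (\<Sum>g\<in>?G. a g * (1 - q g))"
  proof -
    have "lambda_schreier n \<alpha> = (\<Sum>g\<in>?G. a g * (real (card {x\<in>{1..n}. g \<langle>$\<rangle> x = x}) - 1) / (real n - 1))"
      unfolding a_def by (rule lambda_schreier_eq) (use n nrm in simp_all)
    also have "\<dots> = (\<Sum>g\<in>?G. a g * (1 - q g))"
    proof (rule sum.cong [OF refl])
      fix g assume g: "g \<in> ?G"
      have c: "real (card {x\<in>{1..n}. g \<langle>$\<rangle> x = x}) = real n - card (affected g)"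
        using card_fixed [OF finite_atLeastAtMost g] by (simp only: card_atLeastAtMost diff_Suc_1 add_diff_cancel_right' Suc_eq_plus1)
      show "a g * (real (card {x\<in>{1..n}. g \<langle>$\<rangle> x = x}) - 1) / (real n - 1) = a g * (1 - q g)"
        unfolding c q_def using n by (simp add: field_simps)
    qed
    finally show ?thesis .
  qed
  \<comment> \<open>Both sides become sums with the nonnegative weights \<open>a g\<close>, so the
    character bound can be applied termwise.\<close>
  then have "(total_weight n \<alpha> - lambda_schreier n \<alpha>) * (1 - loss n) = (\<Sum>g\<in>?G. a g * ((1 - loss n) * q g))"
    unfolding tw by (simp add: sum_distrib_left sum_distrib_right algebra_simps flip: sum_subtractf)
  also have "\<dots> \<le> (\<Sum>g\<in>?G. a g * (1 - r g))"
  proof (rule sum_mono)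
    fix g assume g: "g \<in> ?G"
    have "r g \<le> 1 - (1 - loss n) * q g"
      using loss_bound_loss [of n] n r(1) g by (simp add: loss_bound_def q_def)
    then have "(1 - loss n) * q g \<le> 1 - r g" by simp
    then show "a g * ((1 - loss n) * q g) \<le> a g * (1 - r g)" by (rule mult_left_mono) (rule a0 [OF g])
  qed
  also have "\<dots> = total_weight n \<alpha> - lambda_Sn n \<alpha>"
    unfolding tw r(2) by (simp add: right_diff_distrib sum_subtractf)
  finally show "total_weight n \<alpha> - lambda_Sn n \<alpha> \<ge> (total_weight n \<alpha> - lambda_schreier n \<alpha>) * (1 - loss n)" .
qed

end
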